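(* Let $(\alpha, \beta)$ be an admissible pair and let $2 < k < j$ be integers. Then \[ r(C_{2k+1}, W_{2j}) \le \frac{3j + \beta}{1 - \alpha}. \]
   Context: For reals $\alpha \in [\frac14, 1)$ and $\beta > 0$, $(\alpha,\beta)$ is called an admissible pair if every $2$-connected non-bipartite graph $G$ on $n$ vertices with minimum degree $\delta(G) \ge \alpha n + \beta$ contains a cycle $C_t$ for every $t$ with $6 \le t \le c(G)$, where $c(G)$ (the circumference) is the length of a longest cycle of $G$. $C_n$ is the cycle on $n$ vertices and the wheel $W_m := C_m \ast K_1$ is obtained from $C_m$ by adding a new vertex adjacent to all vertices of the cycle. The Ramsey number $r(F,H)$ is the smallest integer $N$ such that every red-blue coloring of the edges of $K_N$ contains a red copy of $F$ or a blue copy of $H$. *)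

theory Defs
  imports Complex_Main
begin

text \<open>
  A graph is a pair of a vertex set and a set of edges, where an edge is a two-element set of
  vertices; well-formedness and finiteness are imposed by \<open>fin_graph\<close>.
\<close>

type_synonym 'a graph = "'a set \<times> 'a set set"

abbreviation verts :: "'a graph \<Rightarrow> 'a set" where
  "verts G \<equiv> fst G"

abbreviation edges :: "'a graph \<Rightarrow> 'a set set" where
  "edges G \<equiv> snd G"

definition fin_graph :: "'a graph \<Rightarrow> bool" where
  "fin_graph G \<longleftrightarrow> finite (verts G) \<and> (\<forall>e\<in>edges G. e \<subseteq> verts G \<and> card e = 2)"

text \<open>A copy of \<open>H\<close> in \<open>G\<close> is a not necessarily induced subgraph of \<open>G\<close> isomorphic to \<open>H\<close>.\<close>

definition contains_copy :: "'a graph \<Rightarrow> 'b graph \<Rightarrow> bool" where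
  "contains_copy G H \<longleftrightarrow>
     (\<exists>f. inj_on f (verts H) \<and> f ` verts H \<subseteq> verts G \<and> (\<forall>e\<in>edges H. f ` e \<in> edges G))"

definition complete_graph :: "nat \<Rightarrow> nat graph" where
  "complete_graph n = ({..<n}, {e. e \<subseteq> {..<n} \<and> card e = 2})"

text \<open>This is a cycle only for \<open>n \<ge> 3\<close>.\<close>

definition cycle_graph :: "nat \<Rightarrow> nat graph" where
  "cycle_graph n = ({..<n}, {{i, Suc i mod n} |i. i < n})"

definition graph_join :: "'a graph \<Rightarrow> 'b graph \<Rightarrow> ('a + 'b) graph" where
  "graph_join G H =
     (verts G <+> verts H,
      (`) Inl ` edges G \<union> (`) Inr ` edges H \<union> {{Inl u, Inr v} |u v. u \<in> verts G \<and> v \<in> verts H})"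

definition wheel_graph :: "nat \<Rightarrow> (nat + nat) graph" where
  "wheel_graph m = graph_join (cycle_graph m) (complete_graph 1)"

definition degree :: "'a graph \<Rightarrow> 'a \<Rightarrow> nat" where
  "degree G v = card {e \<in> edges G. v \<in> e}"

definition min_degree :: "'a graph \<Rightarrow> nat" where
  "min_degree G = Min (degree G ` verts G)"

definition bipartite :: "'a graph \<Rightarrow> bool" where
  "bipartite G \<longleftrightarrow>
     (\<exists>A B. A \<union> B = verts G \<and> A \<inter> B = {} \<and> (\<forall>e\<in>edges G. \<exists>a\<in>A. \<exists>b\<in>B. e = {a, b}))"

definition connected_graph :: "'a graph \<Rightarrow> bool" where
  "connected_graph G \<longleftrightarrow>
     verts G \<noteq> {} \<and> (\<forall>u\<in>verts G. \<forall>v\<in>verts G. (u, v) \<in> {(x, y). {x, y} \<in> edges G}\<^sup>*)"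

definition delete_verts :: "'a graph \<Rightarrow> 'a set \<Rightarrow> 'a graph" where
  "delete_verts G S = (verts G - S, {e \<in> edges G. e \<inter> S = {}})"

definition k_connected :: "nat \<Rightarrow> 'a graph \<Rightarrow> bool" where
  "k_connected k G \<longleftrightarrow>
     card (verts G) > k \<and> (\<forall>S \<subseteq> verts G. card S < k \<longrightarrow> connected_graph (delete_verts G S))"

text \<open>For a finite graph this is a maximum, with value 0 if there is no cycle.\<close>

definition circumference :: "'a graph \<Rightarrow> nat" where
  "circumference G = Sup {t. t \<ge> 3 \<and> contains_copy G (cycle_graph t)}"

text \<open>
  Every finite graph is isomorphic to one whose vertices are natural numbers, so quantifying over
  \<^typ>\<open>nat graph\<close> covers all finite graphs.
\<close>

definition admissible_pair :: "real \<Rightarrow> real \<Rightarrow> bool" where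
  "admissible_pair \<alpha> \<beta> \<longleftrightarrow>
     1 / 4 \<le> \<alpha> \<and> \<alpha> < 1 \<and> \<beta> > 0 \<and>
     (\<forall>G :: nat graph.
        fin_graph G \<and> k_connected 2 G \<and> \<not> bipartite G \<and>
        real (min_degree G) \<ge> \<alpha> * real (card (verts G)) + \<beta> \<longrightarrow>
        (\<forall>t. 6 \<le> t \<and> t \<le> circumference G \<longrightarrow> contains_copy G (cycle_graph t)))"

text \<open>
  A red-blue coloring of the edges of the complete graph is given by its set \<open>R\<close> of red edges, all
  other edges being blue.
\<close>

definition ramsey_property :: "nat \<Rightarrow> 'a graph \<Rightarrow> 'b graph \<Rightarrow> bool" where
  "ramsey_property N F H \<longleftrightarrow>
     (\<forall>R \<subseteq> edges (complete_graph N).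
        contains_copy (verts (complete_graph N), R) F \<or>
        contains_copy (verts (complete_graph N), edges (complete_graph N) - R) H)"

text \<open>For finite \<open>F\<close> and \<open>H\<close> the minimum exists by Ramsey's theorem.\<close>

definition ramsey_number :: "'a graph \<Rightarrow> 'b graph \<Rightarrow> nat" where
  "ramsey_number F H = (LEAST N. ramsey_property N F H)"

end

theory Submission
  imports Defs
begin

text \<open>
  A cycle of length 6 is missing in a Hamiltonian, 2-connected, non-bipartite graph with 13 vertices and minimum degree 4, so
  \<open>13\<alpha> + \<beta> > 4\<close>; hence \<open>N = \<lfloor>(3j + \<beta>) / (1 - \<alpha>)\<rfloor> \<ge> 4j + 1\<close>. Consider a coloring of \<open>K\<^sub>N\<close> with neither a red
  \<open>C\<^sub>2\<^sub>k\<^sub>+\<^sub>1\<close> nor a blue \<open>W\<^sub>2\<^sub>j\<close>.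

  If some vertex has at least \<open>3j - 1\<close> blue neighbours, these contain no blue \<open>C\<^sub>2\<^sub>j\<close>. Then all of them but one split into two
  blue cliques that are completely joined in red. The vertices outside have few red neighbours in these cliques, and a blue
  wheel appears whose rim alternates between one of the cliques and the outside.

  Otherwise all red degrees are at least \<open>N + 1 - 3j \<ge> \<alpha>N + \<beta>\<close>. The red graph is not bipartite, since one of the sides would be
  a large blue clique; it is 2-connected, since the blue complete bipartite graph across a cut leaves almost no blue
  neighbours within a side, which is therefore pancyclic in red; and rotating a longest red path shows that its circumference is at
  least \<open>2k + 1\<close>. So admissibility yields a red \<open>C\<^sub>2\<^sub>k\<^sub>+\<^sub>1\<close>.
\<close>

section \<open>Paths and cycles as lists\<close>

text \<open>A set of \<open>3j - 1\<close> vertices need not contain a red cycle of length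
  \<open>2k + 1\<close> or a blue one of length \<open>2j\<close>: two blue cliques with at most
  \<open>2j - 1\<close> vertices each, completely joined in red, contain neither. So the blue
  neighbourhood of a vertex can only be described, not excluded, and the wheel has to use vertices
  outside it. The inequality \<open>4j + 1 \<le> N\<close> carries the rest: two sets with at most
  \<open>2j\<close> vertices each never cover all vertices. The conditions
  \<open>\<alpha> \<ge> 1/4\<close> and \<open>\<beta> > 0\<close> by themselves only guarantee a
  bound above \<open>4j\<close>, so something must be extracted from admissibility itself; the order
  13 and the degree 4 of the ring graph supply exactly the missing vertex. The border between the
  two cases comes from rounding: \<open>N + 1\<close> exceeds the bound, so
  \<open>(N + 1)(1 - \<alpha>) > 3j + \<beta>\<close>, and the red degree \<open>N + 1 - 3j\<close>
  left by at most \<open>3j - 2\<close> blue neighbours still suffices.\<close>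

definition cyc :: "('a \<Rightarrow> 'a \<Rightarrow> bool) \<Rightarrow> 'a list \<Rightarrow> bool" where
  "cyc E xs \<longleftrightarrow> xs \<noteq> [] \<and> distinct xs \<and> successively E xs \<and> E (last xs) (hd xs)"

text \<open>An edge counts as a cycle of length 2 here.\<close>

definition has_cycle :: "('a \<Rightarrow> 'a \<Rightarrow> bool) \<Rightarrow> 'a set \<Rightarrow> nat \<Rightarrow> bool" where
  "has_cycle E S n \<longleftrightarrow> (\<exists>xs. cyc E xs \<and> set xs \<subseteq> S \<and> length xs = n)"

lemma has_cycleI: "cyc E xs \<Longrightarrow> set xs \<subseteq> S \<Longrightarrow> length xs = n \<Longrightarrow> has_cycle E S n"
  by (auto simp: has_cycle_def)

lemma has_cycle_mono: "has_cycle E S n \<Longrightarrow> S \<subseteq> T \<Longrightarrow> has_cycle E T n"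
  by (auto simp: has_cycle_def)

lemma has_cycle_le_card: "has_cycle E S n \<Longrightarrow> finite S \<Longrightarrow> n \<le> card S"
  by (auto simp: has_cycle_def cyc_def dest!: distinct_card[symmetric] intro: card_mono)

lemma cyc_append_commute: "cyc E (xs @ ys) \<Longrightarrow> cyc E (ys @ xs)"
  by (cases "xs = []"; cases "ys = []") (auto simp: cyc_def successively_append_iff)

lemma cyc_rotate: "cyc E xs \<Longrightarrow> cyc E (rotate n xs)"
proof (induction n)
  case (Suc n)
  then have "cyc E (rotate n xs)" by simp
  moreover have "ys \<noteq> [] \<Longrightarrow> rotate1 ys = tl ys @ [hd ys]" for ys :: "'a list"
    by (cases ys) auto
  moreover have "rotate n xs \<noteq> []" using Suc.prems by (simp add: cyc_def)
  ultimately show ?case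
    using cyc_append_commute[of E "[hd (rotate n xs)]" "tl (rotate n xs)"]
    by (simp add: rotate_Suc)
qed auto

lemma rotate_to_hd:
  assumes "y \<in> set xs"
  shows "\<exists>n ys. rotate n xs = y # ys"
proof -
  obtain as bs where "xs = as @ y # bs" using split_list[OF assms] by blast
  then have "rotate (length as) xs = y # bs @ as"
    by (simp add: rotate_append)
  then show ?thesis by blast
qed

lemma rotate_to_two:
  assumes "x \<in> set xs" "y \<in> set xs" "x \<noteq> y"
  shows "\<exists>n ys zs. rotate n xs = x # ys @ y # zs"
proof -
  obtain n ws where n: "rotate n xs = x # ws" using rotate_to_hd[OF assms(1)] by blast
  then have "y \<in> set ws" using assms by (metis set_ConsD set_rotate)
  then obtain ys zs where "ws = ys @ y # zs" using split_list by metis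
  then show ?thesis using n by blast
qed

lemma successively_rev_sym:
  assumes "symp E" "successively E xs"
  shows "successively E (rev xs)"
  using assms by (auto intro: successively_mono dest: sympD)

lemma successively_complete:
  assumes "\<And>x y. x \<in> set xs \<Longrightarrow> y \<in> set xs \<Longrightarrow> x \<noteq> y \<Longrightarrow> E x y" "distinct xs"
  shows "successively E xs"
  using assms by (induction xs rule: induct_list012) auto

lemma obtain_distinct_list:
  assumes "finite S" "n \<le> card S"
  obtains xs where "distinct xs" "set xs \<subseteq> S" "length xs = n"
proof -
  obtain T where "T \<subseteq> S" "card T = n" using assms by (meson obtain_subset_with_card_n)
  moreover obtain xs where "set xs = T" "distinct xs"
    using finite_distinct_list[of T] finite_subset[OF \<open>T \<subseteq> S\<close> \<open>finite S\<close>] by blast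
  ultimately show ?thesis using that[of xs] by (metis distinct_card)
qed

lemma obtain_list_with_ends:
  assumes "finite S" "x \<in> S" "y \<in> S" "x \<noteq> y" "2 \<le> n" "n \<le> card S"
  obtains zs where "distinct (x # zs @ [y])" "set (x # zs @ [y]) \<subseteq> S" "length (x # zs @ [y]) = n"
proof -
  have "n - 2 \<le> card (S - {x, y})" using assms by (simp add: card_Diff_subset)
  then obtain zs where "distinct zs" "set zs \<subseteq> S - {x,y}" "length zs = n - 2"
    using obtain_distinct_list[of "S - {x,y}" "n-2"] assms(1) by (metis finite_Diff)
  then show ?thesis using assms by (intro that[of zs]) auto
qed

section \<open>Alternating paths and blocks\<close>

text \<open>\<open>viap R ws ys\<close>: the alternating sequence \<open>w\<^sub>0, y\<^sub>1, w\<^sub>1, \<dots>, y\<^sub>m, w\<^sub>m\<close> is an \<open>R\<close>-walk.\<close>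

fun viap :: "('a \<Rightarrow> 'a \<Rightarrow> bool) \<Rightarrow> 'a list \<Rightarrow> 'a list \<Rightarrow> bool" where
  "viap R [w] [] \<longleftrightarrow> True"
| "viap R (w # w' # ws) (y # ys) \<longleftrightarrow> R w y \<and> R y w' \<and> viap R (w' # ws) ys"
| "viap R _ _ \<longleftrightarrow> False"

fun weave :: "'a list \<Rightarrow> 'a list \<Rightarrow> 'a list" where
  "weave (w # ws) (y # ys) = w # y # weave ws ys"
| "weave ws [] = ws"
| "weave [] ys = ys"

lemma viap_length: "viap R ws ys \<Longrightarrow> length ws = Suc (length ys)"
  by (induction R ws ys rule: viap.induct) auto

lemma viap_nonempty: "viap R ws ys \<Longrightarrow> ws \<noteq> []"
  by (auto dest: viap_length)

lemma viap_append:
  "viap R ws ys \<Longrightarrow> viap R ws' ys' \<Longrightarrow> R (last ws) y \<Longrightarrow> R y (hd ws') \<Longrightarrow> viap R (ws @ ws') (ys @ y # ys')"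
proof (induction R ws ys rule: viap.induct)
  case (1 R w)
  then show ?case by (cases ws') (auto dest: viap_nonempty)
qed auto

lemma viap_split:
  "viap R (ws @ ws') (ys @ y # ys') \<Longrightarrow> length ws = Suc (length ys) \<Longrightarrow>
    viap R ws ys \<and> viap R ws' ys' \<and> R (last ws) y \<and> R y (hd ws')"
proof (induction R ws ys rule: viap.induct)
  case (1 R w)
  then show ?case by (cases ws') auto
qed auto

lemma viap_rev:
  assumes "symp R"
  shows "viap R ws ys \<Longrightarrow> viap R (rev ws) (rev ys)"
  using assms
proof (induction R ws ys rule: viap.induct)
  case (2 R w w' ws y ys)
  then show ?case
    using viap_append[of R "rev (w' # ws)" "rev ys" "[w]" "[]" y] by (auto simp: last_rev dest: sympD)
qed auto

lemma set_weave: "set (weave ws ys) = set ws \<union> set ys"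
  by (induction ws ys rule: weave.induct) auto

lemma length_weave: "length (weave ws ys) = length ws + length ys"
  by (induction ws ys rule: weave.induct) auto

lemma distinct_weave: "distinct ws \<Longrightarrow> distinct ys \<Longrightarrow> set ws \<inter> set ys = {} \<Longrightarrow> distinct (weave ws ys)"
  by (induction ws ys rule: weave.induct) (auto simp: set_weave)

lemma viap_weave:
  "viap R ws ys \<Longrightarrow> successively R (weave ws ys) \<and> hd (weave ws ys) = hd ws \<and>
     last (weave ws ys) = last ws \<and> weave ws ys \<noteq> []"
proof (induction R ws ys rule: viap.induct)
  case (2 R w w' ws y ys)
  then show ?case by (auto simp: successively_Cons)
qed auto

lemma viap_complete:
  assumes "length ws = Suc (length ys)" "\<And>w y. w \<in> set ws \<Longrightarrow> y \<in> set ys \<Longrightarrow> R w y \<and> R y w"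
  shows "viap R ws ys"
  using assms by (induction R ws ys rule: viap.induct) auto

text \<open>In the applications the blocks \<open>(u, v)\<close> are disjoint edges of a blue cycle,
  and an outside vertex that cannot be inserted into the cycle has a red neighbour in every
  block.\<close>

definition meets :: "('a \<times> 'a) list \<Rightarrow> ('a \<Rightarrow> bool) \<Rightarrow> bool" where
  "meets bs P \<longleftrightarrow> (\<forall>(u, v) \<in> set bs. P u \<or> P v)"

definition flat :: "('a \<times> 'a) list \<Rightarrow> 'a list" where
  "flat bs = concat (map (\<lambda>(u, v). [u, v]) bs)"

lemma flat_simps [simp]: "flat [] = []" "flat ((u, v) # bs) = u # v # flat bs"
  by (auto simp: flat_def)

lemma flat_append [simp]: "flat (xs @ ys) = flat xs @ flat ys"
  by (simp add: flat_def)

lemma length_flat [simp]: "length (flat bs) = 2 * length bs"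
  by (induction bs) auto

lemma in_flatI: "(u, v) \<in> set bs \<Longrightarrow> u \<in> set (flat bs)" "(u, v) \<in> set bs \<Longrightarrow> v \<in> set (flat bs)"
  by (force simp: flat_def)+

lemma meets_Cons: "meets ((u, v) # bs) P \<longleftrightarrow> (P u \<or> P v) \<and> meets bs P"
  by (auto simp: meets_def)

lemma card_meets_blocks:
  assumes "distinct (flat bs)" "finite U" "meets bs (\<lambda>d. d \<in> U)"
  shows "length bs \<le> card U"
  using assms
proof (induction bs arbitrary: U)
  case (Cons p bs)
  obtain u v where p: "p = (u, v)" by force
  obtain x where x: "x \<in> U" "x = u \<or> x = v" using Cons.prems p by (auto simp: meets_Cons)
  have "meets bs (\<lambda>d. d \<in> U - {x})"
    unfolding meets_def
  proof clarify
    fix u' v' assume m: "(u', v') \<in> set bs" "v' \<notin> U - {x}"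
    have "u' \<noteq> x" "v' \<noteq> x" using in_flatI[OF m(1)] Cons.prems(1) p x(2) by auto
    then show "u' \<in> U - {x}" using m Cons.prems(3) p by (auto simp: meets_def)
  qed
  then have "length bs \<le> card (U - {x})"
    using Cons.IH[of "U - {x}"] Cons.prems p by auto
  then show ?case using x(1) Cons.prems(2) by (simp add: card_Diff_singleton) (metis One_nat_def Suc_leI Suc_pred card_gt_0_iff empty_iff not_less_eq_eq)
qed auto

text \<open>Of three path ends, two have a common neighbour in any further block, so the paths can be merged
  until two are left.\<close>

lemma viap_two_paths:
  fixes R :: "'a \<Rightarrow> 'a \<Rightarrow> bool"
  assumes "symp R" "finite X" "card X = length bs + 2" "distinct (flat bs)"
    "\<And>w. w \<in> X \<Longrightarrow> meets bs (R w)"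
  shows "\<exists>ws1 ys1 ws2 ys2. viap R ws1 ys1 \<and> viap R ws2 ys2 \<and> distinct (ws1 @ ws2) \<and>
           set ws1 \<union> set ws2 = X \<and> distinct (ys1 @ ys2) \<and> set ys1 \<union> set ys2 \<subseteq> set (flat bs)"
  using assms(2-)
proof (induction bs arbitrary: X)
  case Nil
  then have "card X = 2" by simp
  then obtain x y where "X = {x, y}" "x \<noteq> y" by (meson card_2_iff)
  then show ?case
    by (rule_tac x = "[x]" in exI, rule_tac x = "[]" in exI, rule_tac x = "[y]" in exI, rule_tac x = "[]" in exI)
      auto
next
  case (Cons p bs)
  obtain u v where p: "p = (u, v)" by force
  obtain x where x: "x \<in> X" using Cons.prems by (metis card.empty add_is_0 equals0I zero_neq_numeral)
  have "card (X - {x}) = length bs + 2" using Cons.prems x by simp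
  then obtain ws1 ys1 ws2 ys2 where h:
    "viap R ws1 ys1" "viap R ws2 ys2" "distinct (ws1 @ ws2)"
    "set ws1 \<union> set ws2 = X - {x}" "distinct (ys1 @ ys2)" "set ys1 \<union> set ys2 \<subseteq> set (flat bs)"
    using Cons.IH[of "X - {x}"] Cons.prems p by (auto simp: meets_Cons)
  have ne: "ws1 \<noteq> []" "ws2 \<noteq> []" using viap_nonempty[OF h(1)] viap_nonempty[OF h(2)] by auto
  have in_X: "last ws1 \<in> X" "hd ws2 \<in> X"
    using h(4) last_in_set[OF ne(1)] hd_in_set[OF ne(2)] by blast+
  have fresh: "u \<notin> set (flat bs)" "v \<notin> set (flat bs)" using Cons.prems p by auto
  have cov: "R w u \<or> R w v" if "w \<in> X" for w using Cons.prems(4)[OF that] p by (auto simp: meets_Cons)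
  consider y where "y \<in> {u, v}" "R (last ws1) y" "R (hd ws2) y"
    | y where "y \<in> {u, v}" "R (last ws1) y" "R x y"
    | y where "y \<in> {u, v}" "R x y" "R (hd ws2) y"
    using cov[OF in_X(1)] cov[OF in_X(2)] cov[OF x] by auto
  then show ?case
  proof cases
    case 1
    then have "viap R (ws1 @ ws2) (ys1 @ y # ys2)" using h sympD[OF assms(1)] viap_append by metis
    then show ?thesis
      by (rule_tac x = "ws1 @ ws2" in exI, rule_tac x = "ys1 @ y # ys2" in exI, rule_tac x = "[x]" in exI,
          rule_tac x = "[]" in exI) (use h x 1 fresh p in auto)
  next
    case 2
    then have "viap R (ws1 @ [x]) (ys1 @ y # [])" using h sympD[OF assms(1)] viap_append[of R ws1 ys1 "[x]" "[]" y] by simp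
    then show ?thesis
      by (rule_tac x = "ws1 @ [x]" in exI, rule_tac x = "ys1 @ y # []" in exI, rule_tac x = ws2 in exI,
          rule_tac x = ys2 in exI) (use h x 2 fresh p in auto)
  next
    case 3
    then have "viap R ([x] @ ws2) ([] @ y # ys2)" using h sympD[OF assms(1)] viap_append[of R "[x]" "[]" ws2 ys2 y] by simp
    then show ?thesis
      by (rule_tac x = ws1 in exI, rule_tac x = ys1 in exI, rule_tac x = "[x] @ ws2" in exI,
          rule_tac x = "[] @ y # ys2" in exI) (use h x 3 fresh p in auto)
  qed
qed

text \<open>A closed alternating cycle, encoded as an alternating path together with the connecting
  vertex \<open>z\<close> at which it is cut open; rotating the cycle changes the role of
  \<open>z\<close>.\<close>

definition viac :: "('a \<Rightarrow> 'a \<Rightarrow> bool) \<Rightarrow> 'a list \<Rightarrow> 'a list \<Rightarrow> 'a \<Rightarrow> bool" where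
  "viac R ws ys z \<longleftrightarrow> viap R ws ys \<and> R (last ws) z \<and> R z (hd ws) \<and> distinct ws \<and> distinct (z # ys)"

lemma viac_viap: "viac R ws ys z \<Longrightarrow> viap R ws ys"
  by (simp add: viac_def)

lemma viac_length: "viac R ws ys z \<Longrightarrow> length ws = Suc (length ys)"
  by (rule viap_length[OF viac_viap])

lemma viac_rotate:
  assumes "viac R (ws1 @ ws2) (ys1 @ y # ys2) z" "length ws1 = Suc (length ys1)"
  shows "viac R (ws2 @ ws1) (ys2 @ z # ys1) y"
proof -
  have "viap R ws1 ys1 \<and> viap R ws2 ys2 \<and> R (last ws1) y \<and> R y (hd ws2)"
    using assms viap_split[of R ws1 ws2 ys1 y ys2] by (simp add: viac_def)
  moreover from this have "ws1 \<noteq> []" "ws2 \<noteq> []" using viap_nonempty by blast+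
  ultimately show ?thesis
    using assms(1) viap_append[of R ws2 ys2 ws1 ys1 z] by (auto simp: viac_def)
qed

lemma viac_open_at_place:
  assumes "viac R ws ys z" "d \<in> insert z (set ys)"
  shows "\<exists>ws' ys'. viac R ws' ys' d \<and> set ws' = set ws \<and> insert d (set ys') = insert z (set ys)"
proof (cases "d = z")
  case False
  then obtain ys1 ys2 where ys: "ys = ys1 @ d # ys2" using assms(2) split_list by fastforce
  define ws1 where "ws1 = take (Suc (length ys1)) ws"
  define ws2 where "ws2 = drop (Suc (length ys1)) ws"
  have "length ws = Suc (length ys)" by (rule viac_length[OF assms(1)])
  then have "ws = ws1 @ ws2" "length ws1 = Suc (length ys1)"
    by (auto simp: ws1_def ws2_def ys)
  then have "viac R (ws2 @ ws1) (ys2 @ z # ys1) d" "set ws = set (ws2 @ ws1)"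
    using assms(1) viac_rotate ys by auto
  then show ?thesis using ys
    by (rule_tac x = "ws2 @ ws1" in exI, rule_tac x = "ys2 @ z # ys1" in exI) auto
qed (use assms in blast)

lemma viac_open_at_hd:
  assumes "viac R ws ys z" "w \<in> set ws"
  shows "\<exists>ws' ys' z'. viac R ws' ys' z' \<and> hd ws' = w \<and> set ws' = set ws \<and>
    insert z' (set ys') = insert z (set ys)"
proof -
  obtain as bs where ws: "ws = as @ w # bs" using assms(2) split_list by metis
  show ?thesis
  proof (cases "as = []")
    case True
    then show ?thesis using ws assms(1) by (metis append_Nil list.sel(1))
  next
    case False
    have len: "length ws = Suc (length ys)" by (rule viac_length[OF assms(1)])
    then have "length as \<le> length ys" using ws by simp
    define ys1 where "ys1 = take (length as - 1) ys"
    define ys2 where "ys2 = drop (length as) ys"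
    define y where "y = ys ! (length as - 1)"
    have as0: "0 < length as" using False by simp
    have i: "length as - 1 < length ys" and Suc_i: "Suc (length as - 1) = length as"
      using as0 \<open>length as \<le> length ys\<close> by linarith+
    have ys: "ys = ys1 @ y # ys2"
      unfolding ys1_def ys2_def y_def by (rule id_take_nth_drop[OF i, unfolded Suc_i])
    have "length as = Suc (length ys1)" using as0 \<open>length as \<le> length ys\<close> by (simp add: ys1_def)
    then have "viac R ((w # bs) @ as) (ys2 @ z # ys1) y"
      using viac_rotate[of R as "w # bs" ys1 y ys2 z] assms(1) ws ys by simp
    then show ?thesis
      by (rule_tac x = "(w # bs) @ as" in exI, rule_tac x = "ys2 @ z # ys1" in exI, rule_tac x = y in exI)
        (auto simp: ws ys)
  qed
qed

lemma viac_open_at_last: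
  assumes "symp R" "viac R ws ys z" "w \<in> set ws"
  shows "\<exists>ws' ys' z'. viac R ws' ys' z' \<and> last ws' = w \<and> set ws' = set ws \<and>
    insert z' (set ys') = insert z (set ys)"
proof -
  obtain ws' ys' z' where h: "viac R ws' ys' z'" "hd ws' = w" "set ws' = set ws"
    "insert z' (set ys') = insert z (set ys)" using viac_open_at_hd[OF assms(2,3)] by blast
  have "ws' \<noteq> []" using h(1) viap_nonempty by (auto simp: viac_def)
  then have "viac R (rev ws') (rev ys') z'" "last (rev ws') = w"
    using h viap_rev[OF assms(1)] sympD[OF assms(1)] by (auto simp: viac_def last_rev hd_rev)
  then show ?thesis using h
    by (rule_tac x = "rev ws'" in exI, rule_tac x = "rev ys'" in exI, rule_tac x = z' in exI) auto
qed

text \<open>The obstruction to a path through all of \<open>X\<close> whose consecutive vertices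
  have common neighbours in \<open>Y\<close>.\<close>

definition splits :: "('a \<Rightarrow> 'a \<Rightarrow> bool) \<Rightarrow> 'a set \<Rightarrow> 'a set \<Rightarrow> bool" where
  "splits R X Y \<longleftrightarrow> (\<exists>S1 S2. S1 \<noteq> {} \<and> S2 \<noteq> {} \<and> S1 \<union> S2 = X \<and>
     (\<forall>w\<in>S1. \<forall>x\<in>S2. \<forall>d\<in>Y. \<not> (R w d \<and> R x d)))"

text \<open>If the two remaining paths cannot be linked in the last block, its two vertices close them to two
  alternating cycles; these can be opened anywhere, so any common neighbour links them.\<close>

lemma viap_or_split:
  fixes R :: "'a \<Rightarrow> 'a \<Rightarrow> bool"
  assumes sym: "symp R"
    and X: "finite X" "card X = Suc (length bs)" "bs \<noteq> []"
    and bs: "distinct (flat bs)" "set (flat bs) \<subseteq> Y"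
    and cov: "\<And>w. w \<in> X \<Longrightarrow> meets bs (R w)"
  shows "(\<exists>ws ys. viap R ws ys \<and> set ws = X \<and> distinct ws \<and> distinct ys \<and> set ys \<subseteq> Y) \<or> splits R X Y"
proof (rule ccontr)
  assume neg: "\<not> ?thesis"
  obtain u v bs' where bs': "bs = (u, v) # bs'" using X(3) by (cases bs) auto
  have "\<And>w. w \<in> X \<Longrightarrow> meets bs' (R w)" using cov bs' by (auto simp: meets_Cons)
  then obtain ws1 ys1 ws2 ys2 where h:
    "viap R ws1 ys1" "viap R ws2 ys2" "distinct (ws1 @ ws2)"
    "set ws1 \<union> set ws2 = X" "distinct (ys1 @ ys2)" "set ys1 \<union> set ys2 \<subseteq> set (flat bs')"
    using viap_two_paths[OF sym X(1), where bs = bs'] X(2) bs(1) bs' by auto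
  have no_join: False
    if "viap R as cs" "viap R as' cs'" "R (last as) y" "R (hd as') y" "y \<in> Y"
      "distinct (as @ as')" "set as \<union> set as' = X" "distinct (y # cs @ cs')" "set cs \<union> set cs' \<subseteq> Y"
    for as cs as' cs' y
  proof -
    have "viap R (as @ as') (cs @ y # cs')" using that viap_append sympD[OF sym] by metis
    moreover have "set (as @ as') = X" "distinct (cs @ y # cs')" "set (cs @ y # cs') \<subseteq> Y"
      using that by auto
    ultimately show False using neg that(6) by blast
  qed
  have ne: "ws1 \<noteq> []" "ws2 \<noteq> []" using h viap_nonempty by (metis, metis)
  have uv: "u \<in> Y" "v \<in> Y" "u \<noteq> v" "u \<notin> set ys1 \<union> set ys2" "v \<notin> set ys1 \<union> set ys2"
    "set ys1 \<union> set ys2 \<subseteq> Y"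
    using bs bs' h(6) by auto
  have rev1: "viap R (rev ws1) (rev ys1)" and rev2: "viap R (rev ws2) (rev ys2)"
    using h viap_rev sym by metis+
  \<comment> \<open>Either path may be reversed, so any end of the one can be linked to any end of
    the other; a common neighbour among \<open>u\<close>, \<open>v\<close> would therefore merge
    them.\<close>
  have sep: "\<not> (R p y \<and> R q y)" if "p \<in> {hd ws1, last ws1}" "q \<in> {hd ws2, last ws2}" "y \<in> {u, v}" for p q y
  proof
    assume a: "R p y \<and> R q y"
    obtain as cs where 1: "viap R as cs" "last as = p" "set as = set ws1" "distinct as" "set cs = set ys1" "distinct cs"
    proof (cases "p = last ws1")
      case True then show ?thesis using that[of ws1 ys1] h by auto
    next
      case False
      then have "p = hd ws1" using \<open>p \<in> _\<close> by auto
      then show ?thesis using that[of "rev ws1" "rev ys1"] rev1 h ne by (auto simp: last_rev)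
    qed
    obtain as' cs' where 2: "viap R as' cs'" "hd as' = q" "set as' = set ws2" "distinct as'" "set cs' = set ys2" "distinct cs'"
    proof (cases "q = hd ws2")
      case True then show ?thesis using that[of ws2 ys2] h by auto
    next
      case False
      then have "q = last ws2" using \<open>q \<in> _\<close> by auto
      then show ?thesis using that[of "rev ws2" "rev ys2"] rev2 h ne by (auto simp: hd_rev)
    qed
    show False
      by (rule no_join[of as cs as' cs' y]) (use 1 2 a that uv h in auto)
  qed
  have ends: "hd ws1 \<in> X" "last ws1 \<in> X" "hd ws2 \<in> X" "last ws2 \<in> X"
    using h(4) hd_in_set[OF ne(1)] hd_in_set[OF ne(2)] last_in_set[OF ne(1)] last_in_set[OF ne(2)] by blast+
  have cuv: "R w u \<or> R w v" if "w \<in> X" for w using cov[OF that] bs' by (auto simp: meets_Cons)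
  \<comment> \<open>Ends of different paths never share \<open>u\<close> or \<open>v\<close>, and
    every end sees one of them. Hence one of \<open>u\<close>, \<open>v\<close> is adjacent to both
    ends of the first path and the other to both ends of the second, and both paths close to
    cycles.\<close>
  obtain z1 z2 where z: "{z1, z2} = {u, v}" "R (hd ws1) z1" "R (last ws1) z1" "R (hd ws2) z2" "R (last ws2) z2"
  proof (cases "R (hd ws1) u")
    case True
    then have "R (hd ws2) v" "R (last ws2) v" using sep cuv ends by blast+
    then have "R (last ws1) u" using sep cuv ends by blast
    then show ?thesis using that[of u v] True \<open>R (hd ws2) v\<close> \<open>R (last ws2) v\<close> by blast
  next
    case False
    then have "R (hd ws1) v" using cuv ends by blast
    then have "R (hd ws2) u" "R (last ws2) u" using sep cuv ends by blast+
    then have "R (last ws1) v" using sep cuv ends by blast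
    then show ?thesis using that[of v u] \<open>R (hd ws1) v\<close> \<open>R (hd ws2) u\<close> \<open>R (last ws2) u\<close> by blast
  qed
  have z': "z1 \<noteq> z2" "z1 \<in> Y" "z2 \<in> Y" "z1 \<notin> set ys1 \<union> set ys2" "z2 \<notin> set ys1 \<union> set ys2"
    using z(1) uv by (auto simp: doubleton_eq_iff)
  have c1: "viac R ws1 ys1 z1" and c2: "viac R ws2 ys2 z2"
    using h z z' sympD[OF sym] by (auto simp: viac_def)
  define U1 where "U1 = insert z1 (set ys1)"
  define U2 where "U2 = insert z2 (set ys2)"
  have disj: "U1 \<inter> U2 = {}" using z' h(5) by (auto simp: U1_def U2_def)
  have UY: "U1 \<subseteq> Y" "U2 \<subseteq> Y" using z' uv(6) by (auto simp: U1_def U2_def)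
  note op = viac_open_at_place[OF c1, folded U1_def] viac_open_at_place[OF c2, folded U2_def]
    viac_open_at_last[OF sym c1, folded U1_def] viac_open_at_hd[OF c2, folded U2_def]
  have "\<not> (R w d \<and> R x d)" if wx: "w \<in> set ws1" "x \<in> set ws2" "d \<in> Y" for w x d
  proof
    assume a: "R w d \<and> R x d"
    \<comment> \<open>The first cycle is opened so that it ends in \<open>w\<close>, the second so
      that it begins with \<open>x\<close>. If \<open>d\<close> itself lies on one of the cycles,
      that cycle is opened at \<open>d\<close> instead, and \<open>d\<close> is adjacent to its ends
      anyway.\<close>
    obtain as cs e where 1: "viac R as cs e" "last as = w" "set as = set ws1" "insert e (set cs) = U1"
      using op(3)[OF wx(1)] by blast
    obtain as' cs' e' where 2: "viac R as' cs' e'" "hd as' = x" "set as' = set ws2" "insert e' (set cs') = U2"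
      using op(4)[OF wx(2)] by blast
    show False
    proof (cases "d \<in> U1")
      case True
      obtain as cs where 3: "viac R as cs d" "set as = set ws1" "insert d (set cs) = U1"
        using op(1)[OF True] by blast
      have "set cs \<subseteq> U1" "set cs' \<subseteq> U2" using 2(4) 3(3) by auto
      then have "d \<notin> set cs'" "set cs \<inter> set cs' = {}" "set cs \<union> set cs' \<subseteq> Y"
        using disj UY True by blast+
      moreover have "distinct (as @ as')" using 3 2 h(3) by (auto simp: viac_def)
      ultimately show False
        by (intro no_join[of as cs as' cs' d]) (use 3 2 a wx h in \<open>auto simp: viac_def\<close>)
    next
      case F1: False
      show False
      proof (cases "d \<in> U2")
        case True
        obtain as' cs' where 3: "viac R as' cs' d" "set as' = set ws2" "insert d (set cs') = U2"
          using op(2)[OF True] by blast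
        have "set cs \<subseteq> U1" "set cs' \<subseteq> U2" using 1(4) 3(3) by auto
        then have "d \<notin> set cs" "set cs \<inter> set cs' = {}" "set cs \<union> set cs' \<subseteq> Y"
          using disj UY F1 by blast+
        moreover have "distinct (as @ as')" using 3 1 h(3) by (auto simp: viac_def)
        ultimately show False
          by (intro no_join[of as cs as' cs' d]) (use 3 1 a wx h sympD[OF sym] in \<open>auto simp: viac_def\<close>)
      next
        case False
        have "set cs \<subseteq> U1" "set cs' \<subseteq> U2" using 1(4) 2(4) by auto
        then have "d \<notin> set cs" "d \<notin> set cs'" "set cs \<inter> set cs' = {}" "set cs \<union> set cs' \<subseteq> Y"
          using disj UY F1 False by blast+
        moreover have "distinct (as @ as')" using 2 1 h(3) by (auto simp: viac_def)
        ultimately show False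
          by (intro no_join[of as cs as' cs' d]) (use 2 1 a wx h in \<open>auto simp: viac_def\<close>)
      qed
    qed
  qed
  note nsh = this
  have "splits R X Y" unfolding splits_def
    by (rule exI[of _ "set ws1"], rule exI[of _ "set ws2"]) (use ne h(4) nsh in blast)
  then show False using neg by blast
qed

lemma viap_closed_has_cycle:
  assumes "viap R ws ys" "distinct ws" "distinct ys" "set ws \<inter> set ys = {}" "R (last ws) (hd ws)"
    "set ws \<union> set ys \<subseteq> S"
  shows "has_cycle R S (length ws + length ys)"
  using assms viap_weave[OF assms(1)]
  by (intro has_cycleI[of R "weave ws ys"])
    (auto simp: cyc_def set_weave length_weave distinct_weave)

lemma viac_has_cycle:
  assumes "viac R ws ys z" "set ws \<inter> insert z (set ys) = {}" "set ws \<union> insert z (set ys) \<subseteq> S"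
  shows "has_cycle R S (2 * length ws)"
proof -
  have v: "viap R ws ys" using assms by (simp add: viac_def)
  have "distinct (weave ws ys @ [z])"
    using assms distinct_weave[of ws ys] by (auto simp: viac_def set_weave)
  then show ?thesis
    using assms viap_weave[OF v] viap_length[OF v]
    by (intro has_cycleI[of R "weave ws ys @ [z]"])
      (auto simp: cyc_def set_weave length_weave viac_def successively_append_iff)
qed

lemma viac_rotate_n:
  assumes "viac R ws ys z"
  shows "\<exists>ys' z'. viac R (rotate n ws) ys' z' \<and> insert z' (set ys') = insert z (set ys)"
proof (induction n)
  case (Suc n)
  then obtain ys' z' where h: "viac R (rotate n ws) ys' z'" "insert z' (set ys') = insert z (set ys)" by blast
  have len: "length (rotate n ws) = Suc (length ys')" by (rule viac_length[OF h(1)])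
  then obtain v vs where v: "rotate n ws = v # vs" by (cases "rotate n ws") auto
  show ?case
  proof (cases ys')
    case Nil
    then have "vs = []" using len v by simp
    then show ?thesis using h v by (auto simp: rotate_Suc)
  next
    case (Cons y ys'')
    then have "viac R (vs @ [v]) (ys'' @ [z']) y"
      using viac_rotate[of R "[v]" vs "[]" y ys'' z'] h(1) v by simp
    then show ?thesis using h(2) v Cons
      by (intro exI[of _ "ys'' @ [z']"] exI[of _ y]) (auto simp: rotate_Suc)
  qed
qed (use assms in auto)

lemma meets_sublist: "meets bs P \<Longrightarrow> set bs' \<subseteq> set bs \<Longrightarrow> meets bs' P"
  by (auto simp: meets_def)

lemma set_flat_mono: "set bs' \<subseteq> set bs \<Longrightarrow> set (flat bs') \<subseteq> set (flat bs)"
  by (auto simp: flat_def)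

lemma remove_block:
  assumes "distinct (flat bs)" "bs \<noteq> []"
  shows "\<exists>bs'. Suc (length bs') = length bs \<and> distinct (flat bs') \<and> set bs' \<subseteq> set bs \<and> d \<notin> set (flat bs')"
proof (cases "d \<in> set (flat bs)")
  case True
  then obtain u v where uv: "(u, v) \<in> set bs" "d = u \<or> d = v" by (auto simp: flat_def)
  then obtain b1 b2 where "bs = b1 @ (u, v) # b2" using split_list by metis
  then show ?thesis using assms uv by (intro exI[of _ "b1 @ b2"]) auto
next
  case False
  then show ?thesis using assms by (cases bs) (auto simp: split: prod.splits)
qed

text \<open>Each consecutive pair takes its connecting vertex from a block of its own, which makes
  the connecting vertices distinct.\<close>

lemma viap_greedy:
  assumes "symp R" "us \<noteq> []" "length us \<le> Suc (length bs)" "distinct (flat bs)"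
    "successively (\<lambda>w x. meets bs (\<lambda>d. R w d \<and> R x d)) us"
  shows "\<exists>ys. viap R us ys \<and> distinct ys \<and> set ys \<subseteq> set (flat bs)"
  using assms
proof (induction us arbitrary: bs rule: induct_list012)
  case (2 w)
  then show ?case by (intro exI[of _ "[]"]) auto
next
  case (3 w x us)
  then obtain u v bs' where bs: "bs = (u, v) # bs'" by (cases bs) auto
  have "successively (\<lambda>w x. meets bs' (\<lambda>d. R w d \<and> R x d)) (x # us)"
    using "3.prems"(5) bs by (auto intro: successively_mono simp: meets_Cons)
  then obtain ys where ys: "viap R (x # us) ys" "distinct ys" "set ys \<subseteq> set (flat bs')"
    using "3.IH"(2)[of bs'] "3.prems" bs by auto
  obtain y where y: "y \<in> {u, v}" "R w y" "R y x"
    using "3.prems"(1,5) bs by (auto simp: meets_Cons dest: sympD)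
  then have "viap R (w # x # us) (y # ys)" using ys by simp
  moreover have "distinct (y # ys)" using y ys "3.prems"(4) bs by auto
  moreover have "set (y # ys) \<subseteq> set (flat bs)" using y ys bs by auto
  ultimately show ?case by blast
qed auto

text \<open>All pairs of distinct elements of the type are coloured, not only those of a vertex set;
  vertex sets enter later as arguments, and no membership conditions arise when the colour is not
  red.\<close>

locale two_coloring =
  fixes r b :: "'a \<Rightarrow> 'a \<Rightarrow> bool"
  assumes r_sym: "symp r" and b_sym: "symp b"
    and r_irrefl: "\<not> r x x" and b_irrefl: "\<not> b x x"
    and total: "x \<noteq> y \<Longrightarrow> r x y \<or> b x y" and exclusive: "\<not> (r x y \<and> b x y)"
begin

lemma swap: "two_coloring b r"
  by unfold_locales (use r_sym b_sym r_irrefl b_irrefl total exclusive in blast)+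

lemma r_commute: "r x y \<longleftrightarrow> r y x" using r_sym by (auto dest: sympD)
lemma b_commute: "b x y \<longleftrightarrow> b y x" using b_sym by (auto dest: sympD)

definition b_clique :: "'a set \<Rightarrow> bool" where
  "b_clique S \<longleftrightarrow> (\<forall>x\<in>S. \<forall>y\<in>S. x \<noteq> y \<longrightarrow> b x y)"

text \<open>This holds for the vertices outside a blue cycle that cannot be lengthened by two, see
  \<open>b_shares_if_no_insertion\<close>.\<close>

definition b_shares :: "'a set \<Rightarrow> ('a \<times> 'a) list \<Rightarrow> bool" where
  "b_shares X bs \<longleftrightarrow> (\<forall>w\<in>X. \<forall>x\<in>X. b w x \<longrightarrow> meets bs (\<lambda>d. r w d \<and> r x d))"

text \<open>Take an alternating path through \<open>X\<close>. A red edge between its ends would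
  close the forbidden odd cycle, so the ends are joined in blue and share a red neighbour in every
  block. Either some common neighbour lies off the path and closes it to an alternating cycle, or,
  by counting, the common neighbours are exactly the connecting vertices. Applying this to other
  paths on the same vertices spreads it from the two ends to all of \<open>X\<close>.\<close>

lemma via_alternatives:
  assumes X: "finite X" "card X = Suc (length bs)" "bs \<noteq> []" "X \<inter> Y = {}" "finite Y"
    and bs: "distinct (flat bs)" "set (flat bs) \<subseteq> Y"
    and cov: "\<And>w. w \<in> X \<Longrightarrow> meets bs (r w)"
    and shares: "b_shares X bs"
    and no_cycle: "\<not> has_cycle r (X \<union> Y) (2 * length bs + 1)"
  shows "(\<exists>ws ys z. viac r ws ys z \<and> set ws = X \<and> insert z (set ys) \<subseteq> Y) \<or>
    (\<exists>U\<subseteq>Y. card U = length bs \<and> (\<forall>w\<in>X. \<forall>u\<in>U. r w u) \<and> b_clique X \<and>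
       (\<forall>w\<in>X. \<forall>x\<in>X. w \<noteq> x \<longrightarrow> {d\<in>Y. r w d \<and> r x d} = U)) \<or>
    splits r X Y"
proof (rule ccontr)
  assume neg: "\<not> ?thesis"
  then obtain ws ys where p: "viap r ws ys" "set ws = X" "distinct ws" "distinct ys" "set ys \<subseteq> Y"
    using viap_or_split[OF r_sym X(1-3) bs cov] by blast
  have key: "b (hd as) (last as) \<and> {d\<in>Y. r (hd as) d \<and> r (last as) d} = set cs"
    if "viap r as cs" "set as = X" "distinct as" "distinct cs" "set cs \<subseteq> Y" for as cs
  proof -
    have las: "length as = Suc (length bs)" using that(2,3) X(2) by (metis distinct_card)
    then have len: "length cs = length bs" using viap_length[OF that(1)] by simp
    have ne: "as \<noteq> []" using that(1) viap_nonempty by blast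
    have "hd as \<noteq> last as"
    proof
      assume "hd as = last as"
      then have "length as = 1" using that(3) ne
        by (cases as) (auto split: if_splits)
      then show False using las X(3) by simp
    qed
    moreover have "\<not> r (last as) (hd as)"
    proof
      assume "r (last as) (hd as)"
      then have "has_cycle r (X \<union> Y) (length as + length cs)"
        using that X(4) by (intro viap_closed_has_cycle) auto
      then show False using no_cycle len las by (simp add: mult_2)
    qed
    ultimately have bb: "b (hd as) (last as)" using total r_commute by blast
    let ?S = "{d\<in>Y. r (hd as) d \<and> r (last as) d}"
    have sub: "?S \<subseteq> set cs"
    proof (rule ccontr)
      assume "\<not> ?S \<subseteq> set cs"
      then obtain z where "z \<in> ?S" "z \<notin> set cs" by blast
      then have "viac r as cs z" "insert z (set cs) \<subseteq> Y" using that r_commute by (auto simp: viac_def)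
      then show False using neg that(2) by blast
    qed
    have hl: "hd as \<in> X" "last as \<in> X" using ne that(2) by auto
    have "meets bs (\<lambda>d. r (hd as) d \<and> r (last as) d)"
      using shares bb hl unfolding b_shares_def by blast
    then have "meets bs (\<lambda>d. d \<in> ?S)" using bs(2) in_flatI unfolding meets_def by fastforce
    then have "length bs \<le> card ?S" using card_meets_blocks[OF bs(1)] X(5) by simp
    moreover have "card (set cs) = length bs" using len that(4) distinct_card by metis
    ultimately have "?S = set cs" using sub by (metis card_seteq finite_set)
    then show ?thesis using bb by blast
  qed
  define U where "U = set ys"
  have lenws: "length ws = Suc (length ys)" using viap_length[OF p(1)] .
  have cardU: "card U = length bs"
    using lenws p X(2) distinct_card by (metis U_def nat.inject)
  have all_U: "r w u" if w: "w \<in> X" and u: "u \<in> U" for w u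
  proof -
    obtain as cs where ws: "ws = as @ w # cs" using split_list w p(2) by metis
    show ?thesis
    proof (cases "cs = []")
      case True
      then have "last ws = w" using ws by simp
      then show ?thesis using key[OF p] u U_def by blast
    next
      case False
      define ys1 where "ys1 = take (length as) ys"
      define y where "y = ys ! length as"
      define ys2 where "ys2 = drop (Suc (length as)) ys"
      have "length as < length ys" using lenws ws False by (cases cs) auto
      then have ys: "ys = ys1 @ y # ys2" unfolding ys1_def y_def ys2_def by (rule id_take_nth_drop)
      have len1: "length (as @ [w]) = Suc (length ys1)" using \<open>length as < length ys\<close> by (simp add: ys1_def)
      \<comment> \<open>The part of the path up to \<open>w\<close> is reversed. Its new last vertex
        \<open>hd ws\<close> is adjacent to all connecting vertices, hence to \<open>y\<close>, so
        the remainder can be attached again, and now \<open>w\<close> is an end.\<close>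
      have sp: "viap r (as @ [w]) ys1 \<and> viap r cs ys2 \<and> r w y \<and> r y (hd cs)"
        using viap_split[of r "as @ [w]" cs ys1 y ys2] len1 p(1) ws ys by simp
      have "viap r (rev (as @ [w])) (rev ys1)" using sp viap_rev[OF r_sym] by blast
      moreover have "last (rev (as @ [w])) = hd ws" using ws by (cases as) auto
      moreover have "r (hd ws) y" using key[OF p] ys by auto
      ultimately have v: "viap r (rev (as @ [w]) @ cs) (rev ys1 @ y # ys2)"
        using sp by (intro viap_append) auto
      have "b (hd (rev (as @ [w]) @ cs)) (last (rev (as @ [w]) @ cs)) \<and>
          {d \<in> Y. r (hd (rev (as @ [w]) @ cs)) d \<and> r (last (rev (as @ [w]) @ cs)) d} = set (rev ys1 @ y # ys2)"
        by (rule key[OF v]) (use p ws ys in auto)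
      moreover have "u \<in> set (rev ys1 @ y # ys2)" using u ys U_def by auto
      ultimately have "r (hd (rev (as @ [w]) @ cs)) u" by blast
      then show ?thesis by simp
    qed
  qed
  \<comment> \<open>Every vertex of \<open>X\<close> is now adjacent to every vertex of
    \<open>U\<close>, so \<open>X\<close> can be traversed in any order and any two of its vertices
    can be made the ends.\<close>
  have pair: "b w x \<and> {d\<in>Y. r w d \<and> r x d} = U" if wx: "w \<in> X" "x \<in> X" "w \<noteq> x" for w x
  proof -
    have "2 \<le> card X" using X(2,3) by (cases bs) auto
    then obtain zs where zs: "distinct (w # zs @ [x])" "set (w # zs @ [x]) \<subseteq> X" "length (w # zs @ [x]) = card X"
      using obtain_list_with_ends[OF X(1) wx, of "card X"] by auto
    then have "set (w # zs @ [x]) = X" using X(1) by (metis card_subset_eq distinct_card)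
    moreover have "viap r (w # zs @ [x]) ys"
      using zs X(2) cardU p(4) all_U r_commute
      by (intro viap_complete) (auto simp: U_def distinct_card)
    ultimately have "b (hd (w # zs @ [x])) (last (w # zs @ [x])) \<and>
        {d \<in> Y. r (hd (w # zs @ [x])) d \<and> r (last (w # zs @ [x])) d} = set ys"
      by (intro key) (use zs p in simp_all)
    then show ?thesis by (simp add: U_def)
  qed
  have "b_clique X" using pair unfolding b_clique_def by simp
  moreover have "U \<subseteq> Y" using p U_def by simp
  moreover have "\<forall>w\<in>X. \<forall>u\<in>U. r w u" using all_U by simp
  moreover have "\<forall>w\<in>X. \<forall>x\<in>X. w \<noteq> x \<longrightarrow> {d\<in>Y. r w d \<and> r x d} = U" using pair by simp
  ultimately have "\<exists>U\<subseteq>Y. card U = length bs \<and> (\<forall>w\<in>X. \<forall>u\<in>U. r w u) \<and> b_clique X \<and>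
       (\<forall>w\<in>X. \<forall>x\<in>X. w \<noteq> x \<longrightarrow> {d\<in>Y. r w d \<and> r x d} = U)"
    using cardU by (intro exI[of _ U] conjI)
  then show False using neg by argo
qed

text \<open>In an alternating cycle through \<open>X\<close> a red pair forces the preceding pair to be red without common
  neighbours; going round, the words of neighbours on any block would have to be constant.\<close>

lemma b_clique_or_split:
  assumes X: "finite X" "card X = Suc (length bs)" "bs \<noteq> []" "X \<inter> Y = {}" "finite Y"
    and bs: "distinct (flat bs)" "set (flat bs) \<subseteq> Y"
    and cov: "\<And>w. w \<in> X \<Longrightarrow> meets bs (r w)"
    and shares: "b_shares X bs"
    and no_cycle: "\<not> has_cycle r (X \<union> Y) (2 * length bs + 1)"
  shows "b_clique X \<or> splits r X Y"
proof (rule ccontr)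
  assume neg: "\<not> ?thesis"
  then obtain ws ys z where c: "viac r ws ys z" "set ws = X" "insert z (set ys) \<subseteq> Y"
    using via_alternatives[OF assms] by blast
  define n where "n = length ws"
  have dws: "distinct ws" using c(1) by (simp add: viac_def)
  define q where "q = length bs"
  have n: "n = Suc q" using X(2) c(2) dws distinct_card n_def q_def by metis
  have n2: "2 \<le> n" using n X(3) q_def by (cases bs) auto
  define w where "w i = ws ! (i mod n)" for i
  have per: "w (i + n) = w i" for i by (simp add: w_def)
  have wX: "w i \<in> X" for i using n2 by (simp add: w_def c(2)[symmetric]) (metis mod_less_divisor n_def nth_mem less_le_trans zero_less_numeral)
  have rot: "\<exists>ys' z'. viac r (rotate i ws) ys' z' \<and> insert z' (set ys') \<subseteq> Y" for i
    using viac_rotate_n[OF c(1)] c(3) by metis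
  have nth_rot: "rotate i ws ! k = w (i + k)" if "k < n" for i k
    using that by (simp add: nth_rotate w_def n_def)
  have cyc_contra: False
    if "viap r as cs" "set as = X" "distinct as" "distinct cs" "set cs \<subseteq> Y" "r (last as) (hd as)" for as cs
  proof -
    have "length as = n" using that(2,3) c(2) dws n_def by (metis distinct_card)
    moreover have "length as = Suc (length cs)" using viap_length[OF that(1)] .
    moreover have "has_cycle r (X \<union> Y) (length as + length cs)"
      using that X(4) by (intro viap_closed_has_cycle) auto
    ultimately show False using no_cycle n q_def by (simp add: mult_2)
  qed
  \<comment> \<open>As \<open>n = q + 1\<close>, the index \<open>i + q\<close> belongs to the
    cyclic predecessor of \<open>w i\<close>. These two are the ends of a path through
    \<open>X\<close>, and a red edge between them would close the forbidden odd cycle.\<close>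
  have b_step: "b (w (i + q)) (w i)" for i
  proof (rule ccontr)
    assume nb: "\<not> b (w (i + q)) (w i)"
    obtain ys' z' where v: "viac r (rotate i ws) ys' z'" "insert z' (set ys') \<subseteq> Y" using rot by blast
    have l: "length (rotate i ws) = n" "rotate i ws \<noteq> []" using n2 n_def by auto
    have e: "last (rotate i ws) = w (i + q)" "hd (rotate i ws) = w i"
      using l nth_rot[of q i] nth_rot[of 0 i] n by (simp_all add: last_conv_nth hd_conv_nth)
    have "hd (rotate i ws) \<noteq> last (rotate i ws)"
      using l n2 dws by (simp add: last_conv_nth hd_conv_nth nth_eq_iff_index_eq)
    then have "r (last (rotate i ws)) (hd (rotate i ws))" using nb e total by metis
    then show False using v c(2) by (intro cyc_contra[of "rotate i ws" ys']) (auto simp: viac_def)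
  qed
  define D where "D x y \<longleftrightarrow> (\<forall>d\<in>Y. \<not> (r x d \<and> r y d))" for x y
  \<comment> \<open>A common neighbour \<open>d\<close> would give the path
    \<open>w i, ..., w (i + m - 1), d, w (i + q), ..., w (i + m)\<close>, whose other connections
    are taken from blocks avoiding \<open>d\<close>; the red edge between its ends would close an
    odd cycle.\<close>
  have step: "D (w (i + m - 1)) (w (i + q))" if m: "0 < m" "m < n" and nb: "\<not> b (w i) (w (i + m))" for i m
  proof (rule ccontr)
    assume "\<not> D (w (i + m - 1)) (w (i + q))"
    then obtain d where d: "d \<in> Y" "r (w (i + m - 1)) d" "r (w (i + q)) d" by (auto simp: D_def)
    define vs where "vs = rotate i ws"
    have lvs: "length vs = n" "set vs = X" "distinct vs" using n_def c(2) dws by (auto simp: vs_def)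
    define as where "as = take m vs"
    define cs where "cs = rev (drop m vs)"
    have ne: "as \<noteq> []" "cs \<noteq> []" using m lvs by (auto simp: as_def cs_def)
    have ends: "hd as = w i" "last as = w (i + m - 1)" "hd cs = w (i + q)" "last cs = w (i + m)"
    proof -
      show "hd as = w i" using nth_rot[of 0 i] m n2 lvs ne by (simp add: as_def hd_conv_nth vs_def)
      show "last as = w (i + m - 1)" using nth_rot[of "m - 1" i] m lvs ne
        by (simp add: as_def last_conv_nth vs_def)
      show "hd cs = w (i + q)" using nth_rot[of q i] m lvs ne n
        by (simp add: cs_def hd_rev last_conv_nth vs_def)
      show "last cs = w (i + m)" using nth_rot[of m i] m lvs ne
        by (simp add: cs_def last_rev hd_conv_nth vs_def hd_drop_conv_nth)
    qed
    have suc: "successively b vs"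
    proof (unfold successively_conv_nth, intro allI impI)
      fix k assume k: "Suc k < length vs"
      have "i + Suc k + q = (i + k) + n" using n by simp
      then have "w (i + Suc k + q) = w (i + k)" by (simp only: per)
      then show "b (vs ! k) (vs ! Suc k)"
        using b_step[of "i + Suc k"] nth_rot[of k i] nth_rot[of "Suc k" i] k lvs by (simp add: vs_def)
    qed
    then have sb: "successively b as" "successively b cs"
      using m by (metis append_take_drop_id as_def successively_append_iff,
        metis append_take_drop_id cs_def successively_append_iff successively_rev_sym[OF b_sym])
    obtain bs' where bs': "Suc (length bs') = length bs" "distinct (flat bs')" "set bs' \<subseteq> set bs" "d \<notin> set (flat bs')"
      using remove_block[OF bs(1) X(3)] by blast
    define b1 where "b1 = take (m - 1) bs'"
    define b2 where "b2 = drop (m - 1) bs'"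
    have bb: "bs' = b1 @ b2" by (simp add: b1_def b2_def)
    have sX: "set as \<subseteq> X" "set cs \<subseteq> X"
      using set_take_subset[of m vs] set_drop_subset[of m vs] lvs(2) by (simp_all add: as_def cs_def)
    have greedy: "\<exists>ys. viap r us ys \<and> distinct ys \<and> set ys \<subseteq> set (flat bs0)"
      if "us \<noteq> []" "length us \<le> Suc (length bs0)" "set bs0 \<subseteq> set bs" "distinct (flat bs0)" "successively b us" "set us \<subseteq> X"
      for us bs0
    proof (rule viap_greedy[OF r_sym that(1,2,4)])
      have "meets bs0 (\<lambda>d. r x d \<and> r y d)" if "b x y" "x \<in> X" "y \<in> X" for x y
        using shares that meets_sublist[OF _ \<open>set bs0 \<subseteq> set bs\<close>] unfolding b_shares_def by simp
      then show "successively (\<lambda>w x. meets bs0 (\<lambda>d. r w d \<and> r x d)) us"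
        by (rule successively_mono[OF that(5)]) (use that(6) in auto)
    qed
    have "length as \<le> Suc (length b1)" "length cs \<le> Suc (length b2)"
      using m lvs bs'(1) n q_def by (auto simp: as_def cs_def b1_def b2_def)
    then obtain ys1 ys2 where y: "viap r as ys1" "distinct ys1" "set ys1 \<subseteq> set (flat b1)"
      "viap r cs ys2" "distinct ys2" "set ys2 \<subseteq> set (flat b2)"
      using greedy[OF ne(1), of b1] greedy[OF ne(2), of b2] sb sX bs'(2,3) bb by auto
    have v: "viap r (as @ cs) (ys1 @ d # ys2)"
      using viap_append[OF y(1,4)] d ends r_commute by metis
    have "set (flat bs') \<subseteq> Y" using set_flat_mono[OF bs'(3)] bs(2) by blast
    then have "set (ys1 @ d # ys2) \<subseteq> Y" using y(3,6) d bb by auto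
    moreover have "distinct (ys1 @ d # ys2)" using y bs'(2,4) bb by auto
    moreover have "distinct (as @ cs)" "set (as @ cs) = X"
    proof -
      have "vs = as @ rev cs" by (simp add: as_def cs_def)
      then show "distinct (as @ cs)" "set (as @ cs) = X" using lvs by auto
    qed
    moreover have "r (last (as @ cs)) (hd (as @ cs))"
    proof -
      have "w i \<noteq> w (i + m)" using \<open>distinct (as @ cs)\<close> ends ne by (metis disjoint_iff distinct_append hd_in_set last_in_set)
      then show ?thesis using nb total ends ne r_commute by (metis hd_append2 last_appendR)
    qed
    ultimately show False using cyc_contra[OF v] by blast
  qed
  obtain x y where xy: "x \<in> X" "y \<in> X" "x \<noteq> y" "\<not> b x y" using neg by (auto simp: b_clique_def)
  obtain i0 j0 where ij: "i0 < n" "j0 < n" "ws ! i0 = x" "ws ! j0 = y"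
    using xy c(2) n_def by (metis in_set_conv_nth)
  define m where "m = (if i0 < j0 then j0 - i0 else j0 + n - i0)"
  have "i0 \<noteq> j0" using xy ij by auto
  then have m: "0 < m" "m < n" "(i0 + m) mod n = j0" using ij by (auto simp: m_def)
  \<comment> \<open>Modulo \<open>n\<close>, adding \<open>q\<close> means going one place back. So
    a pair that is not blue forces the pair one place before it to have disjoint neighbourhoods, and
    by \<open>D_nb\<close> that pair is not blue either.\<close>
  have shift: "D (w (i + q)) (w (i + q + m))" if "\<not> b (w i) (w (i + m))" for i
  proof -
    have "i + q + m = (i + m - 1) + n" using m n by simp
    then show ?thesis using step[OF m(1,2) that] per by (metis D_def)
  qed
  obtain u v bs' where uv: "bs = (u, v) # bs'" using X(3) by (cases bs) auto
  have uvY: "u \<in> Y" "v \<in> Y" using bs(2) uv by auto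
  have D_nb: "\<not> b (w i) (w k)" if "D (w i) (w k)" for i k
  proof
    assume "b (w i) (w k)"
    then have "meets bs (\<lambda>d. r (w i) d \<and> r (w k) d)" using shares wX unfolding b_shares_def by blast
    then show False using that uv uvY by (auto simp: meets_Cons D_def)
  qed
  have "w i0 = x" "w (i0 + m) = y" using ij m by (simp_all add: w_def)
  then have nb0: "\<not> b (w i0) (w (i0 + m))" using xy by simp
  have Dt: "D (w (i0 + Suc t * q)) (w (i0 + Suc t * q + m))" for t
  proof (induction t)
    case 0 then show ?case using shift[OF nb0] by simp
  next
    case (Suc t)
    have "i0 + Suc (Suc t) * q = i0 + Suc t * q + q" by simp
    then show ?case using shift[OF D_nb[OF Suc]] by (simp only:)
  qed
  have Dall: "D (w i) (w (i + m))" for i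
  proof -
    \<comment> \<open>Going \<open>Suc t\<close> places back from \<open>i0\<close> leads to
      \<open>i\<close> modulo \<open>n\<close>.\<close>
    define t where "t = i0 + q - i mod n"
    have "i mod n < n" using n by simp
    then have St: "Suc t + i mod n = i0 + n" using n t_def by linarith
    have "Suc t * n + i mod n = Suc t * q + (Suc t + i mod n)" using n by simp
    then have e: "i0 + Suc t * q + n = i mod n + Suc t * n" using St by simp
    have "w (i mod n + Suc t * n) = w i" "w (i mod n + Suc t * n + m) = w (i + m)"
      unfolding w_def by (metis mod_mult_self1 mod_mod_trivial, metis mod_mult_self1 mod_add_left_eq add.assoc add.commute)
    moreover have "w (i0 + Suc t * q + n) = w (i0 + Suc t * q)"
      "w (i0 + Suc t * q + n + m) = w (i0 + Suc t * q + m)"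
      using per by (metis, metis add.assoc add.commute)
    ultimately show ?thesis using Dt[of t] e by metis
  qed
  have one: "r (w i) v \<longleftrightarrow> \<not> r (w i) u" for i
    using cov[OF wX, of i] cov[OF wX, of "i + m"] Dall[of i] uv uvY by (auto simp: meets_Cons D_def)
  \<comment> \<open>Each vertex is red to exactly one of \<open>u\<close>, \<open>v\<close>.
    Cyclically consecutive vertices are joined in blue and hence agree in this choice, so all
    vertices agree, against \<open>D (w 0) (w m)\<close>.\<close>
  have "r (w (i + q)) u = r (w i) u" for i
  proof -
    have "meets bs (\<lambda>d. r (w (i + q)) d \<and> r (w i) d)" using shares wX b_step unfolding b_shares_def by blast
    then show ?thesis using one[of i] one[of "i + q"] uv by (auto simp: meets_Cons)
  qed
  then have "r (w (Suc i)) u = r (w i) u" for i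
    using per[of i] n by (metis add_Suc_shift add_Suc_right)
  then have "r (w (0 + m)) u = r (w 0) u" by (induction m) auto
  then show False using Dall[of 0] one[of 0] one[of m] uvY by (auto simp: D_def)
qed

end

section \<open>Blue cycles and the vertices outside them\<close>

fun pairs :: "'a list \<Rightarrow> ('a \<times> 'a) list" where
  "pairs (x # y # xs) = (x, y) # pairs xs"
| "pairs _ = []"

lemma flat_pairs: "even (length xs) \<Longrightarrow> flat (pairs xs) = xs"
  by (induction xs rule: pairs.induct) auto

lemma length_pairs: "length (pairs xs) = length xs div 2"
  by (induction xs rule: pairs.induct) auto

lemma in_pairs: "(u, v) \<in> set (pairs xs) \<Longrightarrow> \<exists>as bs. xs = as @ u # v # bs"
proof (induction xs rule: pairs.induct)
  case (1 x y xs)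
  show ?case
  proof (cases "(u, v) = (x, y)")
    case False
    then obtain as bs where "xs = as @ u # v # bs" using 1 by auto
    then show ?thesis by (metis append_Cons)
  qed auto
qed auto

lemma distinct_flat_take: "distinct (flat bs) \<Longrightarrow> distinct (flat (take n bs))"
  by (metis append_take_drop_id distinct_append flat_append)

definition consec :: "'a list \<Rightarrow> 'a \<Rightarrow> 'a \<Rightarrow> bool" where
  "consec C u v \<longleftrightarrow> (\<exists>as bs. C = as @ u # v # bs) \<or> (C \<noteq> [] \<and> hd C = v \<and> last C = u)"

lemma consec_innerI: "C = as @ u # v # bs \<Longrightarrow> consec C u v"
  by (auto simp: consec_def)

lemma consec_rotate1: "consec C u v \<Longrightarrow> consec (rotate1 C) u v"
proof (cases C)
  case (Cons c cs)
  assume "consec C u v"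
  then consider as bs where "C = as @ u # v # bs" | "hd C = v" "last C = u" by (auto simp: consec_def)
  then show ?thesis
  proof cases
    case 1
    then show ?thesis
      by (cases as) (auto simp: consec_def)
  next
    case 2
    show ?thesis
    proof (cases "cs = []")
      case False
      then have "last cs = u" using 2 Cons by simp
      then have "butlast cs @ [u] = cs" using append_butlast_last_id[OF False] by simp
      then have "rotate1 C = butlast cs @ u # v # []"
        using 2 Cons by (metis append.assoc append_Cons append_Nil list.sel(1) rotate1.simps(2))
      then show ?thesis by (auto simp: consec_def)
    qed (use 2 Cons in \<open>auto simp: consec_def\<close>)
  qed
qed auto

lemma consec_rotate: "consec C u v \<Longrightarrow> consec (rotate n C) u v"
  by (induction n) (auto simp: rotate_Suc consec_rotate1)

lemma rotate_back: "\<exists>m. rotate m (rotate n C) = C"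
proof (cases "C = []")
  case False
  then have "n mod length C \<le> length C" by (simp add: less_imp_le)
  then have "rotate (length C - n mod length C) (rotate (n mod length C) C) = rotate (length C) C"
    by (simp add: rotate_rotate)
  then show ?thesis by (metis rotate_conv_mod rotate_length01 rotate_id mod_self)
qed auto

lemma consec_rotate_iff: "consec (rotate n C) u v \<longleftrightarrow> consec C u v"
  using consec_rotate rotate_back by metis

lemma consec_rotation:
  assumes "consec C u v"
  obtains n where "rotate n C \<noteq> []" "hd (rotate n C) = v" "last (rotate n C) = u"
proof -
  consider as bs where "C = as @ u # v # bs" | "C \<noteq> []" "hd C = v" "last C = u"
    using assms by (auto simp: consec_def)
  then show ?thesis
  proof cases
    case 1
    then have "rotate (length (as @ [u])) C = v # bs @ as @ [u]"
      using rotate_append[of "as @ [u]" "v # bs"] by simp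
    then show ?thesis using that[of "length (as @ [u])"] by simp
  next
    case 2
    then show ?thesis using that[of 0] by simp
  qed
qed

lemma consec_in_set: "consec C u v \<Longrightarrow> u \<in> set C \<and> v \<in> set C"
  by (auto simp: consec_def)

text \<open>In each consecutive pair one entry has \<open>P\<close> and the other has
  \<open>Q\<close>, since no entry has both. So \<open>P\<close> alternates along \<open>D\<close>,
  and the even length makes the two ends differ.\<close>

lemma alternation:
  assumes "successively (\<lambda>x y. (P x \<or> P y) \<and> (Q x \<or> Q y)) D" "even (length D)" "D \<noteq> []"
    "\<And>x. x \<in> set D \<Longrightarrow> \<not> (P x \<and> Q x)" "\<not> P (hd D)"
  shows "P (last D)"
  using assms
proof (induction D rule: pairs.induct)
  case (1 x y D)
  show ?case
  proof (cases D)
    case (Cons z zs)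
    have "P y" "\<not> Q y" using 1 by auto
    then have "\<not> P z" using 1 Cons by auto
    then show ?thesis using 1 Cons by auto
  qed (use 1 in auto)
qed auto

lemma cyc_snoc: "cyc E L \<Longrightarrow> w \<notin> set L \<Longrightarrow> E (last L) w \<Longrightarrow> E w (hd L) \<Longrightarrow> cyc E (L @ [w])"
  by (auto simp: cyc_def successively_append_iff)

text \<open>A bipartite graph without two disjoint edges is a star or has no edges. Deleting the
  centre of the star of blue edges later costs one vertex and leaves only red edges between two
  cliques.\<close>

lemma star_cover:
  assumes "S \<noteq> {}" "T \<noteq> {}"
    "\<And>s s' t t'. s \<in> S \<Longrightarrow> s' \<in> S \<Longrightarrow> t \<in> T \<Longrightarrow> t' \<in> T \<Longrightarrow> E s t \<Longrightarrow> E s' t' \<Longrightarrow> s = s' \<or> t = t'"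
  shows "(\<exists>t0\<in>T. \<forall>s\<in>S. \<forall>t\<in>T. E s t \<longrightarrow> t = t0) \<or> (\<exists>s0\<in>S. \<forall>s\<in>S. \<forall>t\<in>T. E s t \<longrightarrow> s = s0)"
proof (cases "\<exists>s\<in>S. \<exists>t\<in>T. E s t")
  case True
  then obtain s0 t0 where 0: "s0 \<in> S" "t0 \<in> T" "E s0 t0" by blast
  show ?thesis
  proof (rule ccontr)
    assume neg: "\<not> ?thesis"
    obtain s t where 1: "s \<in> S" "t \<in> T" "E s t" "t \<noteq> t0" using neg 0(2) by blast
    obtain s' t' where 2: "s' \<in> S" "t' \<in> T" "E s' t'" "s' \<noteq> s0" using neg 0(1) by blast
    have "s = s0" using assms(3)[OF 1(1) 0(1) 1(2) 0(2) 1(3) 0(3)] 1(4) by blast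
    moreover have "t' = t0" using assms(3)[OF 2(1) 0(1) 2(2) 0(2) 2(3) 0(3)] 2(4) by blast
    ultimately show False using assms(3)[OF 1(1) 2(1) 1(2) 2(2) 1(3) 2(3)] 1(4) 2(4) by blast
  qed
qed (use assms in blast)

lemma obtain_superset_with_card:
  assumes "finite W" "T \<subseteq> W" "card T \<le> n" "n \<le> card W"
  obtains X where "T \<subseteq> X" "X \<subseteq> W" "card X = n" "finite X"
  using exists_subset_between[OF assms(3,4,2,1)] assms(1) finite_subset by blast

context two_coloring
begin

lemma not_r: "x \<noteq> y \<Longrightarrow> \<not> r x y \<longleftrightarrow> b x y" using total exclusive by blast
lemma not_b: "x \<noteq> y \<Longrightarrow> \<not> b x y \<longleftrightarrow> r x y" using total exclusive by blast

definition ins :: "'a \<Rightarrow> 'a list \<Rightarrow> bool" where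
  "ins w C \<longleftrightarrow> (\<exists>u v. consec C u v \<and> b w u \<and> b w v)"

lemma insert_edge:
  assumes "cyc b C" "consec C u v" "w \<notin> set C" "w' \<notin> set C" "w \<noteq> w'" "b w u" "b w w'" "b w' v"
    "set C \<subseteq> H" "w \<in> H" "w' \<in> H"
  shows "has_cycle b H (length C + 2)"
proof -
  obtain n where n: "rotate n C \<noteq> []" "hd (rotate n C) = v" "last (rotate n C) = u"
    using consec_rotation[OF assms(2)] .
  have "cyc b (rotate n C)" using assms(1) cyc_rotate by blast
  then have "cyc b (rotate n C @ [w, w'])"
    using n assms b_commute by (auto simp: cyc_def successively_append_iff)
  then show ?thesis using assms by (intro has_cycleI[of b "rotate n C @ [w, w']"]) auto
qed

lemma insert_two:
  assumes "cyc b C" "consec C u v" "consec C u' v'" "(u, v) \<noteq> (u', v')" "w \<notin> set C" "w' \<notin> set C" "w \<noteq> w'"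
    "b w u" "b w v" "b w' u'" "b w' v'" "set C \<subseteq> H" "w \<in> H" "w' \<in> H"
  shows "has_cycle b H (length C + 2)"
proof -
  obtain n where n: "rotate n C \<noteq> []" "hd (rotate n C) = v" "last (rotate n C) = u"
    using consec_rotation[OF assms(2)] .
  define D where "D = rotate n C"
  have D: "cyc b D" "set D = set C" "length D = length C" "D \<noteq> []" "hd D = v" "last D = u"
    using assms(1) cyc_rotate n by (auto simp: D_def)
  have "consec D u' v'" using assms(3) consec_rotate D_def by metis
  then obtain as bs where as: "D = as @ u' # v' # bs" using D assms(4) by (auto simp: consec_def)
  have w: "w \<notin> set D" "w' \<notin> set D" "b u w" "b u' w'" using D assms b_commute by auto
  have "cyc b (D @ [w])"
    by (rule cyc_snoc) (use D w assms(9) in auto)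
  then have "cyc b ((as @ [u']) @ (v' # bs @ [w]))" unfolding as by simp
  then have c: "cyc b ((v' # bs @ [w]) @ (as @ [u']))" by (rule cyc_append_commute)
  have "w' \<notin> set ((v' # bs @ [w]) @ (as @ [u']))" using w(2) assms(7) unfolding as by auto
  then have "cyc b ((v' # bs @ [w] @ as @ [u']) @ [w'])"
    using cyc_snoc[OF c, of w'] w(4) assms(11) by simp
  moreover have "set ((v' # bs @ [w] @ as @ [u']) @ [w']) \<subseteq> insert w (insert w' (set C))"
    using D(2) as by auto
  moreover have "length ((v' # bs @ [w] @ as @ [u']) @ [w']) = length C + 2" using D(3) as by simp
  ultimately show ?thesis using assms by (blast intro: has_cycleI)
qed

text \<open>Two disjoint blue edges from a blue clique to a blue cycle: combine the longer arc with as many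
  vertices of the clique as needed.\<close>

lemma clique_arc_cycle:
  assumes "cyc b C" "length C = 2 * l" "b_clique W" "finite W" "l + 1 \<le> card W" "W \<inter> set C = {}"
    "w \<in> W" "w' \<in> W" "w \<noteq> w'" "a \<in> set C" "c \<in> set C" "a \<noteq> c" "b w a" "b w' c" "set C \<subseteq> H" "W \<subseteq> H"
  shows "has_cycle b H (2 * l + 2)"
proof -
  obtain n xs zs where n: "rotate n C = a # xs @ c # zs" using rotate_to_two[OF assms(10-12)] by blast
  have D: "cyc b (a # xs @ c # zs)" using n assms(1) cyc_rotate by metis
  have set_C: "set C = set (a # xs @ c # zs)" using n by (metis set_rotate)
  have len: "length xs + length zs + 2 = 2 * l" using n assms(2) by (metis length_rotate length_Cons length_append add.assoc add_Suc_right add_2_eq_Suc')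
  have join: "has_cycle b H (2 * l + 2)"
    if P: "successively b P" "distinct P" "set P \<subseteq> set C" "l + 1 \<le> length P" "length P \<le> 2 * l"
      "hd P = p" "last P = p'" "b u p" "b u' p'" "u \<in> W" "u' \<in> W" "u \<noteq> u'" for P p p' u u'
  proof -
    have num: "2 \<le> 2 * l + 2 - length P" "2 * l + 2 - length P \<le> card W" using P(4,5) assms(5) by linarith+
    obtain ms where ms: "distinct (u' # ms @ [u])" "set (u' # ms @ [u]) \<subseteq> W"
      "length (u' # ms @ [u]) = 2 * l + 2 - length P"
      by (rule obtain_list_with_ends[OF assms(4) P(11,10) P(12)[symmetric] num])
    have "successively b (u' # ms @ [u])"
      using assms(3) ms by (intro successively_complete) (auto simp: b_clique_def)
    moreover have "P \<noteq> []" using P(4) by auto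
    moreover have "set P \<inter> set (u' # ms @ [u]) = {}" using P(3) ms(2) assms(6) by blast
    ultimately have "cyc b (P @ u' # ms @ [u])"
      using P ms b_commute unfolding cyc_def by (auto simp: successively_append_iff)
    moreover have "length (P @ u' # ms @ [u]) = 2 * l + 2" using ms(3) P(5) by simp
    moreover have "set (P @ u' # ms @ [u]) \<subseteq> H" using P(3) ms(2) assms(15,16) by auto
    ultimately show ?thesis by (blast intro: has_cycleI)
  qed
  have "successively b ((a # xs @ [c]) @ zs)" using D by (simp add: cyc_def)
  then have s1: "successively b (a # xs @ [c])" by (simp only: successively_append_iff)
  have "cyc b ((c # zs) @ (a # xs))" using D cyc_append_commute[of b "a # xs" "c # zs"] by simp
  then have "successively b ((c # zs @ [a]) @ xs)" by (simp add: cyc_def)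
  then have s2: "successively b (c # zs @ [a])" by (simp only: successively_append_iff)
  have d: "distinct (a # xs @ c # zs)" using D by (simp add: cyc_def)
  \<comment> \<open>The two arcs between \<open>a\<close> and \<open>c\<close> have
    \<open>2l + 2\<close> vertices together, counting \<open>a\<close> and \<open>c\<close> twice,
    so one of them has at least \<open>l + 1\<close>, and the clique has to contribute at most
    \<open>l + 1\<close>.\<close>
  show ?thesis
  proof (cases "length zs \<le> length xs")
    case True
    then show ?thesis using join[of "a # xs @ [c]" a c w w'] s1 d set_C len assms by auto
  next
    case False
    then show ?thesis using join[of "c # zs @ [a]" c a w' w] s2 d set_C len assms by auto
  qed
qed

text \<open>A path from \<open>x\<close> to \<open>y\<close> that alternates between the two sides
  is closed by the red edge inside \<open>B\<close>.\<close>

lemma odd_cycle_in_join: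
  assumes "finite A" "finite B" "A \<inter> B = {}" "\<And>x y. x \<in> A \<Longrightarrow> y \<in> B \<Longrightarrow> r x y"
    "k \<le> card A" "k + 1 \<le> card B" "x \<in> B" "y \<in> B" "r x y" "1 \<le> k"
  shows "has_cycle r (A \<union> B) (2 * k + 1)"
proof -
  have "x \<noteq> y" using assms(9) r_irrefl by auto
  then obtain zs where zs: "distinct (x # zs @ [y])" "set (x # zs @ [y]) \<subseteq> B" "length (x # zs @ [y]) = k + 1"
    using obtain_list_with_ends[OF assms(2,7,8), of "k + 1"] assms by auto
  obtain as where as: "distinct as" "set as \<subseteq> A" "length as = k" using obtain_distinct_list[OF assms(1,5)] .
  have rr: "r w a \<and> r a w" if "w \<in> B" "a \<in> A" for w a
    using assms(4)[OF that(2,1)] r_commute by blast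
  have "viap r (x # zs @ [y]) as"
    by (rule viap_complete) (use zs as rr in auto)
  then have "has_cycle r (A \<union> B) (length (x # zs @ [y]) + length as)"
    using zs as assms r_commute by (intro viap_closed_has_cycle) auto
  moreover have "length (x # zs @ [y]) + length as = 2 * k + 1" using zs(3) as(3) by linarith
  ultimately show ?thesis by (simp only:)
qed

text \<open>If \<open>w w'\<close>, \<open>w x\<close> and \<open>w' y\<close> were all blue, the
  edge \<open>w w'\<close> could be spliced in between \<open>x\<close> and \<open>y\<close>, and
  the cycle would grow by two. As \<open>w\<close> and \<open>w'\<close> both have a red neighbour
  in the block, they are left with a common one.\<close>

lemma b_shares_if_no_insertion:
  assumes C: "cyc b C" "set C \<subseteq> H" and W: "W \<subseteq> H - set C"
    and nb: "\<not> has_cycle b H (length C + 2)"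
    and bs: "\<And>x y. (x, y) \<in> set bs \<Longrightarrow> consec C x y"
    and nins: "\<And>w x y. w \<in> W \<Longrightarrow> (x, y) \<in> set bs \<Longrightarrow> \<not> (b w x \<and> b w y)"
  shows "b_shares W bs" "w \<in> W \<Longrightarrow> meets bs (r w)"
proof -
  have red: "r w x \<or> r w y" if "w \<in> W" "(x, y) \<in> set bs" for w x y
    using nins[OF that] that consec_in_set[OF bs[OF that(2)]] W not_r by (metis DiffD2 subsetD)
  then show "w \<in> W \<Longrightarrow> meets bs (r w)" by (auto simp: meets_def)
  show "b_shares W bs"
    unfolding b_shares_def meets_def
  proof (intro ballI impI, clarify)
    fix w w' x y
    assume w: "w \<in> W" "w' \<in> W" "b w w'" "(x, y) \<in> set bs" and no: "\<not> (r w y \<and> r w' y)"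
    have "w \<noteq> w'" using w(3) b_irrefl by auto
    have xy: "x \<in> set C" "y \<in> set C" using consec_in_set[OF bs[OF w(4)]] by auto
    have "w \<notin> set C" "w' \<notin> set C" "w \<in> H" "w' \<in> H" using w W by auto
    then have 1: "\<not> (b w x \<and> b w' y)" "\<not> (b w' x \<and> b w y)"
      using insert_edge[OF C(1) bs[OF w(4)], of w w' H] insert_edge[OF C(1) bs[OF w(4)], of w' w H]
        \<open>w \<noteq> w'\<close> w(3) C(2) nb b_commute by blast+
    have "w \<noteq> x" "w \<noteq> y" "w' \<noteq> x" "w' \<noteq> y" using \<open>w \<notin> set C\<close> \<open>w' \<notin> set C\<close> xy by auto
    then show "r w x \<and> r w' x"
      using 1 no red[OF w(1,4)] red[OF w(2,4)] not_b total by blast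
  qed
qed

text \<open>In other words, at most one vertex outside \<open>C\<close> can be inserted. Two
  insertable vertices \<open>w1\<close>, \<open>w2\<close> fit at one edge \<open>u v\<close> only,
  the same for both, since otherwise both could be inserted. They are not joined in blue, so a set
  containing them splits, and some \<open>z\<close> has no red neighbour on \<open>C\<close> in
  common with \<open>w1\<close>. Along the even path from \<open>v\<close> to \<open>u\<close> the
  red neighbours of \<open>w1\<close> then alternate, although \<open>w1\<close> is blue to both
  ends.\<close>

lemma noninsertable_many:
  assumes C: "cyc b C" "length C = 2 * l" "set C \<subseteq> H" and H: "finite H" "3 * l + 2 \<le> card H"
    and k: "1 \<le> k" "k \<le> l"
    and nb: "\<not> has_cycle b H (2 * l + 2)" and nr: "\<not> has_cycle r H (2 * k + 1)"
  shows "card H \<le> 2 * l + 1 + card {w \<in> H - set C. \<not> ins w C}"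
proof (rule ccontr)
  assume few: "\<not> ?thesis"
  define W where "W = H - set C"
  define I where "I = {w \<in> W. ins w C}"
  have dC: "distinct C" using C(1) by (simp add: cyc_def)
  have "card (set C) = 2 * l" using dC C(2) by (simp add: distinct_card)
  then have cW': "card W + 2 * l = card H"
    using H C(3) card_mono[OF H(1) C(3)] by (simp add: W_def card_Diff_subset)
  then have cW: "l + 2 \<le> card W" using H by linarith
  have fin: "finite W" "finite I" using H by (auto simp: W_def I_def)
  have "W - I = {w \<in> H - set C. \<not> ins w C}" by (auto simp: W_def I_def)
  then have "\<not> card H \<le> 2 * l + 1 + (card W - card I)" using few diff_card_le_card_Diff[OF fin(2), of W] by simp
  then have "\<not> card I \<le> Suc 0" using cW' by linarith
  then obtain w1 w2 where w12: "w1 \<in> I" "w2 \<in> I" "w1 \<noteq> w2"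
    using card_le_Suc0_iff_eq[OF fin(2)] by blast
  have nb': "\<not> has_cycle b H (length C + 2)" using nb C(2) by simp
  have same: "(u, v) = (u', v')"
    if "w \<in> W" "w' \<in> W" "w \<noteq> w'" "consec C u v" "consec C u' v'" "b w u" "b w v" "b w' u'" "b w' v'"
    for w w' u v u' v'
    using insert_two[OF C(1) that(4,5) _ _ _ that(3,6-9) C(3)] that(1,2) nb' by (auto simp: W_def)
  obtain u v where uv: "consec C u v" "b w1 u" "b w1 v" using w12(1) by (auto simp: I_def ins_def)
  have W12: "w1 \<in> W" "w2 \<in> W" using w12 by (auto simp: I_def)
  obtain u2 v2 where uv2: "consec C u2 v2" "b w2 u2" "b w2 v2" using w12(2) by (auto simp: I_def ins_def)
  have w2uv: "b w2 u" "b w2 v"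
    using same[OF W12 w12(3) uv(1) uv2(1) uv(2,3) uv2(2,3)] uv2 by simp_all
  have all_same: "(u', v') = (u, v)" if "w \<in> W" "consec C u' v'" "b w u'" "b w v'" for w u' v'
    using same[OF that(1) W12(1) _ that(2) uv(1) that(3,4) uv(2,3)]
      same[OF that(1) W12(2) _ that(2) uv(1) that(3,4) w2uv] w12(3) by blast
  obtain n where n: "rotate n C \<noteq> []" "hd (rotate n C) = v" "last (rotate n C) = u"
    using consec_rotation[OF uv(1)] .
  \<comment> \<open>The edge \<open>u v\<close> becomes the closing edge of \<open>D\<close>, so it
    is not among the consecutive pairs inside \<open>D\<close>, at which nothing can be
    inserted.\<close>
  define D where "D = rotate n C"
  have D: "set D = set C" "length D = 2 * l" "distinct D" "D \<noteq> []" "hd D = v" "last D = u"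
    using n C(2) dC by (auto simp: D_def)
  have inner: "consec C x y \<and> (x, y) \<noteq> (u, v)" if e: "D = as @ x # y # cs" for as cs x y
  proof
    show "consec C x y" using consec_innerI[OF e] consec_rotate_iff D_def by metis
    have "last D \<noteq> x" using D(3) e by (auto split: if_splits)
    then show "(x, y) \<noteq> (u, v)" using D by auto
  qed
  \<comment> \<open>With \<open>k\<close> blocks and \<open>k + 1\<close> outside vertices the odd
    cycle to be excluded has length \<open>2k + 1\<close>.\<close>
  define bs where "bs = take k (pairs D)"
  have bsD: "(x, y) \<in> set bs \<Longrightarrow> \<exists>as cs. D = as @ x # y # cs" for x y
    using in_pairs in_set_takeD unfolding bs_def by metis
  have bs: "length bs = k" "distinct (flat bs)" "set (flat bs) \<subseteq> set C"
  proof -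
    have ev: "even (length D)" using D by simp
    show "length bs = k" using D(2) k by (simp add: bs_def length_pairs)
    show "distinct (flat bs)" using D(3) flat_pairs[OF ev] distinct_flat_take[of "pairs D" k] by (simp add: bs_def)
    show "set (flat bs) \<subseteq> set C"
      using set_flat_mono[OF set_take_subset, of k "pairs D"] flat_pairs[OF ev] D(1) by (simp add: bs_def)
  qed
  have nins: "\<not> (b w x \<and> b w y)" if "w \<in> W" "D = as @ x # y # cs" for w x y as cs
    using all_same[OF that(1)] inner[OF that(2)] by blast
  note sh = b_shares_if_no_insertion[OF C(1,3), of W bs]
  have W_bs: "b_shares W bs" "\<And>w. w \<in> W \<Longrightarrow> meets bs (r w)"
    by (rule sh; use nb' W_def inner nins bsD in blast)+
  have "\<not> b w1 w2"
    using insert_edge[OF C(1) uv(1), of w1 w2 H] W12 w12(3) uv w2uv C(3) nb' by (auto simp: W_def)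
  obtain X where X: "{w1, w2} \<subseteq> X" "X \<subseteq> W" "card X = k + 1" "finite X"
    using obtain_superset_with_card[OF fin(1), of "{w1, w2}" "k + 1"] W12 w12(3) k cW by auto
  have XH: "X \<union> set C \<subseteq> H" using X(2) C(3) by (auto simp: W_def)
  have "b_clique X \<or> splits r X (set C)"
  proof (rule b_clique_or_split[of X bs])
    show "bs \<noteq> []" using bs(1) k by auto
    show "X \<inter> set C = {}" using X(2) by (auto simp: W_def)
    show "b_shares X bs" using W_bs(1) X(2) unfolding b_shares_def by blast
    show "\<not> has_cycle r (X \<union> set C) (2 * length bs + 1)" using nr has_cycle_mono[OF _ XH] bs(1) by metis
  qed (use X bs W_bs in auto)
  moreover have "\<not> b_clique X" using X(1) w12(3) \<open>\<not> b w1 w2\<close> by (auto simp: b_clique_def)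
  ultimately obtain z where z: "z \<in> X" "\<forall>d\<in>set C. \<not> (r w1 d \<and> r z d)"
    using X(1) unfolding splits_def by (metis Un_iff insert_subset all_not_in_conv)
  have "r w1 (last D)"
  proof (rule alternation[of "r w1" "r z" D])
    show "successively (\<lambda>x y. (r w1 x \<or> r w1 y) \<and> (r z x \<or> r z y)) D"
    proof (unfold successively_conv_nth, intro allI impI)
      fix i assume i: "Suc i < length D"
      have e: "D = take i D @ D ! i # D ! Suc i # drop (Suc (Suc i)) D"
        using i by (simp add: Cons_nth_drop_Suc)
      have "D ! i \<in> set C" "D ! Suc i \<in> set C" using i D(1) by (metis Suc_lessD nth_mem, metis nth_mem)
      then have "w \<noteq> D ! i" "w \<noteq> D ! Suc i" if "w \<in> W" for w using that by (auto simp: W_def)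
      then show "(r w1 (D ! i) \<or> r w1 (D ! Suc i)) \<and> (r z (D ! i) \<or> r z (D ! Suc i))"
        using nins[OF _ e] W12(1) z(1) X(2) not_r by blast
    qed
    show "\<not> r w1 (hd D)" using uv(3) D(5) exclusive by blast
  qed (use D z in auto)
  then show False using uv(2) D(6) exclusive by blast
qed

text \<open>If two words are disjoint, a vertex of the cycle is replaced by an outside vertex; afterwards the other
  word has two consecutive red positions, which excludes a second split.\<close>

lemma blue_clique_outside:
  assumes C: "cyc b C" "length C = 2 * l" "set C \<subseteq> H" and H: "finite H" "3 * l + 2 \<le> card H"
    and k: "2 \<le> k" "k \<le> l"
    and nb: "\<not> has_cycle b H (2 * l + 2)" and nr: "\<not> has_cycle r H (2 * k + 1)"
  shows "\<exists>D W. cyc b D \<and> length D = 2 * l \<and> set D \<subseteq> H \<and> W \<subseteq> H - set D \<and>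
    card H \<le> 2 * l + 1 + card W \<and> b_clique W"
proof (rule ccontr)
  assume neg: "\<not> ?thesis"
  define N where "N D = {w \<in> H - set D. \<not> ins w D}" for D
  have alt: "b_shares (N D) (pairs D) \<and> (\<forall>w\<in>N D. meets (pairs D) (r w))"
    if "cyc b D" "length D = 2 * l" "set D \<subseteq> H" for D
    using b_shares_if_no_insertion[of D H "N D" "pairs D"] that nb in_pairs consec_innerI
    by (metis (no_types, lifting) N_def ins_def mem_Collect_eq subsetI)
  have split: "splits r X (set D)"
    if D: "cyc b D" "length D = 2 * l" "set D \<subseteq> H" and X: "X \<subseteq> N D" "card X = k + 1" "finite X" "\<not> b_clique X" for D X
  proof -
    define bs where "bs = take k (pairs D)"
    have ev: "even (length D)" "distinct D" using D by (auto simp: cyc_def)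
    have bs: "length bs = k" "distinct (flat bs)" "set (flat bs) \<subseteq> set D" "set bs \<subseteq> set (pairs D)"
      using D(2) k flat_pairs[OF ev(1)] distinct_flat_take[of "pairs D" k] ev(2) set_flat_mono[OF set_take_subset, of k "pairs D"]
        set_take_subset
      by (auto simp: bs_def length_pairs dest: in_set_takeD)
    have XH: "X \<union> set D \<subseteq> H" using X(1) D(3) by (auto simp: N_def)
    have "b_clique X \<or> splits r X (set D)"
    proof (rule b_clique_or_split[of X bs])
      show "bs \<noteq> []" using bs(1) k by auto
      show "X \<inter> set D = {}" using X(1) by (auto simp: N_def)
      show "b_shares X bs" using alt[OF D] X(1) meets_sublist[OF _ bs(4)] unfolding b_shares_def by blast
      show "\<not> has_cycle r (X \<union> set D) (2 * length bs + 1)" using nr has_cycle_mono[OF _ XH] bs(1) by metis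
      show "\<And>w. w \<in> X \<Longrightarrow> meets bs (r w)" using alt[OF D] X(1) meets_sublist[OF _ bs(4)] by blast
    qed (use X bs in auto)
    then show ?thesis using X(4) by blast
  qed
  have cardN': "card H \<le> 2 * l + 1 + card (N D)" and finN: "finite (N D)"
    if "cyc b D" "length D = 2 * l" "set D \<subseteq> H" for D
    using noninsertable_many[OF that H _ k(2) nb nr] k H(1) by (auto simp: N_def)
  have cardN: "l + 1 \<le> card (N D)" if "cyc b D" "length D = 2 * l" "set D \<subseteq> H" for D
    using cardN'[OF that] H(2) by linarith
  have nonclique: "\<exists>w\<in>N D. \<exists>x\<in>N D. w \<noteq> x \<and> \<not> b w x"
    if D: "cyc b D" "length D = 2 * l" "set D \<subseteq> H" for D
  proof (rule ccontr)
    assume c: "\<not> ?thesis"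
    then have "b_clique (N D)" "N D \<subseteq> H - set D" by (auto simp: b_clique_def N_def)
    then show False using neg D cardN'[OF D] by blast
  qed
  have cov: "r w u \<or> r w v" if "w \<in> N D" "consec D u v" for w u v D
  proof -
    have "w \<noteq> u" "w \<noteq> v" using consec_in_set[OF that(2)] that(1) by (auto simp: N_def)
    moreover have "\<not> (b w u \<and> b w v)" using that by (auto simp: N_def ins_def)
    ultimately show ?thesis using total by blast
  qed
  obtain w x where wx: "w \<in> N C" "x \<in> N C" "w \<noteq> x" "\<not> b w x" using nonclique[OF C] by blast
  obtain X where X: "{w, x} \<subseteq> X" "X \<subseteq> N C" "card X = k + 1" "finite X"
    using obtain_superset_with_card[OF finN[OF C], of "{w, x}" "k + 1"] wx cardN[OF C] k by auto
  have "\<not> b_clique X" using X(1) wx by (auto simp: b_clique_def)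
  then obtain e p where ep: "e \<in> N C" "p \<in> N C" "\<forall>d\<in>set C. \<not> (r e d \<and> r p d)"
    using split[OF C X(2-4)] X(2) unfolding splits_def by (metis Un_iff all_not_in_conv subsetD)
  have nbe: "\<not> b e p"
  proof
    assume "b e p"
    then have m: "meets (pairs C) (\<lambda>d. r e d \<and> r p d)" using alt[OF C] ep by (auto simp: b_shares_def)
    have "pairs C \<noteq> []" using C(2) k length_pairs[of C] by auto
    then obtain u v where uv: "(u, v) \<in> set (pairs C)" by (metis last_in_set surj_pair)
    then have "u \<in> set C" "v \<in> set C" using in_pairs by force+
    then show False using m uv ep(3) by (auto simp: meets_def)
  qed
  have l2: "4 \<le> length C" using C(2) k by simp
  obtain c1 c2 cs where c12: "C = c1 # c2 # cs" using l2 by (cases C; cases "tl C") auto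
  have "consec C c1 c2" using consec_innerI[of C "[]" c1 c2 cs] c12 by simp
  then obtain y where y: "y \<in> set C" "r e y" using cov[OF ep(1)] c12 by auto
  obtain n rest where n: "rotate n C = y # rest" using rotate_to_hd[OF y(1)] by blast
  have len: "length (y # rest) = 2 * l" using n C(2) by (metis length_rotate)
  then obtain y2 rest' where rest: "rest = y2 # rest'" "rest' \<noteq> []" using C(2) l2 by (cases rest; cases "tl rest") auto
  have set_C: "set C = set (y # rest)" using n by (metis set_rotate)
  have cyc_yr: "cyc b (y # rest)" using C(1) n cyc_rotate by metis
  have cs1: "consec C y y2" using consec_innerI[of "y # rest" "[]" y y2 rest'] rest n consec_rotate_iff by (metis append_Nil)
  have cs2: "consec C (last rest) y"
    using consec_rotate_iff[of n C "last rest" y] n rest by (auto simp: consec_def)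
  \<comment> \<open>Since \<open>p\<close> misses \<open>y\<close>, it is red to both neighbours of
    \<open>y\<close> on the cycle. As \<open>e\<close> shares no red neighbour with
    \<open>p\<close>, it is blue to both of them and can replace \<open>y\<close>.\<close>
  have "\<not> r p y" using ep(3) y by blast
  then have rp: "r p y2" "r p (last rest)" using cov[OF ep(2) cs1] cov[OF ep(2) cs2] by auto
  have e_out: "e \<notin> set C" "e \<in> H" "p \<notin> set C" "p \<in> H" using ep by (auto simp: N_def)
  have in_C: "y2 \<in> set C" "last rest \<in> set C" using set_C rest by auto
  have be: "b e y2" "b e (last rest)"
    using rp ep(3) in_C e_out not_r by metis+
  define D where "D = e # rest"
  have D: "cyc b D" "length D = 2 * l" "set D \<subseteq> H"
    using cyc_yr be rest len set_C e_out C(3) b_commute by (auto simp: D_def cyc_def)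
  have dist: "distinct (y # rest)" using cyc_yr by (simp add: cyc_def)
  have pe: "p \<noteq> e"
    using ep(3) y(1,2) by blast
  have rpe: "r p e" using nbe pe not_b r_commute by metis
  have "\<not> ins p D"
  proof
    assume "ins p D"
    then obtain u v where uv: "consec D u v" "b p u" "b p v" by (auto simp: ins_def)
    have "u \<noteq> e" "v \<noteq> e" using rpe uv exclusive by blast+
    then obtain as bs where as: "D = as @ u # v # bs" using uv(1) by (auto simp: consec_def D_def)
    then obtain as' where "rest = as' @ u # v # bs" using \<open>u \<noteq> e\<close> by (cases as) (auto simp: D_def)
    then have "consec C u v" using consec_innerI[of "y # rest" "y # as'" u v bs] n consec_rotate_iff by (metis append_Cons)
    then show False using ep(2) uv by (auto simp: N_def ins_def)
  qed
  then have pN: "p \<in> N D" using e_out pe set_C by (auto simp: N_def D_def)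
  \<comment> \<open>The new cycle \<open>D\<close> is treated in the same way, with \<open>p\<close>
    put into the set that has to split, so that \<open>p\<close> again obtains a partner
    \<open>z\<close> without common red neighbours.\<close>
  obtain w' x' where wx': "w' \<in> N D" "x' \<in> N D" "w' \<noteq> x'" "\<not> b w' x'" using nonclique[OF D] by blast
  have "card {w', x', p} \<le> 3" by (simp add: card_insert_le_m1)
  then obtain X' where X': "{w', x', p} \<subseteq> X'" "X' \<subseteq> N D" "card X' = k + 1" "finite X'"
    using obtain_superset_with_card[OF finN[OF D], of "{w', x', p}" "k + 1"] wx' pN cardN[OF D] k by auto
  have "\<not> b_clique X'" using X'(1) wx' by (auto simp: b_clique_def)
  then obtain z where z: "z \<in> N D" "\<forall>d\<in>set D. \<not> (r p d \<and> r z d)"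
    using split[OF D X'(2-4)] X'(1,2) unfolding splits_def
    by (metis (no_types, lifting) Un_iff all_not_in_conv insert_subset subsetD)
  \<comment> \<open>The consecutive vertices \<open>e\<close> and \<open>y2\<close> are both red to
    \<open>p\<close>, which leaves \<open>z\<close> no red neighbour in this pair.\<close>
  have "consec D e y2" using consec_innerI[of D "[]" e y2 rest'] rest by (simp add: D_def)
  then show False using cov[OF z(1)] z(2) rpe rp(1) rest by (auto simp: D_def)
qed

end

section \<open>Pairs of blue cliques joined in red\<close>

lemma split_number:
  fixes n a c :: nat
  assumes "4 \<le> n" "n \<le> a + c" "2 \<le> a" "2 \<le> c"
  obtains p q where "2 \<le> p" "p \<le> a" "2 \<le> q" "q \<le> c" "p + q = n"
proof (cases "n \<le> a + 2")
  case True
  then show ?thesis using assms by (intro that[of "n - 2" 2]) auto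
next
  case False
  then show ?thesis using assms by (intro that[of a "n - a"]) auto
qed

context two_coloring
begin

lemma r_symD: "r x y \<Longrightarrow> r y x" using r_sym by (rule sympD)
lemma b_symD: "b x y \<Longrightarrow> b y x" using b_sym by (rule sympD)

definition joined :: "'a set \<Rightarrow> 'a set \<Rightarrow> 'a set \<Rightarrow> bool" where
  "joined H A B \<longleftrightarrow> A \<subseteq> H \<and> B \<subseteq> H \<and> A \<inter> B = {} \<and> b_clique A \<and> b_clique B \<and> (\<forall>a\<in>A. \<forall>x\<in>B. r a x)"

lemma joined_commute: "joined H A B \<longleftrightarrow> joined H B A"
  by (auto simp: joined_def intro: r_symD)

lemma b_clique_mono: "b_clique S \<Longrightarrow> T \<subseteq> S \<Longrightarrow> b_clique T"
  by (auto simp: b_clique_def)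

lemma b_clique_successively: "b_clique S \<Longrightarrow> set xs \<subseteq> S \<Longrightarrow> distinct xs \<Longrightarrow> successively b xs"
  by (intro successively_complete) (auto simp: b_clique_def)

lemma b_clique_has_cycle:
  assumes "b_clique S" "finite S" "2 \<le> n" "n \<le> card S"
  shows "has_cycle b S n"
proof -
  obtain xs where xs: "distinct xs" "set xs \<subseteq> S" "length xs = n" using obtain_distinct_list[OF assms(2,4)] .
  have ne: "xs \<noteq> []" using xs assms(3) by auto
  have "last xs \<noteq> hd xs" using xs assms(3) by (cases xs) (auto split: if_splits)
  moreover have "last xs \<in> S" "hd xs \<in> S" using ne xs(2) by auto
  ultimately have "b (last xs) (hd xs)" using assms(1) by (simp add: b_clique_def)
  then have "cyc b xs" using xs ne b_clique_successively[OF assms(1)] by (simp add: cyc_def)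
  then show ?thesis using xs by (blast intro: has_cycleI)
qed

text \<open>Two disjoint connections \<open>c1\<close>, \<open>c2\<close> between the cliques
  suffice for all lengths in the range, because the stretch inside each clique may have any number
  of vertices from two to all.\<close>

lemma two_cliques_cycle:
  assumes cl: "b_clique A" "b_clique B" "finite A" "finite B" "A \<inter> B = {}"
    and ab: "a \<in> A" "a' \<in> A" "a \<noteq> a'" "x \<in> B" "x' \<in> B" "x \<noteq> x'"
    and c: "successively b (a # c1 @ [x])" "successively b (a' # c2 @ [x'])" "distinct (c1 @ c2)"
      "set (c1 @ c2) \<inter> (A \<union> B) = {}"
    and n: "4 + length c1 + length c2 \<le> n" "n \<le> card A + card B + length c1 + length c2"
    and H: "A \<union> B \<union> set c1 \<union> set c2 \<subseteq> H"
  shows "has_cycle b H n"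
proof -
  have "card {a, a'} \<le> card A" "card {x, x'} \<le> card B"
    using ab cl card_mono[of A "{a, a'}"] card_mono[of B "{x, x'}"] by blast+
  then have two: "2 \<le> card A" "2 \<le> card B" using ab by auto
  have "4 \<le> n - length c1 - length c2" "n - length c1 - length c2 \<le> card A + card B" using n by linarith+
  then obtain p q where pq: "2 \<le> p" "p \<le> card A" "2 \<le> q" "q \<le> card B" "p + q = n - length c1 - length c2"
    using split_number two by metis
  obtain as where as: "distinct (a # as @ [a'])" "set (a # as @ [a']) \<subseteq> A" "length (a # as @ [a']) = p"
    using obtain_list_with_ends[OF cl(3) ab(1-3) pq(1,2)] .
  obtain xs where xs: "distinct (x' # xs @ [x])" "set (x' # xs @ [x]) \<subseteq> B" "length (x' # xs @ [x]) = q"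
    using obtain_list_with_ends[OF cl(4) ab(5,4) ab(6)[symmetric] pq(3,4)] .
  have s: "successively b (a # as @ [a'])" "successively b (x' # xs @ [x])"
    using b_clique_successively cl as xs by blast+
  have c1: "successively b (rev (a # c1 @ [x]))" using successively_rev_sym[OF b_sym c(1)] .
  define L where "L = (a # as @ [a']) @ c2 @ (x' # xs @ [x]) @ rev c1"
  have "successively b L"
    using s c(2) c1 unfolding L_def
    by (cases c2; cases "rev c1") (auto simp: successively_append_iff successively_Cons hd_append split: if_splits)
  moreover have "b (last L) (hd L)"
    using c(1) b_commute unfolding L_def by (cases c1) (auto simp: last_rev)
  moreover have "distinct L"
    using as xs c(3,4) cl(5) unfolding L_def by auto
  moreover have "L \<noteq> []" by (simp add: L_def)
  ultimately have "cyc b L" by (simp add: cyc_def)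
  moreover have "length L = n" using as(3) xs(3) pq(5) n(1) by (simp add: L_def)
  moreover have "set L \<subseteq> H" using as(2) xs(2) H by (auto simp: L_def)
  ultimately show ?thesis by (blast intro: has_cycleI)
qed

lemma join_path_same:
  assumes "finite A" "finite B" "A \<inter> B = {}" "\<And>y z. y \<in> A \<Longrightarrow> z \<in> B \<Longrightarrow> r y z"
    "x \<in> B" "y \<in> B" "x \<noteq> y" "1 \<le> n" "n \<le> card A" "n + 1 \<le> card B"
  obtains P where "successively r P" "distinct P" "P \<noteq> []" "hd P = x" "last P = y" "set P \<subseteq> A \<union> B"
    "length P = 2 * n + 1"
proof -
  obtain zs where zs: "distinct (x # zs @ [y])" "set (x # zs @ [y]) \<subseteq> B" "length (x # zs @ [y]) = n + 1"
    using obtain_list_with_ends[OF assms(2,5,6,7), of "n + 1"] assms(8,10) by auto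
  obtain as where as: "distinct as" "set as \<subseteq> A" "length as = n" using obtain_distinct_list[OF assms(1,9)] .
  have rr: "r w a \<and> r a w" if "w \<in> B" "a \<in> A" for w a
    using assms(4)[OF that(2,1)] r_commute by blast
  have v: "viap r (x # zs @ [y]) as"
    by (rule viap_complete) (use zs as rr in auto)
  have "set (x # zs @ [y]) \<inter> set as = {}" using zs(2) as(2) assms(3) by blast
  then show ?thesis
    using viap_weave[OF v] zs as distinct_weave[of "x # zs @ [y]" as]
    by (intro that[of "weave (x # zs @ [y]) as"]) (auto simp: set_weave length_weave)
qed

lemma join_path_opposite:
  assumes "finite A" "finite B" "A \<inter> B = {}" "\<And>y z. y \<in> A \<Longrightarrow> z \<in> B \<Longrightarrow> r y z"
    "x \<in> A" "y \<in> B" "2 \<le> n" "n \<le> card A" "n \<le> card B"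
  obtains P where "successively r P" "distinct P" "P \<noteq> []" "hd P = x" "last P = y" "set P \<subseteq> A \<union> B"
    "length P = 2 * n"
proof -
  have "\<not> card B \<le> Suc 0" using assms by simp
  then obtain z where z: "z \<in> B" "z \<noteq> y" using assms(2,6) card_le_Suc0_iff_eq by metis
  have "n - 1 \<le> card (A - {x})" using assms by simp
  moreover have "(A - {x}) \<inter> B = {}" "1 \<le> n - 1" "n - 1 + 1 \<le> card B" using assms by auto
  ultimately obtain P where P: "successively r P" "distinct P" "P \<noteq> []" "hd P = z" "last P = y"
    "set P \<subseteq> (A - {x}) \<union> B" "length P = 2 * (n - 1) + 1"
    using join_path_same[of "A - {x}" B z y "n - 1"] assms z by (metis DiffD1 finite_Diff)
  have "r x z" using assms z by blast
  then have "successively r (x # P)" "distinct (x # P)" "set (x # P) \<subseteq> A \<union> B" "length (x # P) = 2 * n"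
    using P assms by (auto simp: successively_Cons)
  then show ?thesis using P by (intro that[of "x # P"]) auto
qed

text \<open>A path with \<open>2k\<close> vertices from \<open>a\<close> to \<open>x\<close>
  alternates between the two cliques, and \<open>u\<close> closes it to an odd red cycle.\<close>

lemma joined_no_common_red:
  assumes j: "joined H A B" "finite H" and k: "2 \<le> k" "k \<le> card A" "k \<le> card B"
    and nr: "\<not> has_cycle r H (2 * k + 1)"
    and u: "u \<in> H" "u \<notin> A \<union> B" "r u a" "a \<in> A" "r u x" "x \<in> B"
  shows False
proof -
  have fin: "finite A" "finite B" using j by (auto simp: joined_def intro: finite_subset)
  have jj: "A \<inter> B = {}" "\<And>y z. y \<in> A \<Longrightarrow> z \<in> B \<Longrightarrow> r y z" "A \<union> B \<subseteq> H" using j(1) by (auto simp: joined_def)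
  obtain P where P: "successively r P" "distinct P" "P \<noteq> []" "hd P = a" "last P = x" "set P \<subseteq> A \<union> B" "length P = 2 * k"
    using join_path_opposite[OF fin jj(1,2) u(4,6) k] by blast
  have "cyc r (u # P)" using P u r_commute by (auto simp: cyc_def successively_Cons)
  moreover have "set (u # P) \<subseteq> H" using P(6) jj(3) u(1) by auto
  moreover have "length (u # P) = 2 * k + 1" using P(7) by simp
  ultimately show False using nr has_cycleI by metis
qed

text \<open>Otherwise a path with \<open>2k - 1\<close> vertices from \<open>x\<close> to
  \<open>x'\<close> alternates between the cliques, and the edge \<open>u u'\<close> closes it to an
  odd red cycle.\<close>

lemma joined_red_pair:
  assumes j: "joined H A B" "finite H" and k: "2 \<le> k" "k \<le> card A" "k \<le> card B"
    and nr: "\<not> has_cycle r H (2 * k + 1)"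
    and u: "u \<in> H" "u \<notin> A \<union> B" "u' \<in> H" "u' \<notin> A \<union> B" "r u u'" "r u x" "r u' x'" "x \<in> B" "x' \<in> B"
  shows "x = x'"
proof (rule ccontr)
  assume ne: "x \<noteq> x'"
  have fin: "finite A" "finite B" using j by (auto simp: joined_def intro: finite_subset)
  have jj: "A \<inter> B = {}" "\<And>y z. y \<in> A \<Longrightarrow> z \<in> B \<Longrightarrow> r y z" "A \<union> B \<subseteq> H" using j(1) by (auto simp: joined_def)
  have "1 \<le> k - 1" "k - 1 \<le> card A" "k - 1 + 1 \<le> card B" using k by auto
  then obtain P where P: "successively r P" "distinct P" "P \<noteq> []" "hd P = x" "last P = x'" "set P \<subseteq> A \<union> B"
    "length P = 2 * (k - 1) + 1"
    using join_path_same[OF fin jj(1,2) u(8,9) ne, of "k - 1"] by blast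
  have "u \<noteq> u'" using u(5) r_irrefl by auto
  then have "cyc r (u' # u # P)" using P u r_commute by (auto simp: cyc_def successively_Cons)
  moreover have "set (u' # u # P) \<subseteq> H" using P(6) jj(3) u by auto
  moreover have "length (u' # u # P) = 2 * k + 1" using P(7) k by simp
  ultimately show False using nr has_cycleI by metis
qed

lemma two_connectors:
  assumes j: "joined H A B" "finite H"
    and nb: "\<not> has_cycle b H n" "6 \<le> n" "n \<le> card A + card B + 2"
    and u: "u \<in> H" "u \<notin> A \<union> B" "u' \<in> H" "u' \<notin> A \<union> B" "u \<noteq> u'"
    and e: "b u a" "b u' a'" "a \<in> A" "a' \<in> A" "a \<noteq> a'" "b u x" "b u' x'" "x \<in> B" "x' \<in> B" "x \<noteq> x'"
  shows False
proof -
  have fin: "finite A" "finite B" using j by (auto simp: joined_def intro: finite_subset)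
  have jj: "A \<inter> B = {}" "b_clique A" "b_clique B" "A \<union> B \<subseteq> H" using j(1) by (auto simp: joined_def)
  have "has_cycle b H n"
    by (rule two_cliques_cycle[of A B a a' x x' "[u]" "[u']"]) (use fin jj nb u e b_commute in auto)
  then show False using nb by blast
qed

text \<open>By \<open>clique_arc_cycle\<close> there are no two disjoint blue edges between
  \<open>W\<close> and the cycle, so the blue edges form a star. Without its centre everything
  between the two sets is red, and then a red edge among the cycle vertices would lie on a red cycle
  of length \<open>2k + 1\<close>.\<close>

lemma core_from_clique:
  assumes C: "cyc b C" "length C = 2 * l" "set C \<subseteq> H" and H: "finite H"
    and W: "W \<subseteq> H - set C" "l + 1 \<le> card W" "b_clique W"
    and k: "2 \<le> k" "k \<le> l"
    and nb: "\<not> has_cycle b H (2 * l + 2)" and nr: "\<not> has_cycle r H (2 * k + 1)"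
  shows "\<exists>A B. joined H A B \<and> k \<le> card A \<and> k \<le> card B \<and> 2 * l + 2 \<le> card A + card B"
proof -
  have fin: "finite W" "finite (set C)" using W(1) H finite_subset by auto
  have dC: "card (set C) = 2 * l" using C(1,2) distinct_card by (fastforce simp: cyc_def)
  have "set C \<noteq> {}" "W \<noteq> {}" using C(1) W(2) by (auto simp: cyc_def)
  have disj: "W \<inter> set C = {}" using W(1) by blast
  have disjoint_edges: "s = s' \<or> t = t'"
    if "s \<in> W" "s' \<in> W" "t \<in> set C" "t' \<in> set C" "b s t" "b s' t'" for s s' t t'
    using clique_arc_cycle[OF C(1,2) W(3) fin(1) W(2) disj that(1,2) _ that(3,4) _ that(5,6) C(3)] nb W(1) by blast
  have build: ?thesis if AB: "A \<subseteq> W" "B \<subseteq> set C" "\<And>a x. a \<in> A \<Longrightarrow> x \<in> B \<Longrightarrow> \<not> b a x"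
    "k \<le> card A" "k + 1 \<le> card B" "2 * l + 2 \<le> card A + card B" for A B
  proof -
    have red: "r a x" if ax: "a \<in> A" "x \<in> B" for a x
    proof -
      have "a \<noteq> x" using ax AB(1,2) disj by blast
      then show ?thesis using AB(3)[OF ax] total by blast
    qed
    have "finite A" "finite B" using finite_subset[OF AB(1) fin(1)] finite_subset[OF AB(2) fin(2)] by auto
    have "A \<union> B \<subseteq> H" "A \<inter> B = {}" using AB(1,2) disj W(1) C(3) by blast+
    have "b_clique B"
      unfolding b_clique_def
    proof (intro ballI impI, rule ccontr)
      fix x y assume "x \<in> B" "y \<in> B" "x \<noteq> y" "\<not> b x y"
      then have "r x y" using total by blast
      then have "has_cycle r (A \<union> B) (2 * k + 1)"
        using odd_cycle_in_join[of A B k x y] \<open>finite A\<close> \<open>finite B\<close> \<open>A \<inter> B = {}\<close> red AB(4,5) \<open>x \<in> B\<close> \<open>y \<in> B\<close> k by simp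
      then show False using nr has_cycle_mono \<open>A \<union> B \<subseteq> H\<close> by metis
    qed
    moreover have "b_clique A" using W(3) AB(1) b_clique_mono by blast
    ultimately have "joined H A B" using \<open>A \<union> B \<subseteq> H\<close> \<open>A \<inter> B = {}\<close> red by (auto simp: joined_def)
    then show ?thesis using AB by (metis add_leD1)
  qed
  have "(\<exists>t0\<in>set C. \<forall>s\<in>W. \<forall>t\<in>set C. b s t \<longrightarrow> t = t0) \<or> (\<exists>s0\<in>W. \<forall>s\<in>W. \<forall>t\<in>set C. b s t \<longrightarrow> s = s0)"
    by (rule star_cover[OF \<open>W \<noteq> {}\<close> \<open>set C \<noteq> {}\<close>]) (rule disjoint_edges)
  then consider t0 where "t0 \<in> set C" "\<forall>s\<in>W. \<forall>t\<in>set C. b s t \<longrightarrow> t = t0"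
    | s0 where "s0 \<in> W" "\<forall>s\<in>W. \<forall>t\<in>set C. b s t \<longrightarrow> s = s0"
    by blast
  then show ?thesis
  proof cases
    case 1
    show ?thesis by (rule build[of W "set C - {t0}"]) (use 1 dC k W(2) fin in auto)
  next
    case 2
    show ?thesis by (rule build[of "W - {s0}" "set C"]) (use 2 dC k W(2) fin in auto)
  qed
qed

text \<open>An outside vertex with a red neighbour in one clique has none in the other and can be
  added to the latter. Two vertices without red neighbours in either clique would connect the
  cliques twice in blue, so at most one of them is left over. The single lost vertex is either that
  one, in which case a blue edge between the enlarged cliques would be a second connection, or the
  centre of the star of blue edges between them.\<close>

lemma core_absorbs:
  assumes j: "joined H A B" "finite H" and k: "2 \<le> k" "k \<le> card A" "k \<le> card B" "3 \<le> card A" "3 \<le> card B"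
    and nr: "\<not> has_cycle r H (2 * k + 1)"
    and nb: "\<not> has_cycle b H n" "6 \<le> n" "n \<le> card A + card B"
  shows "\<exists>P Q. joined H P Q \<and> card H \<le> card P + card Q + 1"
proof -
  have fin: "finite A" "finite B" using j by (auto simp: joined_def intro: finite_subset)
  have jj: "A \<inter> B = {}" "b_clique A" "b_clique B" "A \<union> B \<subseteq> H" using j(1) by (auto simp: joined_def)
  define att where "att S = {u \<in> H - (A \<union> B). \<exists>x\<in>S. r u x}" for S
  have two: "\<exists>a\<in>S - {z}. \<exists>a'\<in>S - {z}. a \<noteq> a'" if "3 \<le> card S" "finite S" for S and z :: 'a
  proof -
    have "\<not> card (S - {z}) \<le> Suc 0" using that by (auto simp: card_Diff_singleton_if)
    then show ?thesis using card_le_Suc0_iff_eq[of "S - {z}"] that by blast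
  qed
  have blue: "b u x" if "u \<in> H - (A \<union> B)" "u \<notin> att S" "x \<in> S" "S = A \<or> S = B" for u x S
  proof -
    have "u \<noteq> x" using that by auto
    moreover have "\<not> r u x" using that by (auto simp: att_def)
    ultimately show ?thesis using total by blast
  qed
  have disj: "att A \<inter> att B = {}"
    using joined_no_common_red[OF j k(1-3) nr] by (auto simp: att_def)
  have attach: "b_clique (S \<union> att T)"
    if ST: "joined H S T" "S = A \<and> T = B \<or> S = B \<and> T = A" for S T
  proof -
    have S: "b_clique S" "finite S" "finite T" "3 \<le> card S" "3 \<le> card T" "k \<le> card S" "k \<le> card T" "att S \<inter> att T = {}"
      "A \<union> B = S \<union> T" "card A + card B = card S + card T"
      using ST jj fin k disj by auto
    have 1: "b u x" if "u \<in> att T" "x \<in> S" for u x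
      using blue[of u S x] that ST(2) S(8) by (auto simp: att_def)
    have 2: "b u u'" if u: "u \<in> att T" "u' \<in> att T" "u \<noteq> u'" for u u'
    proof (rule ccontr)
      assume "\<not> b u u'"
      then have red: "r u u'" using u total by blast
      have out: "u \<in> H" "u \<notin> S \<union> T" "u' \<in> H" "u' \<notin> S \<union> T" using u S(9) by (auto simp: att_def)
      have uniq: "x = x'" if "x \<in> T" "r u x" "x' \<in> T" "r u' x'" for x x'
        using joined_red_pair[OF ST(1) j(2) k(1) S(6,7) nr out red that(2,4,1,3)] .
      obtain x0 where x0: "x0 \<in> T" "r u x0" using u(1) by (auto simp: att_def)
      obtain x1 where x1: "x1 \<in> T" "r u' x1" using u(2) by (auto simp: att_def)
      \<comment> \<open>A red edge \<open>u u'\<close> forces all red neighbours of both in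
        \<open>T\<close> to be one vertex \<open>x0\<close>. Then \<open>u\<close> and
        \<open>u'\<close> connect \<open>S\<close> twice in blue to the remaining vertices of
        \<open>T\<close>.\<close>
      have only: "x = x0" if "x \<in> T" "r u x \<or> r u' x" for x
        using that(2) uniq[OF that(1) _ x1] uniq[OF x0 that(1)] uniq[OF x0 x1] by blast
      obtain y y' where y: "y \<in> T - {x0}" "y' \<in> T - {x0}" "y \<noteq> y'" using two[OF S(5,3)] by blast
      obtain a a' where a: "a \<in> S" "a' \<in> S" "a \<noteq> a'" using two[OF S(4,2)] by blast
      have "\<not> r u y" "\<not> r u' y'" using only[of y] only[of y'] y by blast+
      moreover have "u \<noteq> y" "u' \<noteq> y'" using y out by blast+
      ultimately have buy: "b u y" "b u' y'" using total by blast+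
      show False
        by (rule two_connectors[OF ST(1) j(2) nb(1,2) _ out u(3) 1[OF u(1) a(1)] 1[OF u(2) a(2)] a buy])
          (use nb(3) S(10) y in auto)
    qed
    show ?thesis
      unfolding b_clique_def
    proof (intro ballI impI)
      fix x y assume xy: "x \<in> S \<union> att T" "y \<in> S \<union> att T" "x \<noteq> y"
      show "b x y" using xy S(1) 1 2 b_symD by (auto simp: b_clique_def)
    qed
  qed
  define P where "P = A \<union> att B"
  define Q where "Q = B \<union> att A"
  define N where "N = H - (P \<union> Q)"
  have PQ: "b_clique P" "b_clique Q" "P \<inter> Q = {}" "P \<subseteq> H" "Q \<subseteq> H" "A \<subseteq> P" "B \<subseteq> Q"
  proof -
    show "b_clique P" unfolding P_def by (rule attach[OF j(1)]) simp
    show "b_clique Q" unfolding Q_def by (rule attach) (use j(1) joined_commute in auto)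
    have sub: "att S \<subseteq> H - (A \<union> B)" for S by (auto simp: att_def)
    then show "P \<inter> Q = {}" using sub[of A] sub[of B] disj jj(1) unfolding P_def Q_def by blast
    show "P \<subseteq> H" "Q \<subseteq> H" "A \<subseteq> P" "B \<subseteq> Q" using sub[of A] sub[of B] jj(4) unfolding P_def Q_def by blast+
  qed
  have finPQ: "finite P" "finite Q" using finite_subset[OF PQ(4) j(2)] finite_subset[OF PQ(5) j(2)] by auto
  have cPQ: "card A \<le> card P" "card B \<le> card Q" using card_mono[OF finPQ(1) PQ(6)] card_mono[OF finPQ(2) PQ(7)] .
  have N_out: "u \<in> H" "u \<notin> A \<union> B" "u \<notin> att A" "u \<notin> att B" "u \<notin> P" "u \<notin> Q" if "u \<in> N" for u
    using that by (auto simp: N_def P_def Q_def)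
  have N_blue: "b u x" if "u \<in> N" "x \<in> A \<union> B" for u x
    using N_out[OF that(1)] blue[of u A x] blue[of u B x] that(2) by blast
  have N1: "u = u'" if "u \<in> N" "u' \<in> N" for u u'
  proof (rule ccontr)
    assume ne: "u \<noteq> u'"
    obtain a a' where a: "a \<in> A" "a' \<in> A" "a \<noteq> a'" using two[OF k(4) fin(1)] by blast
    obtain y y' where y: "y \<in> B" "y' \<in> B" "y \<noteq> y'" using two[OF k(5) fin(2)] by blast
    show False
      by (rule two_connectors[OF j nb(1,2) _ N_out(1,2)[OF that(1)] N_out(1,2)[OF that(2)] ne _ _ a _ _ y])
        (use nb(3) N_blue that a y in auto)
  qed
  have "finite N" using j(2) by (simp add: N_def)
  then have cN: "card N \<le> 1" using N1 by (simp add: card_le_Suc0_iff_eq)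
  have cH: "card H = card P + card Q + card N"
  proof -
    have "H = (P \<union> Q) \<union> N" using PQ by (auto simp: N_def)
    moreover have "(P \<union> Q) \<inter> N = {}" by (auto simp: N_def)
    ultimately have "card H = card (P \<union> Q) + card N" using finPQ \<open>finite N\<close> by (metis card_Un_disjoint finite_UnI)
    then show ?thesis using PQ(3) finPQ by (simp add: card_Un_disjoint)
  qed
  have red: "r s t" if "s \<in> P" "t \<in> Q" "\<not> b s t" for s t
  proof -
    have "s \<noteq> t" using that(1,2) PQ(3) by blast
    then show ?thesis using that(3) total by blast
  qed
  show ?thesis
  proof (cases "N = {}")
    case True
    have disjoint_edges: "s = s' \<or> t = t'"
      if e: "s \<in> P" "s' \<in> P" "t \<in> Q" "t' \<in> Q" "b s t" "b s' t'" for s s' t t'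
    proof (rule ccontr)
      assume "\<not> (s = s' \<or> t = t')"
      then have "has_cycle b H n"
        by (intro two_cliques_cycle[of P Q s s' t t' "[]" "[]"]) (use PQ finPQ e nb cPQ in auto)
      then show False using nb by blast
    qed
    have "P \<noteq> {}" "Q \<noteq> {}" using PQ(6,7) k by auto
    then have "(\<exists>t0\<in>Q. \<forall>s\<in>P. \<forall>t\<in>Q. b s t \<longrightarrow> t = t0) \<or> (\<exists>s0\<in>P. \<forall>s\<in>P. \<forall>t\<in>Q. b s t \<longrightarrow> s = s0)"
      by (rule star_cover) (rule disjoint_edges)
    then consider t0 where "t0 \<in> Q" "\<forall>s\<in>P. \<forall>t\<in>Q. b s t \<longrightarrow> t = t0"
      | s0 where "s0 \<in> P" "\<forall>s\<in>P. \<forall>t\<in>Q. b s t \<longrightarrow> s = s0"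
      by blast
    then show ?thesis
    proof cases
      case 1
      have "r s t" if "s \<in> P" "t \<in> Q - {t0}" for s t using 1 that red by blast
      then have "joined H P (Q - {t0})"
        using PQ b_clique_mono[OF PQ(2), of "Q - {t0}"] by (auto simp: joined_def)
      moreover have "card (Q - {t0}) + 1 = card Q" using 1 finPQ by (metis card.remove Suc_eq_plus1)
      ultimately show ?thesis using cH True by (intro exI[of _ P] exI[of _ "Q - {t0}"]) auto
    next
      case 2
      have "r s t" if "s \<in> P - {s0}" "t \<in> Q" for s t using 2 that red by blast
      then have "joined H (P - {s0}) Q"
        using PQ b_clique_mono[OF PQ(1), of "P - {s0}"] by (auto simp: joined_def)
      moreover have "card (P - {s0}) + 1 = card P" using 2 finPQ by (metis card.remove Suc_eq_plus1)
      ultimately show ?thesis using cH True by (intro exI[of _ "P - {s0}"] exI[of _ Q]) auto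
    qed
  next
    case False
    then obtain u where u: "u \<in> N" by blast
    have "\<not> b s t" if st: "s \<in> P" "t \<in> Q" for s t
    proof
      assume bst: "b s t"
      obtain a where a: "a \<in> A" "a \<noteq> s" using two[OF k(4) fin(1), of s] by blast
      obtain x where x: "x \<in> B" "x \<noteq> t" using two[OF k(5) fin(2), of t] by blast
      have "has_cycle b H n"
        by (rule two_cliques_cycle[of P Q s a t x "[]" "[u]"])
          (use PQ finPQ st a x bst u N_blue[OF u] b_symD[OF N_blue[OF u]] N_out[OF u] nb cPQ in auto)
      then show False using nb by blast
    qed
    then have "r s t" if "s \<in> P" "t \<in> Q" for s t using that red by blast
    then have "joined H P Q" using PQ by (simp add: joined_def)
    then show ?thesis using cH cN by (intro exI[of _ P] exI[of _ Q]) auto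
  qed
qed

end

section \<open>Long monochromatic cycles\<close>

lemma mono_triangle:
  fixes r b :: "'a \<Rightarrow> 'a \<Rightarrow> bool"
  assumes "two_coloring r b" "finite H" "6 \<le> card H"
  shows "has_cycle r H 3 \<or> has_cycle b H 3"
proof -
  interpret two_coloring r b by fact
  obtain v where v: "v \<in> H" using assms(3) by fastforce
  have main: "has_cycle r' H 3 \<or> has_cycle b' H 3"
    if "two_coloring r' b'" "S \<subseteq> H - {v}" "card S = 3" "\<And>x. x \<in> S \<Longrightarrow> r' v x" for r' b' S
  proof -
    interpret c: two_coloring r' b' by fact
    obtain x y z where S: "S = {x, y, z}" "x \<noteq> y" "x \<noteq> z" "y \<noteq> z" using \<open>card S = 3\<close> by (auto simp: card_3_iff)
    have tri: "has_cycle r' H 3" if "r' p q" "p \<in> S" "q \<in> S" "p \<noteq> q" for p q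
    proof -
      have "p \<in> H" "q \<in> H" "p \<noteq> v" "q \<noteq> v" using that \<open>S \<subseteq> H - {v}\<close> by auto
      moreover have "r' v p" "r' q v" using that \<open>\<And>x. x \<in> S \<Longrightarrow> r' v x\<close> c.r_symD by auto
      ultimately have "cyc r' [v, p, q]" "set [v, p, q] \<subseteq> H"
        using that v by (auto simp: cyc_def)
      then show ?thesis by (auto intro!: has_cycleI[of r' "[v, p, q]"])
    qed
    show ?thesis
    proof (cases "b' x y \<and> b' y z \<and> b' z x")
      case True
      then have "cyc b' [x, y, z]" "set [x, y, z] \<subseteq> H" using S \<open>S \<subseteq> H - {v}\<close> by (auto simp: cyc_def)
      then show ?thesis by (auto intro!: has_cycleI[of b' "[x, y, z]"])
    next
      case False
      then have "r' x y \<or> r' y z \<or> r' z x" using S c.total by metis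
      then show ?thesis using tri S by auto
    qed
  qed
  let ?R = "{x \<in> H - {v}. r v x}" and ?B = "{x \<in> H - {v}. b v x}"
  have "x \<in> ?R \<union> ?B" if "x \<in> H - {v}" for x using total[of v x] that by auto
  then have "H - {v} \<subseteq> ?R \<union> ?B" by blast
  then have "card (H - {v}) \<le> card (?R \<union> ?B)" using assms(2) by (intro card_mono) auto
  then have "card (H - {v}) \<le> card ?R + card ?B" using card_Un_le le_trans by blast
  moreover have "5 \<le> card (H - {v})" using assms v by simp
  ultimately consider "3 \<le> card ?R" | "3 \<le> card ?B" by linarith
  then show ?thesis
  proof cases
    case 1
    then obtain S where "S \<subseteq> ?R" "card S = 3" using obtain_subset_with_card_n by metis
    then show ?thesis by (intro main[of r b S]) (use assms in auto)
  next
    case 2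
    then obtain S where "S \<subseteq> ?B" "card S = 3" using obtain_subset_with_card_n by metis
    then show ?thesis using main[of b r S] swap by auto
  qed
qed

lemma meetsI: "(\<And>u v. (u, v) \<in> set bs \<Longrightarrow> P u \<or> P v) \<Longrightarrow> meets bs P"
  by (auto simp: meets_def)

text \<open>One vertex satisfying \<open>P\<close> is cut out; the rest falls into \<open>l\<close>
  disjoint blocks, each of which contributes a further one.\<close>

lemma cover_odd_cycle:
  assumes "distinct C" "length C = 2 * l + 1" "1 \<le> l" "\<And>u v. consec C u v \<Longrightarrow> P u \<or> P v"
  shows "l + 1 \<le> card {d \<in> set C. P d}"
proof -
  obtain c1 c2 cs where c: "C = c1 # c2 # cs" using assms(2,3) by (cases C; cases "tl C") auto
  have "consec C c1 c2" using consec_innerI[of C "[]" c1 c2 cs] c by simp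
  then obtain y where y: "y \<in> set C" "P y" using assms(4) c by auto
  obtain n rest where n: "rotate n C = y # rest" using rotate_to_hd[OF y(1)] by blast
  have len: "length rest = 2 * l" using n assms(2) by (metis length_rotate length_Cons add_right_cancel Suc_eq_plus1)
  have d: "distinct (y # rest)" using n assms(1) by (metis distinct_rotate)
  have set_C: "set C = set (y # rest)" using n by (metis set_rotate)
  have "meets (pairs rest) (\<lambda>d. d \<in> {d \<in> set rest. P d})"
  proof (rule meetsI)
    fix u v assume uv: "(u, v) \<in> set (pairs rest)"
    then obtain as bs where as: "rest = as @ u # v # bs" using in_pairs by metis
    then have "y # rest = (y # as) @ u # v # bs" by simp
    then have "consec (rotate n C) u v" using n consec_innerI by metis
    then have "P u \<or> P v" using assms(4) consec_rotate_iff by metis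
    then show "u \<in> {d \<in> set rest. P d} \<or> v \<in> {d \<in> set rest. P d}" using as by auto
  qed
  then have "length (pairs rest) \<le> card {d \<in> set rest. P d}"
    using d len by (intro card_meets_blocks) (auto simp: flat_pairs)
  then have "l \<le> card {d \<in> set rest. P d}" using len by (simp add: length_pairs)
  moreover have "{d \<in> set C. P d} = insert y {d \<in> set rest. P d}" using set_C y by auto
  ultimately show ?thesis using d by simp
qed

context two_coloring
begin

lemma joined_even_cycle:
  assumes "joined H A B" "finite H" "n \<le> card A" "n \<le> card B" "2 \<le> n"
  shows "has_cycle r H (2 * n)"
proof -
  have fin: "finite A" "finite B" using assms(1,2) by (auto simp: joined_def intro: finite_subset)
  have jj: "A \<inter> B = {}" "\<And>y z. y \<in> A \<Longrightarrow> z \<in> B \<Longrightarrow> r y z" "A \<union> B \<subseteq> H" using assms(1) by (auto simp: joined_def)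
  have "A \<noteq> {}" "B \<noteq> {}" using assms by auto
  then obtain x y where xy: "x \<in> A" "y \<in> B" by auto
  obtain P where P: "successively r P" "distinct P" "P \<noteq> []" "hd P = x" "last P = y" "set P \<subseteq> A \<union> B" "length P = 2 * n"
    using join_path_opposite[OF fin jj(1,2) xy assms(5,3,4)] by blast
  then have "cyc r P" using jj(2)[OF xy] r_symD by (auto simp: cyc_def)
  then show ?thesis using P jj(3) has_cycleI by (metis subset_trans)
qed

text \<open>Maximality excludes red cycles of length \<open>2l + 1\<close> and blue ones of length
  \<open>2l + 2\<close>, so the structural lemmas apply with \<open>l\<close> in the role of
  \<open>k\<close>. Both resulting cliques have at most \<open>2l\<close> vertices, hence both have
  at least \<open>l + 1\<close>, and a red cycle of length \<open>2l + 2\<close> alternates between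
  them.\<close>

lemma longest_cycle_even:
  assumes C: "cyc b C" "length C = 2 * l" "set C \<subseteq> H" and H: "finite H" "3 * k + 2 \<le> card H"
    and l: "2 \<le> l" "l \<le> k" and k: "3 \<le> k"
    and longest: "\<And>m. has_cycle r H m \<or> has_cycle b H m \<Longrightarrow> m \<le> 2 * l"
  shows False
proof -
  have no: "\<not> has_cycle b H (2 * l + 2)" "\<not> has_cycle r H (2 * l + 1)" "\<not> has_cycle r H (2 * (l + 1))"
    using longest[of "2 * l + 2"] longest[of "2 * l + 1"] by auto
  have clique: "card S \<le> 2 * l" if "b_clique S" "S \<subseteq> H" for S
  proof -
    have "finite S" using that H finite_subset by auto
    then show ?thesis
      using b_clique_has_cycle[OF that(1) _, of "2 * l + 1"] has_cycle_mono[OF _ that(2)] longest[of "2 * l + 1"] l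
      by fastforce
  qed
  obtain D W where D: "cyc b D" "length D = 2 * l" "set D \<subseteq> H" "W \<subseteq> H - set D" "card H \<le> 2 * l + 1 + card W" "b_clique W"
    using blue_clique_outside[OF C H(1) _ l(1) le_refl no(1,2)] H(2) l(2) by auto
  have "card W \<le> 2 * l" using clique D(4,6) by blast
  then have l3: "3 \<le> l" using D(5) H(2) k by linarith
  have "l + 1 \<le> card W" using D(5) H(2) l(2) by linarith
  then obtain A B where AB: "joined H A B" "l \<le> card A" "l \<le> card B" "2 * l + 2 \<le> card A + card B"
    using core_from_clique[OF D(1-3) H(1) D(4) _ D(6) l(1) le_refl no(1,2)] by blast
  obtain P Q where PQ: "joined H P Q" "card H \<le> card P + card Q + 1"
    using core_absorbs[OF AB(1) H(1) l(1) AB(2,3) _ _ no(2,1) _ AB(4)] l3 AB(2,3) by auto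
  have "card P \<le> 2 * l" "card Q \<le> 2 * l" using clique PQ(1) by (auto simp: joined_def)
  then have "l + 1 \<le> card P" "l + 1 \<le> card Q" using PQ(2) H(2) l(2) by linarith+
  then show False using joined_even_cycle[OF PQ(1) H(1), of "l + 1"] no(3) l(1) by simp
qed

text \<open>No outside vertex can be inserted, so each has at least \<open>l + 1\<close> red
  neighbours among the \<open>2l + 1\<close> vertices of \<open>C\<close>, and any two have a common
  one. Hence \<open>l + 1\<close> outside vertices lie on an alternating red path. Its ends are
  joined in red: otherwise they would have \<open>l + 1\<close> common red neighbours, one of them
  off the path, which closes it. One more outside vertex \<open>w\<close> then yields a longer red
  cycle, whatever its colours to the two ends.\<close>

lemma longest_cycle_odd:
  assumes C: "cyc b C" "length C = 2 * l + 1" "set C \<subseteq> H" and H: "finite H" "3 * l + 3 \<le> card H"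
    and l: "1 \<le> l"
    and longest: "\<And>m. has_cycle r H m \<or> has_cycle b H m \<Longrightarrow> m \<le> 2 * l + 1"
  shows False
proof -
  define Y where "Y = set C"
  define W where "W = H - Y"
  define sh where "sh w x = {d \<in> Y. r w d \<and> r x d}" for w x
  have dC: "distinct C" "finite Y" "card Y = 2 * l + 1" using C distinct_card by (fastforce simp: cyc_def Y_def)+
  have "card W + (2 * l + 1) = card H"
    using H C(3) dC card_mono[OF H(1), of Y] by (simp add: W_def Y_def card_Diff_subset)
  then have cW: "l + 2 \<le> card W" using H(2) by linarith
  have no: "\<not> has_cycle r H m" "\<not> has_cycle b H m" if "2 * l + 1 < m" for m
    using longest[of m] that by auto
  have ne: "w \<noteq> d" if "w \<in> W" "d \<in> Y" for w d using that by (auto simp: W_def)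
  have nins: "\<not> (b w u \<and> b w v)" if w: "w \<in> W" and uv: "consec C u v" for w u v
  proof
    assume a: "b w u \<and> b w v"
    obtain n where n: "rotate n C \<noteq> []" "hd (rotate n C) = v" "last (rotate n C) = u"
      using consec_rotation[OF uv] .
    have "cyc b (rotate n C @ [w])"
      by (rule cyc_snoc) (use C cyc_rotate n a w b_symD in \<open>auto simp: W_def Y_def\<close>)
    then have "has_cycle b H (2 * l + 2)"
      using C w by (intro has_cycleI[of b "rotate n C @ [w]"]) (auto simp: W_def)
    then show False using no(2) by simp
  qed
  have cov: "r w u \<or> r w v" if "w \<in> W" "consec C u v" for w u v
    using nins[OF that] ne[OF that(1)] consec_in_set[OF that(2)] total unfolding Y_def by metis
  have b_sh: "l + 1 \<le> card (sh w x)" if wx: "w \<in> W" "x \<in> W" "b w x" for w x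
    unfolding sh_def Y_def
  proof (rule cover_odd_cycle[OF dC(1) C(2) l])
    fix u v assume uv: "consec C u v"
    have "w \<noteq> x" using wx b_irrefl by auto
    then have "\<not> (b w u \<and> b x v)" "\<not> (b x u \<and> b w v)"
      using insert_edge[OF C(1) uv, of w x H] insert_edge[OF C(1) uv, of x w H] wx b_symD[OF wx(3)] b_symD C(2,3) no(2)[of "length C + 2"]
      by (auto simp: W_def Y_def)
    then show "r w u \<and> r x u \<or> r w v \<and> r x v"
      using cov[OF wx(1) uv] cov[OF wx(2) uv] ne[OF wx(1)] ne[OF wx(2)] consec_in_set[OF uv] total
      unfolding Y_def by metis
  qed
  have fresh: "\<exists>d\<in>sh w x. d \<notin> U" if "w \<in> W" "x \<in> W" "b w x" "finite U" "card U \<le> l" for w x U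
  proof (rule ccontr)
    assume "\<not> ?thesis"
    then have "sh w x \<subseteq> U" by blast
    from card_mono[OF that(4) this] show False using b_sh[OF that(1-3)] that(5) by linarith
  qed
  have closed: False if "viap r ws ys" "distinct ws" "distinct ys" "set ws \<subseteq> W" "set ys \<subseteq> Y" "r (last ws) (hd ws)"
    "2 * l + 1 < length ws + length ys" for ws ys
  proof -
    have "has_cycle r H (length ws + length ys)"
      by (rule viap_closed_has_cycle[OF that(1-3) _ that(6)]) (use that C(3) in \<open>auto simp: W_def Y_def\<close>)
    then show False using no(1) that(7) by blast
  qed
  have closed': False if "viac r ws ys z" "set ws \<subseteq> W" "insert z (set ys) \<subseteq> Y" "2 * l + 1 < 2 * length ws" for ws ys z
  proof -
    have "has_cycle r H (2 * length ws)"
      by (rule viac_has_cycle[OF that(1)]) (use that C(3) in \<open>auto simp: W_def Y_def\<close>)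
    then show False using no(1) that(4) by blast
  qed
  have finW: "finite W" using H by (simp add: W_def)
  obtain X where X: "X \<subseteq> W" "card X = l + 1" using obtain_subset_with_card_n[of "l + 1" W] cW by auto
  have finX: "finite X" using finite_subset[OF X(1) finW] .
  obtain w where w: "w \<in> W" "w \<notin> X"
    using cW X card_mono[OF finX, of W] by fastforce
  obtain c0 C' where C': "C = c0 # C'" using C(2) by (cases C) auto
  have lC': "length (pairs C') = l" "flat (pairs C') = C'" using C(2) C' by (simp_all add: length_pairs flat_pairs)
  have "(\<exists>ws ys. viap r ws ys \<and> set ws = X \<and> distinct ws \<and> distinct ys \<and> set ys \<subseteq> Y) \<or> splits r X Y"
  proof (rule viap_or_split[of r X "pairs C'"])
    show "symp r" using r_sym .
    show "pairs C' \<noteq> []" using lC'(1) l by auto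
    show "meets (pairs C') (r x)" if "x \<in> X" for x
    proof (rule meetsI)
      fix u v assume "(u, v) \<in> set (pairs C')"
      then obtain as bs where "C' = as @ u # v # bs" using in_pairs by metis
      then have "consec C u v" using C' by (intro consec_innerI[of C "c0 # as"]) auto
      then show "r x u \<or> r x v" using cov that X(1) by blast
    qed
  qed (use X finX dC C' lC' in \<open>auto simp: Y_def\<close>)
  moreover have "\<not> splits r X Y"
  proof
    assume "splits r X Y"
    then obtain x y where xy: "x \<in> X" "y \<in> X" "\<forall>d\<in>Y. \<not> (r x d \<and> r y d)"
      unfolding splits_def by blast
    have "l + 1 \<le> card {d \<in> Y. r z d}" if "z \<in> X" for z
      unfolding Y_def by (rule cover_odd_cycle[OF dC(1) C(2) l]) (use cov that X(1) in blast)
    from this[OF xy(1)] this[OF xy(2)]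
    have "2 * l + 2 \<le> card {d \<in> Y. r x d} + card {d \<in> Y. r y d}" by simp
    also have "\<dots> = card ({d \<in> Y. r x d} \<union> {d \<in> Y. r y d})"
      using xy(3) dC(2) by (intro card_Un_disjoint[symmetric]) auto
    also have "\<dots> \<le> card Y" using dC(2) by (intro card_mono) auto
    finally show False using dC(3) by simp
  qed
  ultimately obtain ws ys where p: "viap r ws ys" "set ws = X" "distinct ws" "distinct ys" "set ys \<subseteq> Y" by blast
  have lw: "length ws = l + 1" "length ys = l"
    using p X(2) viap_length[OF p(1)] by (metis distinct_card, metis distinct_card Suc_eq_plus1 add_right_cancel)
  obtain y1 ys' where ys: "ys = y1 # ys'" using lw(2) l by (cases ys) auto
  obtain w0 w1 ws' where ws: "ws = w0 # w1 # ws'" using lw(1) l by (cases ws; cases "tl ws") auto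
  have step: "r w0 y1" "r y1 w1" "viap r (w1 # ws') ys'" using p(1) ws ys by auto
  have inW: "w0 \<in> W" "last ws \<in> W" using p(2) X(1) ws by auto
  have neq: "w0 \<noteq> last ws" using p(3) ws by auto
  have cu: "card (set ys) \<le> l" using lw(2) card_length by metis
  have red_ends: "r w0 (last ws)"
  proof (rule ccontr)
    assume "\<not> ?thesis"
    then have "b w0 (last ws)" using total neq by blast
    then obtain d where d: "d \<in> sh w0 (last ws)" "d \<notin> set ys" using fresh[OF inW] cu by blast
    then have "viac r ws ys d" using p ws r_symD by (auto simp: viac_def sh_def)
    then show False using closed'[of ws ys d] p X(1) d lw by (auto simp: sh_def)
  qed
  have wn: "w \<noteq> w0" "w \<noteq> last ws" "w \<notin> set ws" using w p(2) inW ws by auto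
  have extend: False if v: "viap r as cs" "set as = X" "distinct as" "distinct cs" "set cs \<subseteq> Y"
    and e: "b w (hd as)" "r w (last as)" for as cs
  proof -
    have las: "length as = l + 1" "length cs = l"
      using v X(2) viap_length[OF v(1)] by (metis distinct_card, metis distinct_card Suc_eq_plus1 add_right_cancel)
    then have "as \<noteq> []" by auto
    then have h: "hd as \<in> W" using v(2) X(1) by (metis hd_in_set subsetD)
    have "card (set cs) \<le> l" using las(2) card_length by metis
    then obtain d where d: "d \<in> sh w (hd as)" "d \<notin> set cs" using fresh[OF w(1) h e(1)] by blast
    have "viap r ([w] @ as) ([] @ d # cs)"
      by (rule viap_append[OF _ v(1)]) (use d in \<open>auto simp: sh_def intro: r_symD\<close>)
    then show False
      by (rule closed) (use v d w X(1) e(2) r_symD[OF e(2)] \<open>as \<noteq> []\<close> las in \<open>auto simp: sh_def\<close>)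
  qed
  show False
  proof (cases "b w w0")
    case b0: True
    show False
    proof (cases "b w (last ws)")
      case bl: True
      obtain y where y: "y \<in> sh w w0" "y \<notin> set ys" using fresh[OF w(1) inW(1) b0, of "set ys"] cu by blast
      show False
      proof (cases "r w y1")
        case True
        \<comment> \<open>The cycle is \<open>last ws, ..., w1, y1, w, y, w0\<close>, closed by the
          red edge between the old ends.\<close>
        have "viap r [w, w0] [y]" using y by (auto simp: sh_def intro: r_symD)
        moreover have "r (last (rev (w1 # ws'))) y1" using r_symD[OF step(2)] by simp
        moreover have "r y1 (hd [w, w0])" using r_symD[OF True] by simp
        ultimately have "viap r (rev (w1 # ws') @ [w, w0]) (rev ys' @ y1 # [y])"
          using viap_append[OF viap_rev[OF r_sym step(3)]] by blast
        note v = this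
        have "hd (rev (w1 # ws') @ [w, w0]) = hd (rev (w1 # ws'))" by (rule hd_append2) simp
        also have "\<dots> = last (w1 # ws')" by (rule hd_rev)
        also have "\<dots> = last ws" using ws by simp
        finally have hd_eq: "hd (rev (w1 # ws') @ [w, w0]) = last ws" .
        have "last (rev (w1 # ws') @ [w, w0]) = w0" by simp
        then have "r (last (rev (w1 # ws') @ [w, w0])) (hd (rev (w1 # ws') @ [w, w0]))"
          using red_ends hd_eq by (simp only:)
        moreover have "set (rev (w1 # ws') @ [w, w0]) \<subseteq> W" "distinct (rev (w1 # ws') @ [w, w0])"
          using p(2,3) ws w X(1) wn by auto
        moreover have "y \<in> Y" using y by (simp add: sh_def)
        then have "set (rev ys' @ y1 # [y]) \<subseteq> Y" "distinct (rev ys' @ y1 # [y])"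
          using p(4,5) ys y(2) by auto
        moreover have "2 * l + 1 < length (rev (w1 # ws') @ [w, w0]) + length (rev ys' @ y1 # [y])"
          using lw ws ys by simp
        ultimately show False using closed[OF v] by blast
      next
        case False
        \<comment> \<open>The path is prolonged by \<open>w\<close> through \<open>y\<close> and
          closed through a common neighbour \<open>y'\<close> of \<open>w\<close> and
          \<open>last ws\<close>. As \<open>w\<close> is not red to \<open>y1\<close>, the choice of
          \<open>y'\<close> only has to avoid the \<open>l\<close> vertices of
          \<open>insert y (set ys')\<close>.\<close>
        have "card (insert y (set ys')) \<le> l" using lw(2) ys card_length[of ys'] by (simp add: card_insert_if)
        then obtain y' where y': "y' \<in> sh w (last ws)" "y' \<notin> insert y (set ys')"
          using fresh[OF w(1) inW(2) bl, of "insert y (set ys')"] by auto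
        have "y' \<noteq> y1" using y' False by (auto simp: sh_def)
        have "viac r (w # ws) (y # ys) y'"
        proof -
          have "r w y" "r y w0" "r (last ws) y'" "r y' w" using y y' by (auto simp: sh_def intro: r_symD)
          moreover have "distinct (w # ws)" using p(3) wn by simp
          moreover have "distinct (y' # y # ys)" using y y' \<open>y' \<noteq> y1\<close> p(4) ys by auto
          moreover have "viap r (w # ws) (y # ys)" using p(1) ws \<open>r w y\<close> \<open>r y w0\<close> by simp
          ultimately show ?thesis using ws by (simp add: viac_def)
        qed
        then show False by (rule closed') (use p X(1) w y y' lw in \<open>auto simp: sh_def\<close>)
      qed
    next
      case False
      then have "r w (last ws)" using total wn by blast
      then show False using extend[OF p] b0 ws by simp
    qed
  next
    case False
    then have r0: "r w w0" using total wn by blast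
    show False
    proof (cases "b w (last ws)")
      case True
      show False
      proof (rule extend[OF viap_rev[OF r_sym p(1)]])
        have "ws \<noteq> []" using ws by simp
        then have "hd (rev ws) = last ws" "last (rev ws) = hd ws" by (simp_all only: hd_rev last_rev)
        moreover have "hd ws = w0" using ws by simp
        ultimately show "b w (hd (rev ws))" "r w (last (rev ws))" using True r0 by simp_all
      qed (use p in simp_all)
    next
      case False
      then have rl: "r w (last ws)" using total wn by blast
      have "cyc r (weave ws ys)"
        using viap_weave[OF p(1)] p red_ends ws X(1) distinct_weave[OF p(3,4)]
        by (auto simp: cyc_def W_def r_symD)
      moreover have "w \<notin> set (weave ws ys)" using w wn p(5) by (auto simp: set_weave W_def)
      ultimately have "cyc r (weave ws ys @ [w])"
        by (rule cyc_snoc) (use viap_weave[OF p(1)] r0 rl ws in \<open>auto intro: r_symD\<close>)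
      moreover have "set (weave ws ys @ [w]) \<subseteq> H" using p X(1) w C(3) by (auto simp: set_weave W_def Y_def)
      moreover have "length (weave ws ys @ [w]) = 2 * l + 2" using lw by (simp add: length_weave)
      ultimately have "has_cycle r H (2 * l + 2)" by (blast intro: has_cycleI)
      then show False using no(1) by simp
    qed
  qed
qed

text \<open>The maximality of a longest monochromatic cycle is symmetric in the colours, so by
  \<open>swap\<close> the cycle may be taken to be blue, and its parity decides which of the two
  preceding lemmas applies.\<close>

lemma long_mono_cycle:
  assumes H: "finite H" "3 * k + 2 \<le> card H" and k: "3 \<le> k"
  shows "\<exists>m\<ge>2 * k + 1. has_cycle r H m \<or> has_cycle b H m"
proof (rule ccontr)
  assume neg: "\<not> ?thesis"
  define S where "S = {m. has_cycle r H m \<or> has_cycle b H m}"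
  have S3: "3 \<in> S" using mono_triangle[OF two_coloring_axioms H(1)] H(2) k by (simp add: S_def)
  have "S \<subseteq> {..card H}" using has_cycle_le_card[OF _ H(1)] by (auto simp: S_def)
  then have fS: "finite S" using finite_subset by blast
  define c where "c = Max S"
  have c: "c \<in> S" "\<And>m. m \<in> S \<Longrightarrow> m \<le> c" using S3 fS unfolding c_def by (auto intro: Max_in)
  have c3: "3 \<le> c" using c(2)[OF S3] .
  have c2k: "c \<le> 2 * k"
  proof (rule ccontr)
    assume "\<not> ?thesis"
    then have "2 * k + 1 \<le> c" by simp
    then show False using neg c(1) by (auto simp: S_def)
  qed
  have core: False if rb: "two_coloring r' b'" "has_cycle b' H c"
    and mx: "\<And>m. has_cycle r' H m \<or> has_cycle b' H m \<Longrightarrow> m \<le> c" for r' b'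
  proof -
    interpret c: two_coloring r' b' by fact
    obtain C where C: "cyc b' C" "set C \<subseteq> H" "length C = c" using rb(2) by (auto simp: has_cycle_def)
    show False
    proof (cases "even c")
      case True
      then obtain l where l: "c = 2 * l" by blast
      show False by (rule c.longest_cycle_even[of C l H k]) (use C H l c3 c2k k mx in auto)
    next
      case False
      then obtain l where l: "c = 2 * l + 1" using oddE by blast
      have "3 * l + 3 \<le> card H" using l c2k H(2) by presburger
      then show False by (intro c.longest_cycle_odd[of C l H]) (use C H l c3 mx in auto)
    qed
  qed
  show False
  proof (cases "has_cycle b H c")
    case True
    then show False using core[OF two_coloring_axioms] c(2) by (auto simp: S_def)
  next
    case False
    then have "has_cycle r H c" using c(1) by (auto simp: S_def)
    then show False using core[OF swap] c(2) by (auto simp: S_def)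
  qed
qed

end

section \<open>Chords of monochromatic cycles\<close>

text \<open>A cycle as a periodic function on all natural numbers, so that chords are written
  \<open>f i\<close>, \<open>f (i + s)\<close> and the starting point can be shifted freely.\<close>

definition cfun :: "('a \<Rightarrow> 'a \<Rightarrow> bool) \<Rightarrow> (nat \<Rightarrow> 'a) \<Rightarrow> nat \<Rightarrow> bool" where
  "cfun E f m \<longleftrightarrow> 0 < m \<and> (\<forall>i. E (f i) (f (Suc i))) \<and> (\<forall>i j. f i = f j \<longleftrightarrow> i mod m = j mod m)"

lemma has_cycle_cfun:
  assumes "has_cycle E H m"
  obtains f where "cfun E f m" "range f \<subseteq> H"
proof -
  obtain C where C: "cyc E C" "set C \<subseteq> H" "length C = m" using assms by (auto simp: has_cycle_def)
  define f where "f i = C ! (i mod m)" for i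
  have m: "0 < m" "distinct C" using C by (auto simp: cyc_def)
  have "E (f i) (f (Suc i))" for i
  proof (cases "Suc (i mod m) = m")
    case True
    then have "Suc i mod m = 0" by (simp add: mod_Suc)
    moreover have "C ! (i mod m) = last C" using True C(3) m by (metis diff_Suc_1 last_conv_nth length_greater_0_conv)
    moreover have "C ! 0 = hd C" using C(3) m by (metis hd_conv_nth length_greater_0_conv)
    ultimately show ?thesis using C(1) by (simp add: f_def cyc_def)
  next
    case False
    then have "Suc i mod m = Suc (i mod m)" "Suc (i mod m) < m" using m by (auto simp: mod_Suc Suc_lessI)
    then show ?thesis using C by (auto simp: f_def cyc_def successively_conv_nth)
  qed
  moreover have "f i = f j \<longleftrightarrow> i mod m = j mod m" for i j
    using nth_eq_iff_index_eq[OF m(2)] C(3) m(1) by (simp add: f_def)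
  moreover have "range f \<subseteq> H" using C m by (auto simp: f_def intro!: subsetD[OF C(2)] nth_mem)
  ultimately show ?thesis using that[of f] m by (auto simp: cfun_def)
qed

lemma cfun_period: "cfun E f m \<Longrightarrow> f (i + m) = f i"
  by (simp add: cfun_def)

lemma cfun_shift: "cfun E f m \<Longrightarrow> cfun E (\<lambda>i. f (i + k)) m"
  unfolding cfun_def by (auto simp: nat_mod_eq_iff)

lemma cycle_of_indices:
  assumes "cfun E f m" "range f \<subseteq> H" "idx \<noteq> []" "distinct idx" "set idx \<subseteq> {..<m}"
    "successively (\<lambda>i j. F (f i) (f j)) idx" "F (f (last idx)) (f (hd idx))"
  shows "has_cycle F H (length idx)"
proof (rule has_cycleI[of F "map f idx"])
  have "inj_on f (set idx)"
  proof (rule inj_onI)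
    fix i j assume "i \<in> set idx" "j \<in> set idx" "f i = f j"
    then show "i = j" using assms(1,5) unfolding cfun_def by (metis lessThan_iff mod_less subsetD)
  qed
  then show "cyc F (map f idx)"
    using assms by (auto simp: cyc_def successively_map distinct_map last_map hd_map)
qed (use assms in auto)

lemma successively_upt: "successively P [a..<c] \<longleftrightarrow> (\<forall>i. a \<le> i \<and> Suc i < c \<longrightarrow> P i (Suc i))"
proof -
  have "successively P [a..<c] \<longleftrightarrow> (\<forall>i. Suc i < c - a \<longrightarrow> P (a + i) (Suc (a + i)))"
    by (auto simp: successively_conv_nth)
  also have "\<dots> \<longleftrightarrow> (\<forall>i. a \<le> i \<and> Suc i < c \<longrightarrow> P i (Suc i))"
    by (metis (no_types, opaque_lifting) add.commute add_Suc_right less_diff_conv le_add_diff_inverse le_add1)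
  finally show ?thesis .
qed

lemma successively_steps:
  assumes "\<And>t. t + 1 < n \<Longrightarrow> P (2 * t + c) (2 * t + c + 2)"
  shows "successively P (map (\<lambda>t. 2 * t + c) [0..<n])"
  using assms by (auto simp: successively_map successively_upt)

lemma successively_steps_rev:
  assumes "\<And>t. t + 1 < n \<Longrightarrow> P (2 * t + c + 2) (2 * t + c)"
  shows "successively P (rev (map (\<lambda>t. 2 * t + c) [0..<n]))"
  using successively_steps[of n "\<lambda>x y. P y x" c] assms by simp

lemma no_short_chord:
  assumes f: "cfun E f m" "range f \<subseteq> H" and s: "1 \<le> s" "s < m" "\<not> has_cycle E H (m - s + 1)"
  shows "\<not> E (f i) (f (i + s))"
proof
  assume e: "E (f i) (f (i + s))"
  let ?g = "\<lambda>j. f (j + i)"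
  have g: "cfun E ?g m" "range ?g \<subseteq> H" using cfun_shift[OF f(1)] f(2) by auto
  have "has_cycle E H (length (0 # [s..<m]))"
  proof (rule cycle_of_indices[OF g])
    have "E (?g (m - 1)) (?g (Suc (m - 1)))" using g(1) unfolding cfun_def by blast
    then show "E (?g (last (0 # [s..<m]))) (?g (hd (0 # [s..<m])))"
      using s cfun_period[OF f(1), of i] by (simp add: add.commute)
    show "successively (\<lambda>ia j. E (?g ia) (?g j)) (0 # [s..<m])"
      using e s g(1) by (auto simp: successively_Cons successively_upt cfun_def add.commute)
  qed (use s in auto)
  then show False using s by simp
qed

context two_coloring
begin

text \<open>The cycle \<open>i + 1, ..., i + d, i, i - 1, ..., i + d + 2\<close> would use both
  chords and leave out the vertex \<open>i + d + 1\<close> only.\<close>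

lemma crossing_chords:
  assumes f: "cfun r f m" "range f \<subseteq> H" and d: "2 \<le> d" "d + 3 \<le> m" and no: "\<not> has_cycle r H (m - 1)"
    and e: "r (f i) (f (i + d))"
  shows "\<not> r (f (i + 1)) (f (i + d + 2))"
proof
  assume e2: "r (f (i + 1)) (f (i + d + 2))"
  let ?g = "\<lambda>j. f (j + i)"
  have g: "cfun r ?g m" "range ?g \<subseteq> H" using cfun_shift[OF f(1)] f(2) by auto
  have st: "r (?g j) (?g (Suc j))" for j using g(1) unfolding cfun_def by blast
  define idx where "idx = [1..<d + 1] @ 0 # rev [d + 2..<m]"
  have "has_cycle r H (length idx)"
  proof (rule cycle_of_indices[OF g])
    have "successively (\<lambda>x y. r (?g x) (?g y)) (rev [d + 2..<m])"
      using st r_symD by (auto simp: successively_upt)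
    moreover have "r (?g 0) (?g (m - 1))"
      using st[of "m - 1"] d cfun_period[OF f(1), of i] r_symD by (simp add: add.commute)
    moreover have "r (?g d) (?g 0)" using e r_symD by (simp add: add.commute)
    moreover have "r (f (d + i - 1)) (f (d + i))" using st[of "d - 1"] d by simp
    ultimately show "successively (\<lambda>x y. r (?g x) (?g y)) idx"
      using d st by (auto simp: idx_def successively_append_iff successively_Cons successively_upt hd_rev)
    show "r (?g (last idx)) (?g (hd idx))"
      using e2 d r_symD by (simp add: idx_def last_rev add.commute hd_append)
  qed (use d in \<open>auto simp: idx_def\<close>)
  moreover have "length idx = m - 1" using d by (simp add: idx_def)
  ultimately show False using no by simp
qed

text \<open>A red chord of length 2 would shorten the cycle by one. A longer red chord of even
  length makes chords that cross it blue, and these link the even to the odd positions. Together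
  with the chords of length 2, which run inside each parity class, they form a blue cycle of length
  \<open>2l - 2\<close> if the red chord has length 4, and of length \<open>2l\<close>
  otherwise.\<close>

lemma even_cycle_cliques:
  assumes f: "cfun r f (2 * l)" "range f \<subseteq> H" and l: "4 \<le> l"
    and nr: "\<not> has_cycle r H (2 * l - 1)" and nb: "\<not> has_cycle b H (2 * l - 2)" "\<not> has_cycle b H (2 * l)"
    and ne: "f i \<noteq> f (i + 2 * s)"
  shows "b (f i) (f (i + 2 * s))"
proof -
  have eq: "f i = f j \<longleftrightarrow> i mod (2 * l) = j mod (2 * l)" for i j using f(1) unfolding cfun_def by blast
  have per: "f (i + 2 * l) = f i" for i by (simp add: eq)
  have nr': "b (f i) (f j)" if "\<not> r (f i) (f j)" "i mod (2 * l) \<noteq> j mod (2 * l)" for i j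
    using that total eq by blast
  have cross: "\<not> r (f (i + 1)) (f (i + d + 2))" if "r (f i) (f (i + d))" "2 \<le> d" "d + 3 \<le> 2 * l" for i d
    using crossing_chords[OF f that(2,3) nr that(1)] .
  have mod_ne: "i mod (2 * l) \<noteq> (i + d) mod (2 * l)" if "0 < d" "d < 2 * l" for i d
    using that by (metis add.right_neutral add_left_cancel mod_less nat_mod_eq_iff not_gr_zero mod_0 mod_add_left_eq mod_add_cong nat_neq_iff mod_add_right_eq zero_less_diff diff_is_0_eq mod_eq_dvd_iff_nat le_add1 add_diff_cancel_left' dvd_imp_le not_less)
  have d2: "b (f i) (f (i + 2))" for i
  proof -
    have h: "2 * l - 2 + 1 = 2 * l - 1" using l by simp
    have "\<not> has_cycle r H (2 * l - 2 + 1)" using nr unfolding h .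
    then show ?thesis using no_short_chord[OF f, of 2 i] l mod_ne[of 2 i] by (intro nr') auto
  qed
  have d4: "b (f i) (f (i + 4))" for i
  proof (rule ccontr)
    assume "\<not> b (f i) (f (i + 4))"
    then have red: "r (f i) (f (i + 4))" using nr' mod_ne[of 4 i] l by auto
    let ?g = "\<lambda>j. f (j + i)"
    have g: "cfun r ?g (2 * l)" "range ?g \<subseteq> H" using cfun_shift[OF f(1)] f(2) by auto
    have "\<not> r (f (i + 3)) (f (i + 3 + (2 * l - 5)))"
    proof
      assume "r (f (i + 3)) (f (i + 3 + (2 * l - 5)))"
      then have c: "\<not> r (f (i + 3 + 1)) (f (i + 3 + (2 * l - 5) + 2))" using l by (intro cross) auto
      have h: "i + 3 + 1 = i + 4" "i + 3 + (2 * l - 5) + 2 = i + 2 * l" using l by simp_all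
      show False using c unfolding h per using r_symD[OF red] by contradiction
    qed
    then have c1: "b (f (i + 3)) (f (i + (2 * l - 2)))"
      using nr'[of "i + 3" "i + 3 + (2 * l - 5)"] mod_ne[of "2 * l - 5" "i + 3"] l by (simp add: add.assoc)
    have "\<not> r (f (i + (2 * l - 1))) (f (i + (2 * l - 1) + 3))"
    proof
      assume "r (f (i + (2 * l - 1))) (f (i + (2 * l - 1) + 3))"
      then have c: "\<not> r (f (i + (2 * l - 1) + 1)) (f (i + (2 * l - 1) + 3 + 2))" using l by (intro cross) auto
      have h: "i + (2 * l - 1) + 1 = i + 2 * l" "i + (2 * l - 1) + 3 + 2 = (i + 4) + 2 * l" using l by simp_all
      show False using c unfolding h per using red by contradiction
    qed
    then have bl: "b (f (i + (2 * l - 1))) (f (i + (2 * l - 1) + 3))"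
      using nr'[of "i + (2 * l - 1)" "i + (2 * l - 1) + 3"] mod_ne[of 3 "i + (2 * l - 1)"] l by simp
    have h: "i + (2 * l - 1) + 3 = (i + 2) + 2 * l" using l by simp
    have c2: "b (f (i + (2 * l - 1))) (f (i + 2))" using bl unfolding h per .
    \<comment> \<open>The cycle visits all even positions except 0 and then all odd positions except
      1; the two blue links just found are its transitions.\<close>
    define B1 where "B1 = map (\<lambda>t. 2 * t + 2) [0..<l - 1]"
    define B2 where "B2 = map (\<lambda>t. 2 * t + 3) [0..<l - 1]"
    define idx where "idx = B1 @ B2"
    have "has_cycle b H (length idx)"
    proof (rule cycle_of_indices[OF g])
      have "distinct B1" "distinct B2" by (auto simp: B1_def B2_def distinct_map inj_on_def)
      moreover have "x \<in> set B1 \<Longrightarrow> even x \<and> x < 2 * l" "x \<in> set B2 \<Longrightarrow> odd x \<and> x < 2 * l" for x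
        using l by (auto simp: B1_def B2_def)
      ultimately show "distinct idx" "set idx \<subseteq> {..<2 * l}" by (fastforce simp: idx_def)+
      have n: "B1 \<noteq> []" "B2 \<noteq> []" "hd B1 = 2" "last B1 = 2 * l - 2" "hd B2 = 3" "last B2 = 2 * l - 1"
        using l by (auto simp: B1_def B2_def last_map hd_map)
      then show "idx \<noteq> []" by (simp add: idx_def)
      have st: "b (f (x + i)) (f (x + 2 + i))" for x using d2[of "x + i"] by (simp add: add.commute add.left_commute)
      have "successively (\<lambda>x y. b (?g x) (?g y)) B1" unfolding B1_def by (rule successively_steps) (rule st)
      moreover have "successively (\<lambda>x y. b (?g x) (?g y)) B2" unfolding B2_def by (rule successively_steps) (rule st)
      moreover have "b (f (2 * l - 2 + i)) (f (3 + i))" using b_symD[OF c1] by (simp add: add.commute)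
      ultimately show "successively (\<lambda>x y. b (?g x) (?g y)) idx"
        using n by (simp add: idx_def successively_append_iff)
      show "b (?g (last idx)) (?g (hd idx))"
        using n c2 by (simp add: idx_def add.commute)
    qed
    moreover have "length idx = 2 * l - 2" by (simp add: idx_def B1_def B2_def)
    ultimately show False using nb(1) by simp
  qed
  have dr: "b (f i) (f (i + 2 * s))" if s: "3 \<le> s" "s + 3 \<le> l" for i s
  proof (rule ccontr)
    assume "\<not> b (f i) (f (i + 2 * s))"
    then have red: "r (f i) (f (i + 2 * s))" using nr' mod_ne[of "2 * s" i] s by auto
    let ?g = "\<lambda>j. f (j + i)"
    have g: "cfun r ?g (2 * l)" "range ?g \<subseteq> H" using cfun_shift[OF f(1)] f(2) by auto
    have "\<not> r (f (i + 1)) (f (i + 2 * s + 2))" using cross[OF red] s by auto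
    then have c1: "b (f (i + 1)) (f (i + 2 * s + 2))"
      using nr'[of "i + 1" "i + 2 * s + 2"] mod_ne[of "2 * s + 1" "i + 1"] s by (simp add: add.assoc)
    have "\<not> r (f (i + (2 * l - 1))) (f (i + (2 * l - 1) + (2 * s - 1)))"
    proof
      assume "r (f (i + (2 * l - 1))) (f (i + (2 * l - 1) + (2 * s - 1)))"
      then have c: "\<not> r (f (i + (2 * l - 1) + 1)) (f (i + (2 * l - 1) + (2 * s - 1) + 2))" using s by (intro cross) auto
      have h: "i + (2 * l - 1) + 1 = i + 2 * l" "i + (2 * l - 1) + (2 * s - 1) + 2 = (i + 2 * s) + 2 * l" using s by simp_all
      show False using c unfolding h per using red by contradiction
    qed
    then have bl: "b (f (i + (2 * l - 1))) (f (i + (2 * l - 1) + (2 * s - 1)))"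
      using nr'[of "i + (2 * l - 1)" "i + (2 * l - 1) + (2 * s - 1)"] mod_ne[of "2 * s - 1" "i + (2 * l - 1)"] s by simp
    have h: "i + (2 * l - 1) + (2 * s - 1) = (i + (2 * s - 2)) + 2 * l" using s by simp
    have c2: "b (f (i + (2 * l - 1))) (f (i + (2 * s - 2)))" using bl unfolding h per .
    \<comment> \<open>The cycle runs through the even positions from \<open>2s + 2\<close> round to
      \<open>2s - 2\<close>, picking up \<open>2s\<close> right after \<open>2s + 2\<close> by
      chords of lengths 2 and 4, and then backwards through the odd positions.\<close>
    define A1 where "A1 = map (\<lambda>t. 2 * t + (2 * s + 4)) [0..<l - s - 2]"
    define A2 where "A2 = map (\<lambda>t. 2 * t + 0) [0..<s]"
    define A3 where "A3 = map (\<lambda>t. 2 * t + 1) [0..<l]"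
    define idx where "idx = [2 * s + 2, 2 * s] @ A1 @ A2 @ rev A3"
    have "has_cycle b H (length idx)"
    proof (rule cycle_of_indices[OF g])
      have "distinct A1" "distinct A2" "distinct A3" by (auto simp: A1_def A2_def A3_def distinct_map inj_on_def)
      moreover have "x \<in> set A1 \<Longrightarrow> even x \<and> 2 * s + 4 \<le> x \<and> x < 2 * l" "x \<in> set A2 \<Longrightarrow> even x \<and> x < 2 * s"
        "x \<in> set A3 \<Longrightarrow> odd x \<and> x < 2 * l" for x using s by (auto simp: A1_def A2_def A3_def)
      ultimately show "distinct idx" "set idx \<subseteq> {..<2 * l}" using s by (fastforce simp: idx_def)+
      show "idx \<noteq> []" by (simp add: idx_def)
      have n: "A1 \<noteq> []" "A2 \<noteq> []" "A3 \<noteq> []" "hd A1 = 2 * s + 4" "last A1 = 2 * l - 2" "hd A2 = 0"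
        "last A2 = 2 * s - 2" "hd A3 = 1" "last A3 = 2 * l - 1"
        using s by (auto simp: A1_def A2_def A3_def last_map hd_map)
      have st: "b (f (x + i)) (f (x + 2 + i))" for x using d2[of "x + i"] by (simp add: add.commute add.left_commute)
      have s1: "successively (\<lambda>x y. b (?g x) (?g y)) A1" unfolding A1_def by (rule successively_steps) (rule st)
      have s2: "successively (\<lambda>x y. b (?g x) (?g y)) A2" unfolding A2_def by (rule successively_steps) (rule st)
      have s3: "successively (\<lambda>x y. b (?g x) (?g y)) (rev A3)"
        unfolding A3_def by (rule successively_steps_rev) (rule b_symD[OF st])
      have e1: "b (?g (2 * s + 2)) (?g (2 * s))" using b_symD[OF d2[of "2 * s + i"]] by (simp add: algebra_simps)
      have e2: "b (?g (2 * s)) (?g (2 * s + 4))" using d4[of "2 * s + i"] by (simp add: algebra_simps)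
      have h: "2 * l - 2 + i + 2 = i + 2 * l" using l by simp
      have e3: "b (?g (2 * l - 2)) (?g 0)" using d2[of "2 * l - 2 + i"] unfolding h per add_0 .
      have e4: "b (?g (2 * s - 2)) (?g (2 * l - 1))" using b_symD[OF c2] by (simp add: add.commute)
      show "successively (\<lambda>x y. b (?g x) (?g y)) idx"
        using n s1 s2 s3 e1 e2 e3 e4
        by (simp add: idx_def successively_append_iff successively_Cons hd_append hd_rev del: successively_rev)
      show "b (?g (last idx)) (?g (hd idx))"
        using n c1 by (simp add: idx_def last_rev add.commute add.left_commute)
    qed
    moreover have "length idx = 2 * l" using s by (simp add: idx_def A1_def A2_def A3_def)
    ultimately show False using nb(2) by simp
  qed
  define t where "t = s mod l"
  have "(i + 2 * s) mod (2 * l) = (i + 2 * t) mod (2 * l)"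
    unfolding t_def by (metis mod_add_right_eq mult_mod_right)
  then have e: "f (i + 2 * s) = f (i + 2 * t)" by (simp add: eq)
  have "t \<noteq> 0" using ne e by (metis add.right_neutral mult_0_right)
  moreover have "t < l" using l by (simp add: t_def)
  \<comment> \<open>The values \<open>l - 2\<close> and \<open>l - 1\<close> are chords of lengths 4
    and 2 seen from the other end.\<close>
  ultimately consider "t = 1" | "t = 2" | "3 \<le> t" "t + 3 \<le> l" | "t = l - 2" | "t = l - 1" using l by linarith
  then have "b (f i) (f (i + 2 * t))"
  proof cases
    case 4
    then have h: "i + 2 * t + 4 = i + 2 * l" using l by simp
    show ?thesis using d4[of "i + 2 * t"] unfolding h per by (rule b_symD)
  next
    case 5
    then have h: "i + 2 * t + 2 = i + 2 * l" using l by simp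
    show ?thesis using d2[of "i + 2 * t"] unfolding h per by (rule b_symD)
  qed (use d2[of i] d4[of i] dr in auto)
  then show ?thesis using e by simp
qed

text \<open>In a shortest monochromatic cycle of length above \<open>2k + 2\<close>, the chords of length 2 and 3 have the other
  colour, and they contain a cycle of one of the excluded lengths.\<close>

lemma red_even_cycle:
  assumes H: "finite H" "3 * k + 2 \<le> card H" and k: "3 \<le> k"
    and nr: "\<not> has_cycle r H (2 * k + 1)"
    and nb: "\<not> has_cycle b H (2 * k)" "\<not> has_cycle b H (2 * k + 2)"
  shows "has_cycle r H (2 * k + 2)"
proof -
  have ex_red: "\<exists>m\<ge>2 * k + 2. has_cycle r H m"
  proof (rule ccontr)
    assume no_red: "\<not> ?thesis"
    obtain m0 where m0: "2 * k + 1 \<le> m0" "has_cycle r H m0 \<or> has_cycle b H m0"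
      using long_mono_cycle[OF H k] by blast
    have "\<not> has_cycle r H m0"
    proof
      assume "has_cycle r H m0"
      then have "m0 \<noteq> 2 * k + 1" using nr by auto
      then show False using m0(1) no_red \<open>has_cycle r H m0\<close> by auto
    qed
    then have ex: "2 * k + 1 \<le> m0 \<and> has_cycle b H m0" using m0 by blast
    define m where "m = (LEAST m. 2 * k + 1 \<le> m \<and> has_cycle b H m)"
    have m: "2 * k + 1 \<le> m" "has_cycle b H m" using LeastI[of "\<lambda>m. 2 * k + 1 \<le> m \<and> has_cycle b H m", OF ex] m_def by auto
    have least: "\<not> has_cycle b H m'" if "2 * k + 1 \<le> m'" "m' < m" for m'
      using not_less_Least[of m'] that m_def by blast
    have m_ne: "m \<noteq> 2 * k + 2" using m(2) nb(2) by auto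
    obtain f where f: "cfun b f m" "range f \<subseteq> H" using has_cycle_cfun[OF m(2)] .
    have red: "r (f i) (f j)" if "\<not> b (f i) (f j)" "i mod m \<noteq> j mod m" for i j
      using that total f(1) unfolding cfun_def by blast
    have "\<not> has_cycle b H (m - 1)"
    proof (cases "m = 2 * k + 1")
      case False
      then show ?thesis using least[of "m - 1"] m(1) by auto
    qed (use nb in auto)
    moreover have h: "m - 2 + 1 = m - 1" using m(1) k by simp
    ultimately have "\<not> has_cycle b H (m - 2 + 1)" unfolding h by simp
    then have d2: "\<not> b (f i) (f (i + 2))" for i using no_short_chord[OF f, of 2 i] m(1) k by simp
    show False
    proof (cases "m = 2 * k + 1")
      case True
      have red2: "r (f i) (f (i + 2))" for i
      proof -
        have "i mod m \<noteq> (i + 2) mod m" using True k by (auto simp: mod_Suc)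
        then show ?thesis using red d2 by blast
      qed
      \<comment> \<open>On a cycle of odd length the chords of length 2 form a single cycle through
        all vertices: first the even positions, then the odd ones.\<close>
      define A1 where "A1 = map (\<lambda>t. 2 * t + 0) [0..<k + 1]"
      define A2 where "A2 = map (\<lambda>t. 2 * t + 1) [0..<k]"
      have n: "A1 \<noteq> []" "A2 \<noteq> []" "hd A1 = 0" "last A1 = 2 * k" "hd A2 = 1" "last A2 = 2 * k - 1"
        using k by (auto simp: A1_def A2_def last_map hd_map)
      have "has_cycle r H (length (A1 @ A2))"
      proof (rule cycle_of_indices[OF f])
        have "distinct A1" "distinct A2" by (auto simp: A1_def A2_def distinct_map inj_on_def)
        moreover have "x \<in> set A1 \<Longrightarrow> even x \<and> x < m" "x \<in> set A2 \<Longrightarrow> odd x \<and> x < m" for x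
          using True by (auto simp: A1_def A2_def)
        ultimately show "distinct (A1 @ A2)" "set (A1 @ A2) \<subseteq> {..<m}" by fastforce+
        show "A1 @ A2 \<noteq> []" using n by simp
        have s1: "successively (\<lambda>i j. r (f i) (f j)) A1" unfolding A1_def by (rule successively_steps) (rule red2)
        have s2: "successively (\<lambda>i j. r (f i) (f j)) A2" unfolding A2_def by (rule successively_steps) (rule red2)
        have "2 * k + 2 = 1 + m" "2 * k - 1 + 2 = 0 + m" using True k by simp_all
        then have "r (f (2 * k)) (f 1)" "r (f (2 * k - 1)) (f 0)"
          using red2[of "2 * k"] red2[of "2 * k - 1"] cfun_period[OF f(1)] by metis+
        then show "successively (\<lambda>i j. r (f i) (f j)) (A1 @ A2)" "r (f (last (A1 @ A2))) (f (hd (A1 @ A2)))"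
          using n s1 s2 by (simp_all add: successively_append_iff)
      qed
      moreover have "length (A1 @ A2) = m" using True by (simp add: A1_def A2_def)
      ultimately show False using nr True by simp
    next
      case False
      then have m3: "2 * k + 3 \<le> m" using m(1) m_ne by auto
      then have "\<not> has_cycle b H (m - 2)" using least[of "m - 2"] nb by auto
      moreover have h: "m - 3 + 1 = m - 2" using m3 by simp
      ultimately have "\<not> has_cycle b H (m - 3 + 1)" unfolding h by simp
      then have d3: "\<not> b (f i) (f (i + 3))" for i using no_short_chord[OF f, of 3 i] m3 k by simp
      have red': "r (f i) (f j)" if "i < m" "j < m" "j = i + 2 \<or> j = i + 3 \<or> i = j + 2 \<or> i = j + 3" for i j
        using that d2 d3 red[of i j] b_commute by (metis mod_less add_eq_self_zero zero_neq_numeral)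
      \<comment> \<open>The cycle \<open>3, 5, ..., 2k - 1, 2k + 2, 2k, ..., 0\<close> has chords of
        length 3 as its two transitions and \<open>(k - 1) + (k + 2) = 2k + 1\<close>
        vertices.\<close>
      define A1 where "A1 = map (\<lambda>t. 2 * t + 3) [0..<k - 1]"
      define A2 where "A2 = map (\<lambda>t. 2 * t + 0) [0..<k + 2]"
      have "has_cycle r H (length (A1 @ rev A2))"
      proof (rule cycle_of_indices[OF f])
        have n: "A1 \<noteq> []" "A2 \<noteq> []" "hd A1 = 3" "last A1 = 2 * k - 1" "hd A2 = 0" "last A2 = 2 * k + 2"
          using k by (auto simp: A1_def A2_def last_map hd_map)
        have "distinct A1" "distinct A2" by (auto simp: A1_def A2_def distinct_map inj_on_def)
        moreover have "x \<in> set A1 \<Longrightarrow> odd x \<and> x < m" "x \<in> set A2 \<Longrightarrow> even x \<and> x < m" for x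
          using m3 by (auto simp: A1_def A2_def)
        ultimately show "distinct (A1 @ rev A2)" "set (A1 @ rev A2) \<subseteq> {..<m}" by fastforce+
        show "A1 @ rev A2 \<noteq> []" using n by simp
        have s1: "successively (\<lambda>i j. r (f i) (f j)) A1" unfolding A1_def
          by (rule successively_steps, rule red') (use m3 in auto)
        have s2: "successively (\<lambda>i j. r (f i) (f j)) (rev A2)" unfolding A2_def
          by (rule successively_steps_rev, rule red') (use m3 in auto)
        have "r (f (2 * k - 1)) (f (2 * k + 2))" using m3 k by (intro red') auto
        then show "successively (\<lambda>i j. r (f i) (f j)) (A1 @ rev A2)"
          using n s1 s2 by (simp add: successively_append_iff hd_rev del: successively_rev)
        have "r (f 0) (f 3)" using m3 k by (intro red') auto
        then show "r (f (last (A1 @ rev A2))) (f (hd (A1 @ rev A2)))" using n by (simp add: last_rev)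
      qed
      moreover have "length (A1 @ rev A2) = 2 * k + 1" using k by (simp add: A1_def A2_def)
      ultimately show False using nr by simp
    qed
  qed
  define m where "m = (LEAST m. 2 * k + 2 \<le> m \<and> has_cycle r H m)"
  have m: "2 * k + 2 \<le> m" "has_cycle r H m" using LeastI_ex[of "\<lambda>m. 2 * k + 2 \<le> m \<and> has_cycle r H m"] ex_red m_def by auto
  have least: "\<not> has_cycle r H m'" if "2 * k + 2 \<le> m'" "m' < m" for m'
    using not_less_Least[of m'] that m_def by blast
  show ?thesis
  proof (cases "m = 2 * k + 2")
    case False
    then have m3: "2 * k + 3 \<le> m" using m(1) by simp
    obtain f where f: "cfun r f m" "range f \<subseteq> H" using has_cycle_cfun[OF m(2)] .
    have "\<not> has_cycle r H (m - 1)" using m3 by (intro least) simp_all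
    moreover have h: "m - 2 + 1 = m - 1" using m3 by simp
    ultimately have "\<not> has_cycle r H (m - 2 + 1)" unfolding h by simp
    then have d2: "\<not> r (f i) (f (i + 2))" for i using no_short_chord[OF f, of 2 i] m3 by simp
    have "\<not> has_cycle r H (m - 2)"
    proof (cases "m = 2 * k + 3")
      case False
      then show ?thesis using least[of "m - 2"] m3 by auto
    qed (use nr in auto)
    moreover have h: "m - 3 + 1 = m - 2" using m3 by simp
    ultimately have "\<not> has_cycle r H (m - 3 + 1)" unfolding h by simp
    then have d3: "\<not> r (f i) (f (i + 3))" for i using no_short_chord[OF f, of 3 i] m3 k by simp
    have blue: "b (f i) (f j)" if "i < m" "j < m" "j = i + 2 \<or> j = i + 3 \<or> i = j + 2 \<or> i = j + 3" for i j
    proof -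
      have "i \<noteq> j" using that(3) by auto
      then have "f i \<noteq> f j" using f(1) that(1,2) unfolding cfun_def by simp
      moreover have "\<not> r (f i) (f j)" using that(3) d2 d3 r_symD by metis
      ultimately show ?thesis using total by blast
    qed
    \<comment> \<open>The cycle \<open>0, 2, ..., 2k - 2, 2k + 1, 2k - 1, ..., 3\<close> has chords
      of length 3 as its two transitions and \<open>k + k\<close> vertices.\<close>
    define A1 where "A1 = map (\<lambda>t. 2 * t + 0) [0..<k]"
    define A2 where "A2 = map (\<lambda>t. 2 * t + 3) [0..<k]"
    have "has_cycle b H (length (A1 @ rev A2))"
    proof (rule cycle_of_indices[OF f])
      have n: "A1 \<noteq> []" "A2 \<noteq> []" "hd A1 = 0" "last A1 = 2 * k - 2" "hd A2 = 3" "last A2 = 2 * k + 1"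
        using k by (auto simp: A1_def A2_def last_map hd_map)
      have "distinct A1" "distinct A2" by (auto simp: A1_def A2_def distinct_map inj_on_def)
      moreover have "x \<in> set A1 \<Longrightarrow> even x \<and> x < m" "x \<in> set A2 \<Longrightarrow> odd x \<and> x < m" for x
        using m3 by (auto simp: A1_def A2_def)
      ultimately show "distinct (A1 @ rev A2)" "set (A1 @ rev A2) \<subseteq> {..<m}" by fastforce+
      show "A1 @ rev A2 \<noteq> []" using n by simp
      have s1: "successively (\<lambda>i j. b (f i) (f j)) A1" unfolding A1_def
        by (rule successively_steps, rule blue) (use m3 in auto)
      have s2: "successively (\<lambda>i j. b (f i) (f j)) (rev A2)" unfolding A2_def
        by (rule successively_steps_rev, rule blue) (use m3 in auto)
      have "b (f (2 * k - 2)) (f (2 * k + 1))" using m3 k by (intro blue) auto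
      then show "successively (\<lambda>i j. b (f i) (f j)) (A1 @ rev A2)"
        using n s1 s2 by (simp add: successively_append_iff hd_rev del: successively_rev)
      have "b (f 3) (f 0)" using m3 k by (intro blue) auto
      then show "b (f (last (A1 @ rev A2))) (f (hd (A1 @ rev A2)))" using n by (simp add: last_rev)
    qed
    moreover have "length (A1 @ rev A2) = 2 * k" by (simp add: A1_def A2_def)
    ultimately show ?thesis using nb(1) by simp
  qed (use m in simp)
qed

text \<open>The even and the odd positions of a red cycle of length \<open>2k + 2\<close> are blue
  cliques with \<open>k + 1\<close> vertices each. Two disjoint blue edges between them would give a
  blue cycle of length \<open>2k\<close>, so deleting one vertex leaves only red edges between
  them.\<close>

lemma base_core:
  assumes H: "finite H" "3 * k + 2 \<le> card H" and k: "3 \<le> k"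
    and nr: "\<not> has_cycle r H (2 * k + 1)"
    and nb: "\<not> has_cycle b H (2 * k)" "\<not> has_cycle b H (2 * k + 2)"
  shows "\<exists>A B. joined H A B \<and> k \<le> card A \<and> k \<le> card B \<and> 2 * k \<le> card A + card B"
proof -
  obtain f where f: "cfun r f (2 * (k + 1))" "range f \<subseteq> H"
    using has_cycle_cfun red_even_cycle[OF assms] by (metis add_mult_distrib2 mult_1_right)
  have nums: "2 * (k + 1) - 1 = 2 * k + 1" "2 * (k + 1) - 2 = 2 * k" "2 * (k + 1) = 2 * k + 2" by simp_all
  have cl: "b (f i) (f (i + 2 * s))" if "f i \<noteq> f (i + 2 * s)" for i s
    using even_cycle_cliques[OF f _ _ _ _ that] nr nb k nums by simp
  have cl': "b (f i) (f j)" if ij: "f i \<noteq> f j" "even (i + j)" for i j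
  proof (cases "i \<le> j")
    case True
    then have "even (j - i)" using ij(2) by simp
    then obtain s where "j - i = 2 * s" by (rule evenE)
    then have "j = i + 2 * s" using True by simp
    then show ?thesis using cl ij by simp
  next
    case False
    then have "even (i - j)" using ij(2) by simp
    then obtain s where "i - j = 2 * s" by (rule evenE)
    then have "i = j + 2 * s" using False by simp
    then show ?thesis using cl[of j s] ij b_symD by simp
  qed
  define S where "S c = (\<lambda>t. f (2 * t + c)) ` {..k}" for c
  have inj: "inj_on (\<lambda>t. f (2 * t + c)) {..k}" if "c \<le> 1" for c
  proof (rule inj_onI)
    fix s t assume a: "s \<in> {..k}" "t \<in> {..k}" "f (2 * s + c) = f (2 * t + c)"
    then have "(2 * s + c) mod (2 * (k + 1)) = (2 * t + c) mod (2 * (k + 1))" using f(1) unfolding cfun_def by blast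
    then show "s = t" using a that by simp
  qed
  have cS: "card (S c) = k + 1" "finite (S c)" "S c \<subseteq> H" if "c \<le> 1" for c
    using card_image[OF inj[OF that]] f(2) by (auto simp: S_def)
  have clS: "b_clique (S c)" for c
    unfolding b_clique_def S_def by (auto intro!: cl')
  have disj: "S 0 \<inter> S 1 = {}"
  proof -
    have "f (2 * s + 0) \<noteq> f (2 * t + 1)" if "s \<le> k" "t \<le> k" for s t
    proof
      assume "f (2 * s + 0) = f (2 * t + 1)"
      then have "(2 * s + 0) mod (2 * (k + 1)) = (2 * t + 1) mod (2 * (k + 1))" using f(1) unfolding cfun_def by blast
      then have "2 * s = 2 * t + 1" using that by simp
      then show False by presburger
    qed
    then show ?thesis by (auto simp: S_def)
  qed
  have disjoint_edges: "s = s' \<or> t = t'"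
    if e: "s \<in> S 0" "s' \<in> S 0" "t \<in> S 1" "t' \<in> S 1" "b s t" "b s' t'" for s s' t t'
  proof (rule ccontr)
    assume "\<not> (s = s' \<or> t = t')"
    then have ne: "s \<noteq> s'" "t \<noteq> t'" by blast+
    have "has_cycle b H (2 * k)"
      by (rule two_cliques_cycle[OF clS clS _ _ disj e(1,2) ne(1) e(3,4) ne(2), of "[]" "[]"])
        (use cS[of 0] cS[of 1] e(5,6) k in simp_all)
    then show False using nb by blast
  qed
  have red: "r s t" if "s \<in> S 0" "t \<in> S 1" "\<not> b s t" for s t
  proof -
    have "s \<noteq> t" using that(1,2) disj by blast
    then show ?thesis using that(3) total by blast
  qed
  have "S 0 \<noteq> {}" "S 1 \<noteq> {}" by (auto simp: S_def)
  then have "(\<exists>t0\<in>S 1. \<forall>s\<in>S 0. \<forall>t\<in>S 1. b s t \<longrightarrow> t = t0) \<or> (\<exists>s0\<in>S 0. \<forall>s\<in>S 0. \<forall>t\<in>S 1. b s t \<longrightarrow> s = s0)"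
    by (rule star_cover) (rule disjoint_edges)
  then consider t0 where "t0 \<in> S 1" "\<forall>s\<in>S 0. \<forall>t\<in>S 1. b s t \<longrightarrow> t = t0"
    | s0 where "s0 \<in> S 0" "\<forall>s\<in>S 0. \<forall>t\<in>S 1. b s t \<longrightarrow> s = s0"
    by blast
  then show ?thesis
  proof cases
    case 1
    have "r s t" if "s \<in> S 0" "t \<in> S 1 - {t0}" for s t using 1 that red by blast
    then have "joined H (S 0) (S 1 - {t0})"
      using cS[of 0] cS[of 1] clS disj b_clique_mono[OF clS, of "S 1 - {t0}" 1] by (auto simp: joined_def)
    moreover have "card (S 1 - {t0}) = k" using 1 cS[of 1] by simp
    ultimately show ?thesis using cS[of 0] by (intro exI[of _ "S 0"] exI[of _ "S 1 - {t0}"]) auto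
  next
    case 2
    have "r s t" if "s \<in> S 0 - {s0}" "t \<in> S 1" for s t using 2 that red by blast
    then have "joined H (S 0 - {s0}) (S 1)"
      using cS[of 0] cS[of 1] clS disj b_clique_mono[OF clS, of "S 0 - {s0}" 0] by (auto simp: joined_def)
    moreover have "card (S 0 - {s0}) = k" using 2 cS[of 0] by simp
    ultimately show ?thesis using cS[of 1] by (intro exI[of _ "S 0 - {s0}"] exI[of _ "S 1"]) auto
  qed
qed

text \<open>If some blue cycle has length \<open>2l\<close> with \<open>k \<le> l < j\<close>, the
  largest such \<open>l\<close> makes blue length \<open>2l + 2\<close> impossible, and the clique
  outside the cycle starts the construction. Otherwise the lengths \<open>2k\<close> and
  \<open>2k + 2\<close> are both missing in blue, which is what \<open>base_core\<close>
  requires.\<close>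

lemma joined_structure:
  assumes H: "finite H" "3 * j \<le> card H + 1" and kj: "3 \<le> k" "k < j"
    and nr: "\<not> has_cycle r H (2 * k + 1)" and nb: "\<not> has_cycle b H (2 * j)"
  shows "\<exists>P Q. joined H P Q \<and> card H \<le> card P + card Q + 1"
proof (cases "\<exists>l. k \<le> l \<and> l < j \<and> has_cycle b H (2 * l)")
  case True
  let ?L = "{l. k \<le> l \<and> l < j \<and> has_cycle b H (2 * l)}"
  have "finite ?L" "?L \<noteq> {}" using True by auto
  define l where "l = Max ?L"
  have "l \<in> ?L" unfolding l_def using \<open>finite ?L\<close> \<open>?L \<noteq> {}\<close> by (rule Max_in)
  then have l: "k \<le> l" "l < j" "has_cycle b H (2 * l)" by auto
  have no: "\<not> has_cycle b H (2 * l + 2)"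
  proof
    assume a: "has_cycle b H (2 * l + 2)"
    then have "l + 1 \<noteq> j" using nb by auto
    then have "l + 1 \<in> ?L" using l a by auto
    then have "l + 1 \<le> l" unfolding l_def using Max_ge[OF \<open>finite ?L\<close>] by blast
    then show False by simp
  qed
  obtain C where C: "cyc b C" "length C = 2 * l" "set C \<subseteq> H" using l(3) by (auto simp: has_cycle_def)
  have cH: "3 * l + 2 \<le> card H" using H(2) l by linarith
  obtain D W where D: "cyc b D" "length D = 2 * l" "set D \<subseteq> H" "W \<subseteq> H - set D" "card H \<le> 2 * l + 1 + card W" "b_clique W"
    using blue_clique_outside[OF C H(1) cH _ l(1) no nr] kj by auto
  have "l + 1 \<le> card W" using D(5) cH by linarith
  then obtain A B where AB: "joined H A B" "k \<le> card A" "k \<le> card B" "2 * l + 2 \<le> card A + card B"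
    using core_from_clique[OF D(1-3) H(1) D(4) _ D(6) _ l(1) no nr] kj by auto
  show ?thesis
    by (rule core_absorbs[OF AB(1) H(1) _ AB(2,3) _ _ nr no _ AB(4)]) (use kj l AB in auto)
next
  case False
  have "\<not> has_cycle b H (2 * k)" using False kj by auto
  moreover have "\<not> has_cycle b H (2 * k + 2)"
  proof (cases "k + 1 = j")
    case True
    then show ?thesis using nb by auto
  next
    case n: False
    have "2 * k + 2 = 2 * (k + 1)" by simp
    then show ?thesis using False kj n by (metis Suc_eq_plus1 Suc_lessI le_add1)
  qed
  moreover have "3 * k + 2 \<le> card H" using H(2) kj by linarith
  ultimately obtain A B where AB: "joined H A B" "k \<le> card A" "k \<le> card B" "2 * k \<le> card A + card B"
    using base_core[OF H(1) _ kj(1) nr] by blast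
  show ?thesis
    by (rule core_absorbs[OF AB(1) H(1) _ AB(2,3) _ _ nr \<open>\<not> has_cycle b H (2 * k)\<close> _ AB(4)]) (use kj AB in auto)
qed


section \<open>A vertex of large blue degree\<close>

text \<open>The last clause says that no further vertex with a red neighbour in \<open>B\<close> can be added to \<open>P\<close>.\<close>

definition extends :: "'a set \<Rightarrow> 'a set \<Rightarrow> 'a set \<Rightarrow> 'a set \<Rightarrow> bool" where
  "extends V A B P \<longleftrightarrow> A \<subseteq> P \<and> b_clique P \<and> P \<subseteq> A \<union> {u \<in> V - B. \<exists>x\<in>B. r u x} \<and>
     (\<forall>u\<in>V - B - P. (\<exists>x\<in>B. r u x) \<longrightarrow> (\<exists>y\<in>P. r u y))"

lemma obtain_extends:
  assumes "finite V" "A \<subseteq> V" "b_clique A"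
  obtains P where "extends V A B P"
proof -
  let ?U = "A \<union> {u \<in> V - B. \<exists>x\<in>B. r u x}"
  let ?S = "{P. A \<subseteq> P \<and> b_clique P \<and> P \<subseteq> ?U}"
  have "finite ?U" using assms by (auto intro: finite_subset)
  then have fin: "finite ?S" by (auto intro: finite_subset[of _ "Pow ?U"])
  have "A \<in> ?S" using assms by auto
  from finite_has_maximal2[OF fin this]
  obtain P where P: "P \<in> ?S" "\<forall>Q\<in>?S. P \<subseteq> Q \<longrightarrow> P = Q" by (elim bexE conjE)
  have "\<exists>y\<in>P. r u y" if u: "u \<in> V - B - P" "\<exists>x\<in>B. r u x" for u
  proof (rule ccontr)
    assume n: "\<not> (\<exists>y\<in>P. r u y)"
    have "b u y \<and> b y u" if "y \<in> P" for y
    proof -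
      have "u \<noteq> y" using u that by blast
      then have "b u y" using n that total by blast
      then show ?thesis using b_symD by blast
    qed
    then have "b_clique (insert u P)" using P(1) by (auto simp: b_clique_def)
    then have "insert u P \<in> ?S" using P(1) u by auto
    then have "P = insert u P" using P(2) by blast
    then show False using u by blast
  qed
  then have "extends V A B P" using P(1) by (auto simp: extends_def)
  then show thesis by (rule that)
qed

text \<open>As \<open>z\<close> was not added to \<open>P\<close>, it is red to some
  \<open>y\<close> in \<open>P\<close>. This \<open>y\<close> is not in \<open>A\<close>, since
  \<open>z\<close> cannot be red to both cliques, so it has a red neighbour in \<open>B\<close>
  itself, and \<open>joined_red_pair\<close> for the red edge \<open>z y\<close> makes all red
  neighbours of \<open>z\<close> and \<open>y\<close> in \<open>B\<close> equal.\<close>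

lemma extends_witness:
  assumes j: "joined V A B" "finite V" and k: "2 \<le> k" "k \<le> card A" "k \<le> card B"
    and nr: "\<not> has_cycle r V (2 * k + 1)" and P: "extends V A B P"
    and z: "z \<in> V - (A \<union> B) - P" "r z x" "x \<in> B"
  obtains y where "y \<in> P - A" "y \<in> V - (A \<union> B)" "r z y" "\<And>x'. x' \<in> B \<Longrightarrow> r z x' \<Longrightarrow> x' = x"
    "\<And>x'. x' \<in> B \<Longrightarrow> r y x' \<Longrightarrow> x' = x"
proof -
  have P': "P \<subseteq> A \<union> {u \<in> V - B. \<exists>x\<in>B. r u x}" "\<forall>u\<in>V - B - P. (\<exists>x\<in>B. r u x) \<longrightarrow> (\<exists>y\<in>P. r u y)"
    using P by (simp_all add: extends_def)
  then obtain y where y: "y \<in> P" "r z y" using z by blast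
  have "y \<notin> A"
  proof
    assume "y \<in> A"
    then show False using joined_no_common_red[OF j k nr _ _ y(2) _ z(2,3)] z by blast
  qed
  then have yV: "y \<in> V" "y \<notin> A \<union> B" and "\<exists>w\<in>B. r y w" using y P'(1) by blast+
  then obtain w where w: "w \<in> B" "r y w" by blast
  have zV: "z \<in> V" "z \<notin> A \<union> B" using z by auto
  have e: "x1 = x2" if "x1 \<in> B" "r z x1" "x2 \<in> B" "r y x2" for x1 x2
    by (rule joined_red_pair[OF j k nr zV yV y(2) that(2,4,1,3)])
  have "w = x" using e[OF z(3,2) w] by simp
  then show thesis using that[of y] y \<open>y \<notin> A\<close> yV e w z by blast
qed

text \<open>The blue neighbourhood of the hub \<open>z\<close> contains \<open>A\<close> and
  \<open>B - {x}\<close>, and \<open>u\<close>, \<open>u'\<close> connect these two cliques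
  twice.\<close>

lemma hub_cycle:
  assumes j: "joined V A B" "finite V"
    and n: "6 \<le> n" "n \<le> card A + card B + 1" "2 \<le> card A" "4 \<le> card B"
    and V: "z \<in> V - (A \<union> B)" "u \<in> V - (A \<union> B)" "u' \<in> V - (A \<union> B)" "u \<noteq> u'" "b z u" "b z u'"
    and A: "\<And>y. y \<in> A \<Longrightarrow> b z y \<and> b u y \<and> b u' y"
    and B: "\<And>y. y \<in> B \<Longrightarrow> y \<noteq> x \<Longrightarrow> b z y" "\<And>y. y \<in> B \<Longrightarrow> y \<noteq> x' \<Longrightarrow> b u y \<and> b u' y"
  shows "has_cycle b {y \<in> V. b z y} n"
proof (rule ccontr)
  assume nb: "\<not> has_cycle b {y \<in> V. b z y} n"
  have jj: "A \<subseteq> V" "B \<subseteq> V" "A \<inter> B = {}" "b_clique A" "b_clique B" "\<And>a y. a \<in> A \<Longrightarrow> y \<in> B \<Longrightarrow> r a y"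
    using j(1) by (auto simp: joined_def)
  have fin: "finite A" "finite B" using jj j(2) by (auto intro: finite_subset)
  have "joined {y \<in> V. b z y} A (B - {x})"
    using jj A B b_clique_mono[OF jj(5), of "B - {x}"] unfolding joined_def by blast
  moreover have "n \<le> card A + card (B - {x}) + 2" using n card_Diff1_le[of B x] by (simp add: card_Diff_singleton_if) 
  moreover have "finite {y \<in> V. b z y}" using j(2) by simp
  moreover obtain a a' where "a \<in> A" "a' \<in> A" "a \<noteq> a'" using n(3) by (metis card_le_Suc0_iff_eq fin(1) not_less_eq_eq numeral_2_eq_2)
  moreover have "2 \<le> card (B - {x} - {x'})" using n(4) by (auto simp: card_Diff_singleton_if)
  then obtain y y' where "y \<in> B - {x} - {x'}" "y' \<in> B - {x} - {x'}" "y \<noteq> y'"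
    by (metis card_le_Suc0_iff_eq fin(2) finite_Diff not_less_eq_eq numeral_2_eq_2)
  ultimately show False
    using two_connectors[of "{y \<in> V. b z y}" A "B - {x}" n u u' a a' y y'] nb n V A B by blast
qed

text \<open>If the red neighbours differed, \<open>z\<close> would be joined in blue to
  \<open>z'\<close> and to the witness \<open>y\<close> of \<open>z'\<close>, and these two would be
  the connectors for a wheel with hub \<open>z\<close>.\<close>

lemma red_to_B_shared:
  assumes j: "joined V A B" "finite V" and k: "2 \<le> k" "k \<le> card A" "k \<le> card B"
    and nr: "\<not> has_cycle r V (2 * k + 1)" and P: "extends V A B P"
    and n: "6 \<le> n" "n \<le> card A + card B + 1" "4 \<le> card B"
    and nw: "\<And>h. h \<in> V \<Longrightarrow> \<not> has_cycle b {y \<in> V. b h y} n"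
    and z: "z \<in> V - (A \<union> B) - P" "r z x" "x \<in> B" and z': "z' \<in> V - (A \<union> B) - P" "r z' x'" "x' \<in> B"
  shows "x = x'"
proof (rule ccontr)
  assume ne: "x \<noteq> x'"
  obtain y where y: "y \<in> P - A" "y \<in> V - (A \<union> B)" "r z' y" "\<And>w. w \<in> B \<Longrightarrow> r z' w \<Longrightarrow> w = x'"
    "\<And>w. w \<in> B \<Longrightarrow> r y w \<Longrightarrow> w = x'"
    using extends_witness[OF j k nr P z'] by blast
  obtain y0 where y0: "\<And>w. w \<in> B \<Longrightarrow> r z w \<Longrightarrow> w = x"
    using extends_witness[OF j k nr P z] by blast
  have PA: "A \<subseteq> P" "b_clique P" "P \<subseteq> A \<union> {u \<in> V - B. \<exists>x\<in>B. r u x}" using P by (simp_all add: extends_def)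
  obtain w where w: "w \<in> B" "r y w" using y(1) PA(3) by blast
  have w': "r y x'" using w(2) unfolding y(5)[OF w] .
  have mem: "z \<in> V" "z \<notin> A \<union> B" "z' \<in> V" "z' \<notin> A \<union> B" "y \<in> V" "y \<notin> A \<union> B"
    using z(1) z'(1) y(2) by blast+
  have "\<not> r z z'" using joined_red_pair[OF j k nr mem(1-4) _ z(2) z'(2) z(3) z'(3)] ne by blast
  moreover have "z \<noteq> z'" using y0[OF z'(3)] z'(2) ne by blast
  ultimately have bz: "b z z'" using total by blast
  have "\<not> r z y" using joined_red_pair[OF j k nr mem(1,2,5,6) _ z(2) w' z(3) z'(3)] ne by blast
  moreover have "z \<noteq> y" using y(1) z(1) by blast
  ultimately have bzy: "b z y" using total by blast
  have A: "b z a \<and> b z' a \<and> b y a" if "a \<in> A" for a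
  proof -
    have "\<not> r z a" using joined_no_common_red[OF j k nr mem(1,2) _ that z(2,3)] by blast
    moreover have "\<not> r z' a" using joined_no_common_red[OF j k nr mem(3,4) _ that z'(2,3)] by blast
    moreover have ne: "z \<noteq> a" "z' \<noteq> a" "y \<noteq> a" using mem that by blast+
    moreover have "b y a" using PA(1,2) y(1) that ne(3) unfolding b_clique_def by blast
    ultimately show ?thesis using total by blast
  qed
  have "2 \<le> card A" using k by simp
  moreover have "z' \<noteq> y" using y(1) z'(1) by blast
  moreover have "b z w" if "w \<in> B" "w \<noteq> x" for w
  proof -
    have "z \<noteq> w" using mem that(1) by blast
    moreover have "\<not> r z w" using y0[OF that(1)] that(2) by blast
    ultimately show ?thesis using total by blast
  qed
  moreover have "b z' w \<and> b y w" if "w \<in> B" "w \<noteq> x'" for w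
  proof -
    have "z' \<noteq> w" "y \<noteq> w" using mem that by blast+
    moreover have "\<not> r z' w" "\<not> r y w" using y(4,5)[OF that(1)] that(2) by blast+
    ultimately show ?thesis using total by blast
  qed
  moreover have "z \<in> V - (A \<union> B)" "z' \<in> V - (A \<union> B)" using z(1) z'(1) by blast+
  ultimately have "has_cycle b {y \<in> V. b z y} n"
    by (intro hub_cycle[OF j n(1,2) _ n(3) _ _ y(2) _ bz bzy A, of x x']) simp_all
  then show False using nw mem by blast
qed

text \<open>The hub \<open>h\<close> is taken from the clique \<open>P\<close>; the vertices \<open>zs\<close> outside of \<open>P\<close> are separated by vertices \<open>xs\<close> of \<open>P\<close>.\<close>

lemma fan_cycle:
  assumes P: "b_clique P" "finite P" "h \<in> P"
    and zs: "viap b zs xs" "distinct zs" "set zs \<inter> P = {}" "distinct xs" "set xs \<subseteq> P - {h}" "\<forall>z\<in>set zs. b h z"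
    and rest: "distinct rest" "rest \<noteq> []" "set rest = P - {h} - set xs" "b (last zs) (hd rest)" "b (last rest) (hd zs)"
  shows "has_cycle b {x \<in> P \<union> set zs. b h x} (length zs + card P - 1)"
proof (rule has_cycleI)
  note w = viap_weave[OF zs(1)]
  have "set zs \<inter> set xs = {}" using zs by blast
  then have "distinct (weave zs xs)" using zs distinct_weave by blast
  moreover have "set (weave zs xs) \<inter> set rest = {}" using rest zs by (auto simp: set_weave)
  moreover have "successively b rest" using b_clique_successively[OF P(1)] rest by blast
  ultimately show "cyc b (weave zs xs @ rest)"
    using w rest(1,2,4,5) unfolding cyc_def successively_append_iff by simp
  have "b h x" if "x \<in> P - {h}" for x
  proof -
    have "h \<noteq> x" "x \<in> P" using that by auto
    then show ?thesis using P(1,3) by (simp add: b_clique_def)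
  qed
  then show "set (weave zs xs @ rest) \<subseteq> {x \<in> P \<union> set zs. b h x}" using zs rest by (auto simp: set_weave)
  have "length xs + length rest = card (P - {h})"
  proof -
    have "card (P - {h}) = card (P - {h} - set xs) + card (set xs)"
      using zs(5) P(2) by (simp add: card_Diff_subset card_mono)
    then show ?thesis using rest zs(4) distinct_card[of xs] distinct_card[of rest] by simp
  qed
  moreover have "card P = card (P - {h}) + 1" using P by (metis Suc_eq_plus1 card_Suc_Diff1)
  ultimately show "length (weave zs xs @ rest) = length zs + card P - 1" by (simp add: length_weave)
qed

text \<open>All red edges between \<open>B\<close> and the vertices outside \<open>P\<close> and
  \<open>Q\<close> end in one vertex \<open>c\<close>. The hub is another vertex of
  \<open>B\<close>, and the rim consists of the rest of \<open>Q\<close> and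
  \<open>2j + 1 - card Q\<close> vertices outside, separated by vertices of \<open>B - {c}\<close>.
  The count forces \<open>c\<close> onto the rim, where it is placed next to \<open>v\<close>, which
  is blue to it. Enough separators exist if \<open>card Q \<ge> j + 2\<close>; in the exceptional
  case \<open>c\<close> lies between two outside vertices, and therefore a second vertex
  \<open>v'\<close> blue to \<open>B\<close> is required.\<close>

lemma side_wheel:
  assumes j: "joined V A B" "finite V" and k: "2 \<le> k" "k \<le> card A" "k \<le> card B"
    and nr: "\<not> has_cycle r V (2 * k + 1)" and P: "extends V A B P" and Q: "extends V B A Q"
    and n: "3 \<le> j" "2 * j \<le> card A + card B + 1" "j + 1 \<le> card B" "4 * j + 1 \<le> card V" "card P \<le> 2 * j" "card Q \<le> 2 * j"
    and v: "v \<in> V - (A \<union> B)" "\<And>x. x \<in> A \<union> B \<Longrightarrow> b v x"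
    and big: "j + 2 \<le> card Q \<or> Q = B \<and> card B + j = 2 * j + 1 \<and> j = 4 \<and> (\<exists>v'\<in>V - P - Q. v' \<noteq> v \<and> (\<forall>x\<in>B. b v' x))"
  shows "\<exists>h\<in>V. has_cycle b {x \<in> V. b h x} (2 * j)"
proof (rule ccontr)
  assume "\<not> ?thesis"
  then have nw: "\<And>h. h \<in> V \<Longrightarrow> \<not> has_cycle b {y \<in> V. b h y} (2 * j)" by blast
  have jj: "A \<subseteq> V" "B \<subseteq> V" "A \<inter> B = {}" using j(1) by (auto simp: joined_def)
  have finB: "finite B" using jj j(2) by (auto intro: finite_subset)
  have PA: "A \<subseteq> P" "P \<subseteq> A \<union> {u \<in> V - B. \<exists>x\<in>B. r u x}" using P by (simp_all add: extends_def)
  have QB: "B \<subseteq> Q" "b_clique Q" "Q \<subseteq> B \<union> {u \<in> V - A. \<exists>x\<in>A. r u x}" using Q by (simp_all add: extends_def)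
  have "P \<subseteq> V" "Q \<subseteq> V" using PA QB jj by blast+
  then have finPQ: "finite P" "finite Q" using j(2) by (auto intro: finite_subset)
  define Z where "Z = V - P - Q"
  have "\<not> r v x" if "x \<in> A \<union> B" for x using v(2)[OF that] exclusive by blast
  then have vZ: "v \<in> Z" using v(1) PA(2) QB(3) unfolding Z_def by auto
  have finZ: "finite Z" using j(2) by (simp add: Z_def)
  have ZV: "Z \<subseteq> V - (A \<union> B) - P" using PA QB by (auto simp: Z_def)
  have "card V \<le> card P + card Q + card Z"
  proof -
    have "V \<subseteq> P \<union> Q \<union> Z" by (auto simp: Z_def)
    then have "card V \<le> card (P \<union> Q \<union> Z)" using finPQ finZ by (intro card_mono) auto
    also have "\<dots> \<le> card P + card Q + card Z" by (meson card_Un_le le_trans add_le_mono1)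
    finally show ?thesis .
  qed
  \<comment> \<open>With the hub taken out of \<open>Q\<close>, the rim has
    \<open>t + card Q - 1 = 2j\<close> vertices.\<close>
  define t where "t = 2 * j + 1 - card Q"
  have t: "1 \<le> t" "t \<le> card Z" "t + card Q = 2 * j + 1"
    using \<open>card V \<le> card P + card Q + card Z\<close> n by (auto simp: t_def)
  have shared: "x = x'" if "z \<in> Z" "r z x" "x \<in> B" "z' \<in> Z" "r z' x'" "x' \<in> B" for z x z' x'
    by (rule red_to_B_shared[OF j k nr P _ _ _ nw]) (use that ZV n in auto)
  have "\<exists>c\<in>B. \<forall>z\<in>Z. \<forall>x\<in>B. r z x \<longrightarrow> x = c"
  proof (cases "\<exists>z\<in>Z. \<exists>x\<in>B. r z x")
    case False
    moreover have "B \<noteq> {}" using n by auto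
    ultimately show ?thesis by blast
  qed (use shared in blast)
  then obtain c where c: "c \<in> B" "\<And>z x. z \<in> Z \<Longrightarrow> x \<in> B \<Longrightarrow> x \<noteq> c \<Longrightarrow> \<not> r z x" by blast
  have blue: "b z x \<and> b x z" if "z \<in> Z" "x \<in> B - {c}" for z x
  proof -
    have "z \<noteq> x" using that ZV by blast
    then have "b z x" using c(2) that total by blast
    then show ?thesis using b_symD by blast
  qed
  have "1 \<le> card (B - {c})" using n c finB by simp
  then have "B - {c} \<noteq> {}" by (metis card.empty not_one_le_zero)
  then obtain h where h: "h \<in> B - {c}" by blast
  have "h \<in> Q" "c \<in> Q" "h \<noteq> c" using h c QB by auto
  have wheel: False if zs: "viap b zs xs" "distinct zs" "set zs \<subseteq> Z" "length zs = t" "distinct xs" "set xs \<subseteq> B - {c} - {h}"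
    and rest: "distinct rest" "rest \<noteq> []" "set rest = Q - {h} - set xs" "b (last zs) (hd rest)" "b (last rest) (hd zs)" for zs xs rest
  proof -
    have "has_cycle b {x \<in> Q \<union> set zs. b h x} (length zs + card Q - 1)"
      by (rule fan_cycle[OF QB(2) finPQ(2) \<open>h \<in> Q\<close> zs(1,2) _ zs(5) _ _ rest])
        (use zs(3,6) QB(1) blue[OF _ h] in \<open>auto simp: Z_def\<close>)
    moreover have "{x \<in> Q \<union> set zs. b h x} \<subseteq> {x \<in> V. b h x}" using \<open>Q \<subseteq> V\<close> zs(3) by (auto simp: Z_def)
    moreover have "length zs + card Q - 1 = 2 * j" using zs(4) t by simp
    ultimately have "has_cycle b {x \<in> V. b h x} (2 * j)" using has_cycle_mono by metis
    then show False using nw h jj by blast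
  qed
  have vc: "b c v" using v(2) c(1) b_symD by blast
  show False
  proof (cases "j + 2 \<le> card Q")
    case True
    have "t - 1 \<le> card (Z - {v})" using t vZ finZ by simp
    then obtain zs' where zs': "distinct zs'" "set zs' \<subseteq> Z - {v}" "length zs' = t - 1"
      using obtain_distinct_list[of "Z - {v}"] finZ by blast
    have cB: "card (B - {c} - {h}) = card B - 2" using h c finB by (simp add: card_Diff_subset)
    have "t \<le> card (B - {c} - {h})" using cB n(3) True t by linarith
    then obtain xs where xs: "distinct xs" "set xs \<subseteq> B - {c} - {h}" "length xs = t"
      using obtain_distinct_list[of "B - {c} - {h}" t] finB by blast
    \<comment> \<open>The \<open>t - 1\<close> vertices \<open>ys\<close> separate the outside
      vertices; the stretch through the rest of \<open>Q\<close> starts at \<open>y\<close>, which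
      is blue to everything in \<open>Z\<close>, and ends at \<open>c\<close>, which is blue to
      \<open>v\<close>.\<close>
    then obtain y ys where ys: "xs = y # ys" using t(1) by (cases xs) auto
    have "w \<in> Z \<and> y' \<in> B - {c}" if "w \<in> set (v # zs')" "y' \<in> set ys" for w y'
      using that zs'(2) xs(2) ys vZ by auto
    then have "viap b (v # zs') ys"
      using blue zs'(3) xs(3) ys t(1) by (intro viap_complete) auto
    moreover have zsZ: "set (v # zs') \<subseteq> Z" "distinct (v # zs')" using zs'(1,2) vZ by auto
    then have lz: "last (v # zs') \<in> Z" using last_in_set[of "v # zs'"] by blast
    have S: "finite (Q - {h} - set ys)" "y \<in> Q - {h} - set ys" "c \<in> Q - {h} - set ys" "y \<noteq> c"
      using xs ys QB(1) finPQ \<open>c \<in> Q\<close> \<open>h \<noteq> c\<close> by auto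
    have "card {y, c} \<le> card (Q - {h} - set ys)" using S by (intro card_mono) auto
    then have "2 \<le> card (Q - {h} - set ys)" using S(4) by simp
    then obtain ms where ms: "distinct (y # ms @ [c])" "set (y # ms @ [c]) \<subseteq> Q - {h} - set ys"
      "length (y # ms @ [c]) = card (Q - {h} - set ys)"
      using obtain_list_with_ends[OF S _ order_refl] by blast
    have "set (y # ms @ [c]) = Q - {h} - set ys"
      using ms S(1) by (intro card_subset_eq) (auto simp: distinct_card simp del: set_append)
    moreover have "b (last (v # zs')) y" using blue[OF lz] xs ys by simp
    ultimately show False
      by (intro wheel[of "v # zs'" ys "y # ms @ [c]"]) (use zsZ zs'(3) xs ys ms(1) t(1) vc in simp_all)
  next
    case False
    \<comment> \<open>Here \<open>t = 4\<close>, and all three vertices of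
      \<open>B - {c} - {h}\<close> serve as separators. Only \<open>c\<close> is left to close the
      rim, between \<open>v'\<close> and \<open>v\<close>.\<close>
    then have s: "Q = B" "j = 4" "card B = 5" using big by auto
    obtain v' where v': "v' \<in> Z" "v' \<noteq> v" "b v' c" using big False c by (auto simp: Z_def)
    have t4: "t = 4" using t s by simp
    have "card (Z - {v} - {v'}) = card Z - 2" using v' vZ finZ by (simp add: card_Diff_subset)
    then have "2 \<le> card (Z - {v} - {v'})" using t t4 by simp
    then obtain zs' where zs': "distinct zs'" "set zs' \<subseteq> Z - {v} - {v'}" "length zs' = 2"
      using obtain_distinct_list[of "Z - {v} - {v'}"] finZ by blast
    have cB: "card (B - {c} - {h}) = 3" using h c finB s by (simp add: card_Diff_subset)
    then obtain xs where xs: "distinct xs" "set xs \<subseteq> B - {c} - {h}" "length xs = 3"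
      using obtain_distinct_list[of "B - {c} - {h}" 3] finB by auto
    then have "set xs = B - {c} - {h}" using cB finB by (intro card_subset_eq) (auto simp: distinct_card)
    then have "set [c] = Q - {h} - set xs" using s h c by auto
    moreover have "w \<in> Z \<and> y' \<in> B - {c}" if "w \<in> set (v # zs' @ [v'])" "y' \<in> set xs" for w y'
      using that zs'(2) xs(2) v'(1) vZ by auto
    then have "viap b (v # zs' @ [v']) xs"
      using blue zs'(3) xs(3) by (intro viap_complete) auto
    ultimately show False
      by (intro wheel[of "v # zs' @ [v']" xs "[c]"]) (use zs' xs v' vZ t4 vc in auto)
  qed
qed

lemma b_clique_wheel:
  assumes S: "b_clique S" "finite V" "S \<subseteq> V" and j: "1 \<le> j" "2 * j < card S"
  shows "\<exists>h\<in>V. has_cycle b {x \<in> V. b h x} (2 * j)"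
proof -
  have finS: "finite S" using S by (auto intro: finite_subset)
  have "S \<noteq> {}" using j by auto
  then obtain h where h: "h \<in> S" by blast
  have "b_clique (S - {h})" using b_clique_mono[OF S(1)] by blast
  then have "has_cycle b (S - {h}) (2 * j)" using b_clique_has_cycle[of "S - {h}" "2 * j"] finS h j by simp
  moreover have "S - {h} \<subseteq> {x \<in> V. b h x}" using S h by (auto simp: b_clique_def)
  ultimately show ?thesis using h S(3) has_cycle_mono by (metis subsetD)
qed

text \<open>By \<open>side_wheel\<close>, neither clique can have more than \<open>j + 1\<close>
  vertices. Since \<open>card A + card B \<ge> 3j - 2\<close>, this leaves only \<open>j = 4\<close>
  with two cliques of 5 vertices that could not be extended. Then there is a further vertex
  \<open>w\<close> outside both, and as it is not red to both cliques, it is blue to all of one of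
  them, which is the exceptional case of \<open>side_wheel\<close>.\<close>

lemma blue_wheel_of_blue_degree:
  assumes V: "finite V" "4 * j + 1 \<le> card V" "v \<in> V" "3 * j \<le> card {x \<in> V. b v x} + 1"
    and kj: "3 \<le> k" "k < j" and nr: "\<not> has_cycle r V (2 * k + 1)"
  shows "\<exists>h\<in>V. has_cycle b {x \<in> V. b h x} (2 * j)"
proof (rule ccontr)
  assume no: "\<not> ?thesis"
  let ?H = "{x \<in> V. b v x}"
  have finH: "finite ?H" using V by simp
  have nrH: "\<not> has_cycle r ?H (2 * k + 1)" using nr has_cycle_mono[of r ?H _ V] by blast
  have nbH: "\<not> has_cycle b ?H (2 * j)" using no V by blast
  obtain A B where AB: "joined ?H A B" "card ?H \<le> card A + card B + 1"
    using joined_structure[OF finH V(4) kj nrH nbH] by blast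
  have jj: "A \<subseteq> ?H" "B \<subseteq> ?H" "A \<inter> B = {}" "b_clique A" "b_clique B" using AB(1) by (auto simp: joined_def)
  have fin: "finite A" "finite B" using jj finH by (auto intro: finite_subset)
  have j: "joined V A B" using AB(1) by (auto simp: joined_def)
  have j': "joined V B A" using j joined_commute by blast
  have small: "card S < 2 * j" if "b_clique S" "S \<subseteq> ?H" "finite S" for S
  proof (rule ccontr)
    assume "\<not> card S < 2 * j"
    then have "has_cycle b S (2 * j)" using b_clique_has_cycle[OF that(1,3)] kj by simp
    then show False using nbH has_cycle_mono that(2) by blast
  qed
  have cAB: "card A < 2 * j" "card B < 2 * j" using small jj fin by blast+
  have sum: "3 * j \<le> card A + card B + 2" using AB(2) V(4) by simp
  have k: "2 \<le> k" "k \<le> card A" "k \<le> card B" using cAB sum kj by linarith+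
  have clique_le: "card S \<le> 2 * j" if S: "b_clique S" "S \<subseteq> V" for S
    using b_clique_wheel[OF S(1) V(1) S(2), of j] no kj by (rule_tac ccontr) simp
  obtain P where P: "extends V A B P" using obtain_extends[OF V(1), of A B] jj by blast
  obtain Q where Q: "extends V B A Q" using obtain_extends[OF V(1), of B A] jj by blast
  have PV: "P \<subseteq> V" "A \<subseteq> P" "b_clique P" and QV: "Q \<subseteq> V" "B \<subseteq> Q" "b_clique Q" using P Q jj by (auto simp: extends_def)
  have cPQ: "card P \<le> 2 * j" "card Q \<le> 2 * j" using clique_le PV QV by blast+
  have finPQ: "finite P" "finite Q" using PV QV V(1) by (auto intro: finite_subset)
  have le: "card A \<le> card P" "card B \<le> card Q" using PV QV finPQ by (auto intro: card_mono)
  have blue: "b v x" if "x \<in> A \<union> B" for x using that jj by blast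
  have v: "v \<in> V - (A \<union> B)" using V(3) blue b_irrefl by blast
  have blue': "b v x" if "x \<in> B \<union> A" for x using that blue by blast
  have v': "v \<in> V - (B \<union> A)" using v by blast
  have fails: False if "j + 1 \<le> card B" "j + 2 \<le> card Q"
    using side_wheel[OF j V(1) k nr P Q _ _ _ V(2) cPQ v blue] that kj sum no by auto
  have fails': False if "j + 1 \<le> card A" "j + 2 \<le> card P"
    using side_wheel[OF j' V(1) k(1,3,2) nr Q P _ _ _ V(2) cPQ(2,1) v' blue'] that kj sum no by auto
  have "card B \<le> j + 1" using fails le(2) by (rule_tac ccontr) simp
  moreover have "card A \<le> j + 1" using fails' le(1) by (rule_tac ccontr) simp
  ultimately have five: "j = 4" "card A = 5" "card B = 5" using sum kj by linarith+
  have "card P \<le> 5" using fails' five by (rule_tac ccontr) simp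
  moreover have "card Q \<le> 5" using fails five by (rule_tac ccontr) simp
  ultimately have "card P = 5" "card Q = 5" using le five by linarith+
  note five = five this
  have eq: "P = A" "Q = B" using five PV QV finPQ by (metis card_subset_eq)+
  have "card (V - P - Q) \<ge> 7"
    using five V(1,2) finPQ PV QV diff_card_le_card_Diff[of P V] diff_card_le_card_Diff[of Q "V - P"] by simp
  then have "card (V - P - Q - {v}) \<ge> 6" by (auto simp: card_Diff_singleton_if)
  then have "V - P - Q - {v} \<noteq> {}" by (metis card.empty not_numeral_le_zero)
  then obtain w where w: "w \<in> V - P - Q" "w \<noteq> v" by blast
  then have wV: "w \<in> V" "w \<notin> A \<union> B" using eq by auto
  show False
  proof (cases "\<forall>x\<in>B. b w x")
    case True
    then show False
      using side_wheel[OF j V(1) k nr P Q _ _ _ V(2) cPQ v blue] five eq w no by auto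
  next
    case False
    then obtain x where x: "x \<in> B" "\<not> b w x" by blast
    then have "w \<noteq> x" using wV(2) by blast
    then have rwx: "r w x" using x(2) total by blast
    have "b w a" if "a \<in> A" for a
    proof -
      have "\<not> r w a" using joined_no_common_red[OF j V(1) k nr wV _ that rwx x(1)] by blast
      moreover have "w \<noteq> a" using wV that by blast
      ultimately show ?thesis using total by blast
    qed
    then show False
      using side_wheel[OF j' V(1) k(1,3,2) nr Q P _ _ _ V(2) cPQ(2,1) v' blue'] five eq w no by auto
  qed
qed

end

section \<open>Longest paths and dense graphs\<close>

lemma cycle_of_map:
  assumes "inj_on p (set idx)" "p ` set idx \<subseteq> S" "idx \<noteq> []" "distinct idx"
    "successively (\<lambda>i j. E (p i) (p j)) idx" "E (p (last idx)) (p (hd idx))"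
  shows "has_cycle E S (length idx)"
  by (rule has_cycleI[of E "map p idx"])
    (use assms in \<open>auto simp: cyc_def successively_map distinct_map last_map hd_map\<close>)

lemma complete_bipartite_cycle:
  assumes "finite A" "finite B" "A \<inter> B = {}" "\<And>x y. x \<in> A \<Longrightarrow> y \<in> B \<Longrightarrow> E x y \<and> E y x"
    "n \<le> card A" "n \<le> card B" "1 \<le> n"
  shows "has_cycle E (A \<union> B) (2 * n)"
proof -
  obtain ws where ws: "distinct ws" "set ws \<subseteq> A" "length ws = n" using obtain_distinct_list[OF assms(1,5)] .
  obtain ys where ys: "distinct ys" "set ys \<subseteq> B" "length ys = n" using obtain_distinct_list[OF assms(2,6)] .
  obtain z zs where z: "ys = z # zs" using ys assms(7) by (cases ys) auto
  have E: "E x y \<and> E y x" if "x \<in> set ws" "y \<in> insert z (set zs)" for x y using assms(4) that ws ys z by auto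
  have "ws \<noteq> []" using ws assms(7) by auto
  moreover have "viap E ws zs" by (rule viap_complete) (use E ws ys z in auto)
  ultimately have "viac E ws zs z" using E ws ys z by (simp add: viac_def)
  then have "has_cycle E (A \<union> B) (2 * length ws)"
    by (rule viac_has_cycle) (use ws ys z assms(3) in auto)
  then show ?thesis using ws by simp
qed

lemma closed_path_cycle:
  assumes "inj_on p {..m}" "p ` {..m} \<subseteq> S" "\<And>i. i < m \<Longrightarrow> E (p i) (p (Suc i))" "E (p m) (p 0)"
  shows "has_cycle E S (length [0..<Suc m])"
proof (rule cycle_of_map)
  have "set [0..<Suc m] = {..m}" by auto
  then show "inj_on p (set [0..<Suc m])" "p ` set [0..<Suc m] \<subseteq> S" using assms(1,2) by metis+
  have "hd [0..<Suc m] = 0" "last [0..<Suc m] = m" by (simp_all del: upt_Suc)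
  then show "E (p (last [0..<Suc m])) (p (hd [0..<Suc m]))" using assms(4) by metis
qed (use assms(3) in \<open>auto simp: successively_upt simp del: upt_Suc\<close>)

definition path_on :: "('a \<Rightarrow> 'a \<Rightarrow> bool) \<Rightarrow> 'a set \<Rightarrow> (nat \<Rightarrow> 'a) \<Rightarrow> nat \<Rightarrow> bool" where
  "path_on E V p m \<longleftrightarrow> inj_on p {..m} \<and> p ` {..m} \<subseteq> V \<and> (\<forall>i<m. E (p i) (p (Suc i)))"

definition max_path :: "('a \<Rightarrow> 'a \<Rightarrow> bool) \<Rightarrow> 'a set \<Rightarrow> (nat \<Rightarrow> 'a) \<Rightarrow> nat \<Rightarrow> bool" where
  "max_path E V p m \<longleftrightarrow> path_on E V p m \<and> (\<forall>q l. path_on E V q l \<longrightarrow> l \<le> m)"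

lemma path_on_less_card: "path_on E V p m \<Longrightarrow> finite V \<Longrightarrow> m < card V"
  using card_inj_on_le[of p "{..m}" V] by (simp add: path_on_def)

lemma obtain_max_path:
  assumes "finite V" "V \<noteq> {}"
  obtains p m where "max_path E V p m"
proof -
  obtain x where "x \<in> V" using assms by blast
  then have "path_on E V (\<lambda>_. x) 0" by (auto simp: path_on_def)
  then have ex: "\<exists>p. path_on E V p 0" by blast
  have "\<exists>m. (\<exists>p. path_on E V p m) \<and> (\<forall>l. (\<exists>p. path_on E V p l) \<longrightarrow> l \<le> m)"
    by (rule ex_has_greatest_nat[of "\<lambda>m. \<exists>p. path_on E V p m" 0 "\<lambda>m. m" "card V"])
      (use ex path_on_less_card[OF _ assms(1)] in auto)
  then show thesis using that unfolding max_path_def by blast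
qed

lemma path_on_reindex:
  assumes "path_on E V p m" "inj_on \<sigma> {..m}" "\<sigma> ` {..m} \<subseteq> {..m}" "\<And>s. s < m \<Longrightarrow> E (p (\<sigma> s)) (p (\<sigma> (Suc s)))"
  shows "path_on E V (\<lambda>s. p (\<sigma> s)) m"
proof -
  have "inj_on p (\<sigma> ` {..m})" using assms(1,3) unfolding path_on_def by (blast intro: inj_on_subset)
  then have "inj_on (p \<circ> \<sigma>) {..m}" by (rule comp_inj_on[OF assms(2)])
  moreover have "(\<lambda>s. p (\<sigma> s)) ` {..m} \<subseteq> V" using assms(1,3) unfolding path_on_def by blast
  ultimately show ?thesis using assms(4) by (simp add: path_on_def comp_def)
qed

lemma path_on_rev:
  assumes "symp E" "path_on E V p m"
  shows "path_on E V (\<lambda>s. p (m - s)) m"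
proof (rule path_on_reindex[OF assms(2)])
  show "E (p (m - s)) (p (m - Suc s))" if "s < m" for s
  proof -
    have h: "m - s = Suc (m - Suc s)" and "m - Suc s < m" using that by auto
    then have "E (p (m - Suc s)) (p (Suc (m - Suc s)))" using assms(2) unfolding path_on_def by blast
    then show ?thesis unfolding h by (rule sympD[OF assms(1)])
  qed
qed (auto simp: inj_on_def)

text \<open>Rotation in the sense of Posa: the edge from \<open>p 0\<close> to \<open>p i\<close>
  allows the segment before \<open>p i\<close> to be reversed. The new first vertex is
  \<open>p (i - 1)\<close>, and the other end is kept.\<close>

lemma path_on_rotate:
  assumes "symp E" "path_on E V p m" "1 \<le> i" "i \<le> m" "E (p 0) (p i)"
  shows "path_on E V (\<lambda>s. p (if s < i then i - 1 - s else s)) m"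
proof (rule path_on_reindex[OF assms(2)])
  show "inj_on (\<lambda>s. if s < i then i - 1 - s else s) {..m}"
    by (rule inj_onI) (auto split: if_splits)
  show "E (p (if s < i then i - 1 - s else s)) (p (if Suc s < i then i - 1 - Suc s else Suc s))" if "s < m" for s
  proof -
    have st: "E (p t) (p (Suc t))" if "t < m" for t using assms(2) that unfolding path_on_def by blast
    consider "Suc s < i" | "Suc s = i" | "i \<le> s" by linarith
    then show ?thesis
    proof cases
      case 1
      then have "i - 1 - s = Suc (i - 1 - Suc s)" by linarith
      moreover have "E (p (i - 1 - Suc s)) (p (Suc (i - 1 - Suc s)))" using st assms(4) 1 by simp
      ultimately show ?thesis using 1 sympD[OF assms(1)] by simp
    next
      case 2
      then show ?thesis using assms(5) by auto
    qed (use st that in auto)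
  qed
qed (use assms in auto)

lemma max_path_rev: "symp E \<Longrightarrow> max_path E V p m \<Longrightarrow> max_path E V (\<lambda>s. p (m - s)) m"
  unfolding max_path_def using path_on_rev by blast

lemma max_path_rotate:
  "symp E \<Longrightarrow> max_path E V p m \<Longrightarrow> 1 \<le> i \<Longrightarrow> i \<le> m \<Longrightarrow> E (p 0) (p i) \<Longrightarrow>
    max_path E V (\<lambda>s. p (if s < i then i - 1 - s else s)) m"
  unfolding max_path_def using path_on_rotate by blast

lemma max_path_no_extension:
  assumes "max_path E V p m" "x \<in> V" "x \<notin> p ` {..m}"
  shows "\<not> E x (p 0)"
proof
  assume e: "E x (p 0)"
  let ?q = "case_nat x p"
  have p: "inj_on p {..m}" "p ` {..m} \<subseteq> V" "\<And>i. i < m \<Longrightarrow> E (p i) (p (Suc i))"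
    using assms(1) by (auto simp: max_path_def path_on_def)
  have "{..Suc m} = insert 0 (Suc ` {..m})" by (rule atMost_Suc_eq_insert_0)
  moreover have "inj_on ?q (Suc ` {..m})" using p(1) by (auto simp: inj_on_def)
  ultimately have "inj_on ?q {..Suc m}" using assms(3) by auto
  moreover have "E (?q i) (?q (Suc i))" if "i < Suc m" for i using that e p(3) by (cases i) auto
  moreover have "?q ` {..Suc m} \<subseteq> V" using p(2) assms(2) by (auto simp: atMost_Suc_eq_insert_0)
  ultimately have "path_on E V ?q (Suc m)" unfolding path_on_def by blast
  then have "Suc m \<le> m" using assms(1) unfolding max_path_def by blast
  then show False by simp
qed

lemma max_path_end_nbr:
  assumes "symp E" "\<And>x. \<not> E x x" "max_path E V p m" "x \<in> V" "E (p 0) x"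
  obtains i where "1 \<le> i" "i \<le> m" "x = p i"
proof -
  have "x \<in> p ` {..m}" using max_path_no_extension[OF assms(3,4)] assms(5) sympD[OF assms(1)] by blast
  then obtain i where i: "i \<le> m" "x = p i" by blast
  then have "i \<noteq> 0" using assms(2,5) by metis
  then show thesis using that[of i] i by simp
qed

text \<open>The closed path is a cycle; cut open just before \<open>p t\<close>, it becomes a
  longest path that begins with \<open>p t\<close>.\<close>

lemma max_path_closed:
  assumes E: "symp E" and p: "max_path E V p m" and e: "E (p 0) (p m)" and w: "w \<in> V" "w \<notin> p ` {..m}" and t: "t \<le> m"
  shows "\<not> E w (p t)"
proof -
  let ?\<sigma> = "\<lambda>s. if s \<le> m - t then t + s else s - (m - t) - 1"
  have pp: "path_on E V p m" using p by (simp add: max_path_def)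
  have st: "E (p i) (p (Suc i))" if "i < m" for i using pp that unfolding path_on_def by blast
  have "path_on E V (\<lambda>s. p (?\<sigma> s)) m"
  proof (rule path_on_reindex[OF pp])
    show "inj_on ?\<sigma> {..m}" by (rule inj_onI) (use t in \<open>auto split: if_splits\<close>)
    show "?\<sigma> ` {..m} \<subseteq> {..m}" using t by auto
    show "E (p (?\<sigma> s)) (p (?\<sigma> (Suc s)))" if "s < m" for s
    proof -
      consider "s < m - t" | "s = m - t" | "m - t < s" by linarith
      then show ?thesis
      proof cases
        case 1
        then show ?thesis using st[of "t + s"] by simp
      next
        case 2
        then show ?thesis using t sympD[OF E e] by simp
      next
        case 3
        then have h: "Suc s - (m - t) - 1 = Suc (s - (m - t) - 1)" by simp
        have "s - (m - t) - 1 < m" using that by simp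
        then show ?thesis using st 3 h by simp
      qed
    qed
  qed
  then have m: "max_path E V (\<lambda>s. p (?\<sigma> s)) m" using p by (simp add: max_path_def)
  have "?\<sigma> s \<in> {..m}" if "s \<in> {..m}" for s using that t by auto
  then have "w \<notin> (\<lambda>s. p (?\<sigma> s)) ` {..m}" using w(2) by blast
  then show ?thesis using max_path_no_extension[OF m w(1)] by simp
qed

text \<open>Dirac's theorem. By the degrees of the two ends of a longest path some
  \<open>p i\<close> is adjacent to \<open>p 0\<close> while \<open>p (i - 1)\<close> is adjacent to
  \<open>p m\<close>, so a rotation closes the path. A vertex off the closed path has no neighbour
  on it, and too few vertices remain for its degree.\<close>

lemma dirac_hamiltonian_cycle:
  assumes E: "symp E" "\<And>x. \<not> E x x" and V: "finite V" "3 \<le> card V"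
    and deg: "\<And>v. v \<in> V \<Longrightarrow> card V \<le> 2 * card {x \<in> V. E v x}"
  shows "has_cycle E V (card V)"
proof -
  have "V \<noteq> {}" using V by auto
  then obtain p m where p: "max_path E V p m" using obtain_max_path[OF V(1)] by blast
  have q: "max_path E V (\<lambda>s. p (m - s)) m" using max_path_rev[OF E(1) p] .
  have pp: "inj_on p {..m}" "p ` {..m} \<subseteq> V" "\<And>i. i < m \<Longrightarrow> E (p i) (p (Suc i))"
    using p by (auto simp: max_path_def path_on_def)
  have mV: "m < card V" using p V path_on_less_card by (auto simp: max_path_def)
  define I where "I = {i \<in> {1..m}. E (p 0) (p i)}"
  define J where "J = {i \<in> {..<m}. E (p m) (p i)}"
  have "{x \<in> V. E (p 0) x} \<subseteq> p ` I"
    using max_path_end_nbr[OF E p] by (force simp: I_def)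
  then have "card {x \<in> V. E (p 0) x} \<le> card I" using surj_card_le[of I _ p] by (simp add: I_def)
  then have cI: "card V \<le> 2 * card I" using deg[of "p 0"] pp(2) by force
  have "{x \<in> V. E (p m) x} \<subseteq> p ` J"
  proof
    fix x assume "x \<in> {x \<in> V. E (p m) x}"
    then obtain i where i: "1 \<le> i" "i \<le> m" "x = p (m - i)" "E (p m) x" using max_path_end_nbr[OF E q, of x] by auto
    then have "m - i \<in> J" by (auto simp: J_def)
    then show "x \<in> p ` J" using i by blast
  qed
  then have "card {x \<in> V. E (p m) x} \<le> card J" using surj_card_le[of J _ p] by (simp add: J_def)
  then have cJ: "card V \<le> 2 * card J" using deg[of "p m"] pp(2) by force
  have "\<exists>i\<in>I. i - 1 \<in> J"
  proof (rule ccontr)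
    assume "\<not> ?thesis"
    then have d: "(\<lambda>i. i - 1) ` I \<inter> J = {}" by blast
    have "inj_on (\<lambda>i. i - 1) I" by (auto simp: inj_on_def I_def)
    then have "card ((\<lambda>i. i - 1) ` I) = card I" by (rule card_image)
    moreover have "card ((\<lambda>i. i - 1) ` I \<union> J) \<le> card {..<m}" by (rule card_mono) (auto simp: I_def J_def)
    moreover have "card ((\<lambda>i. i - 1) ` I \<union> J) = card ((\<lambda>i. i - 1) ` I) + card J"
      by (rule card_Un_disjoint[OF _ _ d]) (auto simp: I_def J_def)
    ultimately show False using cI cJ mV by simp
  qed
  then obtain i where i: "1 \<le> i" "i \<le> m" "E (p 0) (p i)" "E (p m) (p (i - 1))" by (auto simp: I_def J_def)
  define q where "q = (\<lambda>s. p (if s < i then i - 1 - s else s))"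
  have mq: "max_path E V q m" unfolding q_def by (rule max_path_rotate[OF E(1) p i(1-3)])
  have ends: "E (q 0) (q m)" using i sympD[OF E(1) i(4)] by (simp add: q_def)
  have qq: "inj_on q {..m}" "q ` {..m} \<subseteq> V" "\<And>i. i < m \<Longrightarrow> E (q i) (q (Suc i))"
    using mq by (auto simp: max_path_def path_on_def)
  have "has_cycle E V (length [0..<Suc m])"
    by (rule closed_path_cycle) (use qq sympD[OF E(1) ends] in auto)
  moreover have "m + 1 = card V"
  proof (rule ccontr)
    assume ne: "m + 1 \<noteq> card V"
    have cq: "card (q ` {..m}) = m + 1" using card_image[OF qq(1)] by simp
    have "q ` {..m} \<noteq> V" using cq ne by metis
    then obtain w where w: "w \<in> V" "w \<notin> q ` {..m}" using qq(2) by blast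
    have "\<not> E w x" if "x \<in> q ` {..m}" for x
      using max_path_closed[OF E(1) mq ends w] that by auto
    then have "{x \<in> V. E w x} \<subseteq> V - q ` {..m} - {w}" using E(2) by blast
    then have "card {x \<in> V. E w x} \<le> card (V - q ` {..m} - {w})" using V by (intro card_mono) auto
    also have "\<dots> = card V - (m + 1) - 1" using w V qq(2) cq by (simp add: card_Diff_subset)
    finally have "card V \<le> 2 * (card V - (m + 1) - 1)" using deg[OF w(1)] by linarith
    moreover have "card I \<le> card {1..m}" by (rule card_mono) (auto simp: I_def)
    ultimately show False using cI V mV by simp
  qed
  ultimately show ?thesis by simp
qed

text \<open>Bondy's argument: the two edges at a pair of consecutive vertices of a Hamiltonian cycle that
  would close a cycle of length \<open>l\<close> are never both present.\<close>

lemma consecutive_degree_sum: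
  assumes E: "symp E" "\<And>x. \<not> E x x" and n: "card V = n" "finite V" and f: "cfun E f n" "range f \<subseteq> V"
    and l: "3 \<le> l" "l < n" "\<not> has_cycle E V l"
  shows "card {x \<in> V. E (f 0) x} + card {x \<in> V. E (f (n - 1)) x} \<le> n"
proof -
  have inj: "inj_on f {..<n}" using f(1) by (auto simp: inj_on_def cfun_def)
  have im: "f ` {..<n} = V"
    using f(2) n card_image[OF inj] by (intro card_subset_eq) auto
  define I where "I = {i \<in> {1..n - 2}. E (f 0) (f i)}"
  define J where "J = {i \<in> {1..n - 2}. E (f (n - 1)) (f i)}"
  \<comment> \<open>The neighbours \<open>f i\<close> of \<open>f 0\<close> and
    \<open>f (\<phi> i)\<close> of \<open>f (n - 1)\<close> close a cycle with \<open>l\<close>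
    vertices: \<open>0, i, ..., i + l - 3, n - 1\<close> if \<open>i\<close> is small, and otherwise
    \<open>0, ..., \<phi> i, n - 1, ..., i\<close>.\<close>
  define \<phi> where "\<phi> i = (if i \<le> n - l + 1 then i + l - 3 else i - (n + 1 - l))" for i
  have inj\<phi>: "inj_on \<phi> {1..n - 2}"
    by (rule inj_onI) (use l in \<open>auto simp: \<phi>_def split: if_splits\<close>)
  have \<phi>: "\<phi> ` I \<subseteq> {1..n - 2}" using l by (auto simp: \<phi>_def I_def)
  have st: "E (f i) (f (Suc i))" for i using f(1) by (simp add: cfun_def)
  have st': "E (f (Suc i)) (f i)" for i using sympD[OF E(1) st] .
  have "E (f (n - 1)) (f (Suc (n - 1)))" by (rule st)
  then have wrap: "E (f (n - 1)) (f 0)" using l cfun_period[OF f(1), of 0] by simp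
  have "\<not> E (f (n - 1)) (f (\<phi> i))" if i: "i \<in> I" for i
  proof
    assume e: "E (f (n - 1)) (f (\<phi> i))"
    have e': "E (f (\<phi> i)) (f (n - 1))" using sympD[OF E(1) e] .
    have i': "1 \<le> i" "i \<le> n - 2" "E (f 0) (f i)" using i by (auto simp: I_def)
    show False
    proof (cases "i \<le> n - l + 1")
      case True
      define idx where "idx = 0 # [i..<i + l - 2] @ [n - 1]"
      have ne: "[i..<i + l - 2] \<noteq> []" and hl: "hd [i..<i + l - 2] = i" "last [i..<i + l - 2] = i + l - 3"
        using l by auto
      have "has_cycle E V (length idx)"
      proof (rule cycle_of_indices[OF f])
        show "successively (\<lambda>i j. E (f i) (f j)) idx"
          using i'(3) e' st ne hl True
          by (simp add: idx_def successively_Cons successively_append_iff successively_upt hd_append \<phi>_def)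
      qed (use i' True l wrap in \<open>auto simp: idx_def\<close>)
      moreover have "length idx = l" using l by (simp add: idx_def)
      ultimately show False using l(3) by simp
    next
      case False
      define idx where "idx = [0..<\<phi> i + 1] @ rev [i..<n]"
      have p: "\<phi> i = i - (n + 1 - l)" using False by (simp add: \<phi>_def)
      have ne: "[i..<n] \<noteq> []" "hd [i..<n] = i" "last [i..<n] = n - 1"
        "[0..<\<phi> i + 1] \<noteq> []" "hd [0..<\<phi> i + 1] = 0" "last [0..<\<phi> i + 1] = \<phi> i" using i' by (auto simp del: upt_Suc)
      have "has_cycle E V (length idx)"
      proof (rule cycle_of_indices[OF f])
        show "successively (\<lambda>i j. E (f i) (f j)) idx"
          using st st' e' ne
          by (simp add: idx_def successively_append_iff successively_upt hd_rev del: upt_Suc)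
        show "E (f (last idx)) (f (hd idx))" using ne sympD[OF E(1) i'(3)] by (simp add: idx_def last_rev del: upt_Suc)
        show "idx \<noteq> []" "distinct idx" "set idx \<subseteq> {..<n}" using i' p False l by (auto simp: idx_def)
      qed
      moreover have "length idx = l" using i' l p False by (simp add: idx_def)
      ultimately show False using l(3) by simp
    qed
  qed
  then have disj: "\<phi> ` I \<inter> J = {}" by (auto simp: J_def)
  have "card (\<phi> ` I \<union> J) \<le> card {1..n - 2}" using \<phi> by (intro card_mono) (auto simp: J_def)
  moreover have "card (\<phi> ` I \<union> J) = card (\<phi> ` I) + card J"
    by (rule card_Un_disjoint[OF _ _ disj]) (auto simp: I_def J_def)
  moreover have "I \<subseteq> {1..n - 2}" by (auto simp: I_def)
  then have "card (\<phi> ` I) = card I" using inj_on_subset[OF inj\<phi>] card_image by blast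
  ultimately have IJ: "card I + card J \<le> n - 2" by simp
  have "{x \<in> V. E (f 0) x} \<subseteq> f ` insert (n - 1) I"
  proof
    fix x assume x: "x \<in> {x \<in> V. E (f 0) x}"
    then obtain i where i: "i < n" "x = f i" using im by blast
    then have "i \<noteq> 0" using x E(2) by (metis mem_Collect_eq)
    then have "i = n - 1 \<or> i \<in> I" using i x by (auto simp: I_def)
    then show "x \<in> f ` insert (n - 1) I" using i by blast
  qed
  then have "card {x \<in> V. E (f 0) x} \<le> card (insert (n - 1) I)" by (rule surj_card_le[rotated]) (simp add: I_def)
  then have "card {x \<in> V. E (f 0) x} \<le> card I + 1" using card_insert_le_m1[of "card I + 1" I "n - 1"] by (simp add: card_insert_if I_def split: if_splits)
  moreover have "{x \<in> V. E (f (n - 1)) x} \<subseteq> f ` insert 0 J"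
  proof
    fix x assume x: "x \<in> {x \<in> V. E (f (n - 1)) x}"
    then obtain i where i: "i < n" "x = f i" using im by blast
    then have "i \<noteq> n - 1" using x E(2) by (metis mem_Collect_eq)
    then have "i = 0 \<or> i \<in> J" using i x by (auto simp: J_def)
    then show "x \<in> f ` insert 0 J" using i by blast
  qed
  then have "card {x \<in> V. E (f (n - 1)) x} \<le> card (insert 0 J)" by (rule surj_card_le[rotated]) (simp add: J_def)
  then have "card {x \<in> V. E (f (n - 1)) x} \<le> card J + 1" by (simp add: card_insert_if J_def split: if_splits)
  ultimately show ?thesis using IJ l by simp
qed

text \<open>There is a Hamiltonian cycle by Dirac's theorem, and the missing length bounds the
  degree sum of any two consecutive vertices on it by \<open>card V\<close>. Each of them
  contributes at least half, so equality holds everywhere.\<close>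

lemma dense_degree:
  assumes E: "symp E" "\<And>x. \<not> E x x" and V: "finite V"
    and deg: "\<And>v. v \<in> V \<Longrightarrow> card V \<le> 2 * card {x \<in> V. E v x}"
    and l: "3 \<le> l" "l < card V" "\<not> has_cycle E V l" and a: "a \<in> V"
  shows "2 * card {x \<in> V. E a x} = card V"
proof -
  have "has_cycle E V (card V)" using dirac_hamiltonian_cycle[OF E V _ deg] l by simp
  then obtain f where f: "cfun E f (card V)" "range f \<subseteq> V" using has_cycle_cfun by metis
  have inj: "inj_on f {..<card V}" using f(1) by (auto simp: inj_on_def cfun_def)
  have "f ` {..<card V} = V" using f(2) V card_image[OF inj] by (intro card_subset_eq) auto
  then obtain i where i: "a = f i" using a by blast
  have g: "cfun E (\<lambda>t. f (t + i)) (card V)" "range (\<lambda>t. f (t + i)) \<subseteq> V" using cfun_shift[OF f(1)] f(2) by auto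
  have "card {x \<in> V. E (f (0 + i)) x} + card {x \<in> V. E (f (card V - 1 + i)) x} \<le> card V"
    by (rule consecutive_degree_sum[OF E refl V g l])
  moreover have "f (card V - 1 + i) \<in> V" using f(2) by blast
  ultimately show ?thesis using deg[OF a] deg[of "f (card V - 1 + i)"] by (simp add: i)
qed

context two_coloring
begin

text \<open>Let \<open>S\<close> and \<open>T\<close> be the two sets of end vertices that arise by rotating a longest red path at either end. Without a
  long red cycle they are joined completely in blue, and some vertex is joined to all of them in blue.\<close>

lemma long_red_cycle:
  assumes V: "finite V" "4 * j + 1 \<le> card V" and k: "1 \<le> k" "k < j"
    and deg: "\<And>v. v \<in> V \<Longrightarrow> j + 2 \<le> card {x \<in> V. r v x}"
    and conn: "\<And>A. A \<subseteq> V \<Longrightarrow> A \<noteq> {} \<Longrightarrow> A \<noteq> V \<Longrightarrow> \<exists>x\<in>A. \<exists>y\<in>V - A. r x y"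
    and nw: "\<And>h. h \<in> V \<Longrightarrow> \<not> has_cycle b {x \<in> V. b h x} (2 * j)"
  shows "\<exists>l\<ge>2 * k + 1. has_cycle r V l"
proof (rule ccontr)
  assume "\<not> ?thesis"
  then have nc: "\<And>l. 2 * k + 1 \<le> l \<Longrightarrow> \<not> has_cycle r V l" by blast
  have "V \<noteq> {}" using V by auto
  then obtain p m where p: "max_path r V p m" using obtain_max_path[OF V(1)] by blast
  have inj: "inj_on q {..m}" and sub: "q ` {..m} \<subseteq> V" and st: "\<And>i. i < m \<Longrightarrow> r (q i) (q (Suc i))"
    if "max_path r V q m" for q using that by (auto simp: max_path_def path_on_def)
  have mV: "m < card V" using p V path_on_less_card by (auto simp: max_path_def)
  have bound: "i + 1 \<le> 2 * k" if q: "max_path r V q m" and i: "i \<le> m" "r (q 0) (q i)" for q i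
  proof (rule ccontr)
    assume "\<not> i + 1 \<le> 2 * k"
    moreover have "has_cycle r V (length [0..<Suc i])"
    proof (rule closed_path_cycle)
      show "inj_on q {..i}" using inj[OF q] i by (auto intro: inj_on_subset)
      show "q ` {..i} \<subseteq> V" using sub[OF q] i by auto
    qed (use st[OF q] i r_symD in auto)
    ultimately show False using nc[of "Suc i"] by simp
  qed
  \<comment> \<open>A closed longest path would be a red cycle, hence have at most \<open>2k\<close>
    vertices, and connectedness would supply an edge leaving it.\<close>
  have no_close: "\<not> r (q 0) (q m)" if q: "max_path r V q m" for q
  proof
    assume e: "r (q 0) (q m)"
    have "card (q ` {..m}) = m + 1" using card_image[OF inj[OF q]] by simp
    moreover have "m + 1 < card V" using bound[OF q order_refl e] V k by linarith
    ultimately have "q ` {..m} \<noteq> V" by auto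
    then obtain x y where xy: "x \<in> q ` {..m}" "y \<in> V - q ` {..m}" "r x y" using conn[OF sub[OF q]] by blast
    then show False using max_path_closed[OF r_sym q e, of y] r_symD by blast
  qed
  define I where "I q = {i \<in> {1..m}. r (q 0) (q i)}" for q :: "nat \<Rightarrow> 'a"
  have finI: "finite (I q)" for q by (simp add: I_def)
  have cI: "j + 2 \<le> card (I q)" if q: "max_path r V q m" for q
  proof -
    have "{x \<in> V. r (q 0) x} \<subseteq> q ` I q"
      using max_path_end_nbr[OF r_sym r_irrefl q] by (force simp: I_def)
    then have "card {x \<in> V. r (q 0) x} \<le> card (I q)" by (rule surj_card_le[OF finI])
    moreover have "q 0 \<in> V" using sub[OF q] by auto
    ultimately show ?thesis using deg[of "q 0"] by linarith
  qed
  define rot where "rot i q = (\<lambda>s. q (if s < i then i - 1 - s else s))" for i and q :: "nat \<Rightarrow> 'a"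
  have rot: "max_path r V (rot i q) m" if "max_path r V q m" "i \<in> I q" for i q
    unfolding rot_def by (rule max_path_rotate[OF r_sym that(1)]) (use that(2) in \<open>auto simp: I_def\<close>)
  \<comment> \<open>Each rotation produces another longest path, to which \<open>bound\<close>
    applies; so the red neighbours of the new ends also lie among the first \<open>2k\<close>
    vertices.\<close>
  have near: "\<exists>s\<le>m. s + 1 \<le> 2 * k \<and> y = q s"
    if q: "max_path r V q m" and i: "i \<in> I q" and y: "y \<in> V" "r (q (i - 1)) y" for q i y
  proof -
    have "i \<le> m" "1 \<le> i" "i + 1 \<le> 2 * k" using i bound[OF q, of i] by (auto simp: I_def)
    moreover have r0: "r (rot i q 0) y" using y(2) \<open>1 \<le> i\<close> by (simp add: rot_def)
    obtain s where s: "1 \<le> s" "s \<le> m" "y = rot i q s"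
      using max_path_end_nbr[OF r_sym r_irrefl rot[OF q i] y(1) r0] by blast
    moreover have "s + 1 \<le> 2 * k" using bound[OF rot[OF q i] s(2)] r0 s(3) by simp
    ultimately show ?thesis by (intro exI[of _ "if s < i then i - 1 - s else s"]) (auto simp: rot_def)
  qed
  define q where "q = (\<lambda>s. p (m - s))"
  have q: "max_path r V q m" unfolding q_def by (rule max_path_rev[OF r_sym p])
  \<comment> \<open>The condition \<open>i \<le> m - i'\<close> keeps the reversed segments apart,
    so rotations at both ends can be combined, and \<open>no_close\<close> applies to the two new
    ends.\<close>
  have far: "\<not> r (p (i - 1)) (q (i' - 1))" if i: "i \<in> I p" "i' \<in> I q" "i \<le> m - i'" for i i'
  proof
    assume e: "r (p (i - 1)) (q (i' - 1))"
    have h: "1 \<le> i" "i \<le> m" "1 \<le> i'" "i' \<le> m" "r (p m) (p (m - i'))" using i by (auto simp: I_def q_def)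
    define p1 where "p1 = (\<lambda>s. rot i p (m - s))"
    have p1: "max_path r V p1 m" unfolding p1_def by (rule max_path_rev[OF r_sym rot[OF p i(1)]])
    have "i' \<in> I p1" using h i(3) by (auto simp: I_def p1_def rot_def)
    then have "\<not> r (rot i' p1 0) (rot i' p1 m)" using no_close rot[OF p1] by blast
    moreover have "rot i' p1 0 = q (i' - 1)" "rot i' p1 m = p (i - 1)"
      using h i(3) by (auto simp: rot_def p1_def q_def)
    ultimately show False using r_symD[OF e] by simp
  qed
  define J where "J = {l \<in> {..<m}. r (p m) (p l)}"
  have IqJ: "m - i \<in> J" if "i \<in> I q" for i using that by (auto simp: I_def J_def q_def)
  have cJ: "j + 2 \<le> card J"
  proof -
    have "inj_on (\<lambda>i. m - i) (I q)" by (rule inj_onI) (auto simp: I_def)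
    moreover have "(\<lambda>i. m - i) ` I q \<subseteq> J" using IqJ by blast
    ultimately have "card (I q) \<le> card J" by (rule card_inj_on_le) (simp add: J_def)
    then show ?thesis using cI[OF q] by simp
  qed
  have pred: "i - 1 \<notin> J" if i: "i \<in> I p" for i
  proof
    assume "i - 1 \<in> J"
    then have "r (rot i p 0) (rot i p m)" using i r_symD by (auto simp: rot_def I_def J_def)
    then show False using no_close rot[OF p i] by blast
  qed
  have ordered: "i \<le> l" if il: "i \<in> I p" "l \<in> J" for i l
  proof (rule ccontr)
    assume "\<not> i \<le> l"
    then have "\<exists>d i l. i \<in> I p \<and> l \<in> J \<and> l < i \<and> d = i - l"
      using il by (intro exI[of _ "i - l"] exI[of _ i] exI[of _ l]) simp
    then obtain d where d: "\<exists>i l. i \<in> I p \<and> l \<in> J \<and> l < i \<and> d = i - l"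
      "\<And>d'. d' < d \<Longrightarrow> \<not> (\<exists>i l. i \<in> I p \<and> l \<in> J \<and> l < i \<and> d' = i - l)"
      \<comment> \<open>A crossing pair with smallest gap is chosen. The cycle
        \<open>0, ..., l, m, ..., i\<close> leaves out only the vertices strictly between
        \<open>l\<close> and \<open>i\<close>; it contains all neighbours of \<open>p m\<close> and,
        for every neighbour of \<open>p 0\<close> except \<open>p i\<close>, the vertex preceding it
        on the path. By \<open>pred\<close> these two sets are disjoint, so the cycle has more than
        \<open>2k\<close> vertices.\<close>
      using exists_least_iff[of "\<lambda>d. \<exists>i l. i \<in> I p \<and> l \<in> J \<and> l < i \<and> d = i - l"] by blast
    then obtain i l where il: "i \<in> I p" "l \<in> J" "l < i" "d = i - l" by blast
    have min: "i - l \<le> i' - l'" if "i' \<in> I p" "l' \<in> J" "l' < i'" for i' l'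
    proof (rule ccontr)
      assume "\<not> ?thesis"
      then have "i' - l' < d" using il(4) by simp
      then show False using d(2) that by blast
    qed
    have "l \<noteq> i - 1" using pred[OF il(1)] il(2) by blast
    then have li: "l + 2 \<le> i" using il(3) by linarith
    have h: "i \<le> m" "r (p 0) (p i)" "r (p m) (p l)" using il by (auto simp: I_def J_def)
    define idx where "idx = [0..<l + 1] @ rev [i..<m + 1]"
    have ne: "[i..<m + 1] \<noteq> []" "hd [i..<m + 1] = i" "last [i..<m + 1] = m"
      "[0..<l + 1] \<noteq> []" "hd [0..<l + 1] = 0" "last [0..<l + 1] = l" using h by (simp_all del: upt_Suc)
    have set_idx: "set idx = {..l} \<union> {i..m}" by (auto simp: idx_def)
    have dist: "distinct idx" using il(3) by (auto simp: idx_def)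
    have "has_cycle r V (length idx)"
    proof (rule cycle_of_map[of p, OF _ _ _ dist])
      have "set idx \<subseteq> {..m}" using set_idx il(3) h(1) by auto
      then show "inj_on p (set idx)" "p ` set idx \<subseteq> V" using inj[OF p] sub[OF p] by (auto intro: inj_on_subset)
      have "successively (\<lambda>i j. r (p i) (p j)) [0..<l + 1]" "successively (\<lambda>i j. r (p i) (p j)) (rev [i..<m + 1])"
        using st[OF p] r_symD il(3) h(1) by (auto simp: successively_upt simp del: upt_Suc)
      then show "successively (\<lambda>i j. r (p i) (p j)) idx"
        using ne r_symD[OF h(3)] by (simp add: idx_def successively_append_iff hd_rev del: upt_Suc successively_rev)
      show "r (p (last idx)) (p (hd idx))" using ne r_symD[OF h(2)] by (simp add: idx_def last_rev del: upt_Suc)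
    qed (simp add: idx_def)
    then have "length idx \<le> 2 * k" using nc[of "length idx"] by linarith
    then have cidx: "card (set idx) \<le> 2 * k" using distinct_card[OF dist] by simp
    let ?I' = "(\<lambda>s. s - 1) ` (I p - {i})"
    have "s - 1 \<le> l \<or> i \<le> s - 1" if s: "s \<in> I p" "s \<noteq> i" for s
    proof (rule ccontr)
      assume "\<not> ?thesis"
      then have "l < s" "s < i" using s by linarith+
      then show False using min[OF s(1) il(2)] by linarith
    qed
    moreover have "s - 1 \<le> m" if "s \<in> I p" for s using that by (auto simp: I_def)
    ultimately have "?I' \<subseteq> set idx" unfolding set_idx by fastforce
    moreover have "l' \<le> l \<or> i \<le> l'" if l': "l' \<in> J" for l'
    proof (rule ccontr)
      assume "\<not> ?thesis"
      then show False using min[OF il(1) l'] by linarith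
    qed
    then have "l' \<in> set idx" if "l' \<in> J" for l' using that unfolding set_idx by (fastforce simp: J_def)
    then have "J \<subseteq> set idx" by blast
    ultimately have "card (?I' \<union> insert m J) \<le> card (set idx)" using h(1) by (intro card_mono) (auto simp: set_idx)
    moreover have "?I' \<inter> insert m J = {}" using pred by (auto simp: I_def)
    then have "card (?I' \<union> insert m J) = card ?I' + card (insert m J)"
      using finI by (intro card_Un_disjoint) (auto simp: J_def)
    moreover have "card ?I' = card (I p) - 1"
    proof -
      have "inj_on (\<lambda>s. s - 1) (I p - {i})" by (rule inj_onI) (auto simp: I_def)
      then show ?thesis using card_image il(1) finI by fastforce
    qed
    moreover have "card (insert m J) = card J + 1" by (simp add: J_def)
    ultimately show False using cI[OF p] cJ cidx k by linarith
  qed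
  define S where "S = (\<lambda>i. p (i - 1)) ` I p"
  define T where "T = (\<lambda>i. q (i - 1)) ` I q"
  have cS: "j \<le> card S"
  proof -
    have "inj_on (\<lambda>i. p (i - 1)) (I p)" by (rule inj_onI) (auto simp: I_def dest!: inj_onD[OF inj[OF p]])
    then show ?thesis using card_image cI[OF p] unfolding S_def by fastforce
  qed
  have cT: "j \<le> card T"
  proof -
    have "inj_on (\<lambda>i. q (i - 1)) (I q)" by (rule inj_onI) (auto simp: I_def dest!: inj_onD[OF inj[OF q]])
    then show ?thesis using card_image cI[OF q] unfolding T_def by fastforce
  qed
  have ST: "x \<noteq> y \<and> b x y \<and> b y x" if xy: "x \<in> S" "y \<in> T" for x y
  proof -
    obtain i i' where i: "i \<in> I p" "i' \<in> I q" "x = p (i - 1)" "y = q (i' - 1)" using xy by (auto simp: S_def T_def)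
    have le: "i \<le> m - i'" using ordered[OF i(1) IqJ[OF i(2)]] .
    have h: "1 \<le> i" "i \<le> m" "1 \<le> i'" "i' \<le> m" using i by (auto simp: I_def)
    have "x \<noteq> y"
    proof
      assume "x = y"
      then have "p (i - 1) = p (m - (i' - 1))" using i by (simp add: q_def)
      then have "i - 1 = m - (i' - 1)" using inj_onD[OF inj[OF p]] h by simp
      then show False using le h by linarith
    qed
    moreover have "\<not> r x y" using far[OF i(1,2) le] i by simp
    ultimately show ?thesis using total b_symD by blast
  qed
  define X where "X = p ` {s. s \<le> m \<and> s + 1 \<le> 2 * k}"
  define Y where "Y = q ` {s. s \<le> m \<and> s + 1 \<le> 2 * k}"
  have SX: "S \<subseteq> X" using bound[OF p] by (fastforce simp: S_def X_def I_def)
  have TY: "T \<subseteq> Y" using bound[OF q] by (fastforce simp: T_def Y_def I_def)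
  \<comment> \<open>The first \<open>2k\<close> vertices from either end are at most
    \<open>4k < 4j + 1\<close> vertices together. By \<open>near\<close>, a vertex outside them is
    blue to all of \<open>S\<close> and \<open>T\<close> and can serve as hub.\<close>
  have "\<exists>w\<in>V. w \<notin> X \<union> Y"
  proof -
    have "card X \<le> 2 * k" unfolding X_def
      by (rule le_trans[OF card_image_le]) (auto intro: le_trans[OF card_mono[of "{..<2 * k}"]])
    moreover have "card Y \<le> 2 * k" unfolding Y_def
      by (rule le_trans[OF card_image_le]) (auto intro: le_trans[OF card_mono[of "{..<2 * k}"]])
    ultimately have "card (X \<union> Y) < card V" using card_Un_le[of X Y] V k by linarith
    moreover have "finite (X \<union> Y)" by (simp add: X_def Y_def)
    ultimately show ?thesis using card_mono[of "X \<union> Y" V] by (meson linorder_not_le subsetI)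
  qed
  then obtain w where w: "w \<in> V" "w \<notin> X" "w \<notin> Y" by blast
  have "b w x" if "x \<in> S" for x
  proof -
    obtain i where i: "i \<in> I p" "x = p (i - 1)" using \<open>x \<in> S\<close> by (auto simp: S_def)
    have "\<not> r x w" using near[OF p i(1) w(1)] w(2) i(2) by (auto simp: X_def)
    moreover have "x \<noteq> w" using SX that w by blast
    ultimately show ?thesis using total b_symD by blast
  qed
  moreover have "b w y" if "y \<in> T" for y
  proof -
    obtain i where i: "i \<in> I q" "y = q (i - 1)" using \<open>y \<in> T\<close> by (auto simp: T_def)
    have "\<not> r y w" using near[OF q i(1) w(1)] w(3) i(2) by (auto simp: Y_def)
    moreover have "y \<noteq> w" using TY that w by blast
    ultimately show ?thesis using total b_symD by blast
  qed
  moreover have "X \<subseteq> V" "Y \<subseteq> V" using sub[OF p] sub[OF q] by (auto simp: X_def Y_def)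
  ultimately have sub: "S \<union> T \<subseteq> {x \<in> V. b w x}" using SX TY by blast
  have "has_cycle b (S \<union> T) (2 * j)"
    by (rule complete_bipartite_cycle) (use ST cS cT k finI in \<open>auto simp: S_def T_def\<close>)
  then show False using nw[OF w(1)] has_cycle_mono sub by blast
qed


section \<open>Two-connectedness of the red graph\<close>

lemma degree_sum:
  assumes "finite V" "v \<in> V"
  shows "card {x \<in> V. r v x} + card {x \<in> V. b v x} + 1 = card V"
proof -
  have "x = v \<or> r v x \<or> b v x" for x using total[of v x] by auto
  then have eq: "insert v ({x \<in> V. r v x} \<union> {x \<in> V. b v x}) = V" using assms(2) by auto
  have "card ({x \<in> V. r v x} \<union> {x \<in> V. b v x}) = card {x \<in> V. r v x} + card {x \<in> V. b v x}"
    using assms(1) exclusive by (intro card_Un_disjoint) auto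
  moreover have "v \<notin> {x \<in> V. r v x} \<union> {x \<in> V. b v x}" using r_irrefl b_irrefl by blast
  moreover have "finite ({x \<in> V. r v x} \<union> {x \<in> V. b v x})" using assms(1) by simp
  ultimately have "card (insert v ({x \<in> V. r v x} \<union> {x \<in> V. b v x})) = card {x \<in> V. r v x} + card {x \<in> V. b v x} + 1"
    by (simp del: Un_iff)
  then show ?thesis unfolding eq by (rule sym)
qed

text \<open>Otherwise \<open>j\<close> blue neighbours of \<open>a\<close> in \<open>A\<close>
  alternate with \<open>j\<close> vertices of \<open>B\<close>, all of which are blue to
  \<open>a\<close>, and form the rim of a wheel with hub \<open>a\<close>.\<close>

lemma hub_degree_in_side:
  assumes "finite V" "A \<subseteq> V" "B \<subseteq> V" "A \<inter> B = {}" "\<And>x y. x \<in> A \<Longrightarrow> y \<in> B \<Longrightarrow> b x y" "1 \<le> j" "j \<le> card B"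
    and nw: "\<And>h. h \<in> V \<Longrightarrow> \<not> has_cycle b {x \<in> V. b h x} (2 * j)" and a: "a \<in> A"
  shows "card {x \<in> A. b a x} < j"
proof (rule ccontr)
  assume "\<not> ?thesis"
  then have "has_cycle b ({x \<in> A. b a x} \<union> B) (2 * j)"
    using assms b_symD by (intro complete_bipartite_cycle) (auto intro: finite_subset)
  moreover have "{x \<in> A. b a x} \<union> B \<subseteq> {x \<in> V. b a x}" using assms by auto
  ultimately show False using nw a assms(2) has_cycle_mono by blast
qed

text \<open>Blue degrees below \<open>j\<close> inside \<open>A\<close> mean red degrees of at least
  half of \<open>card A\<close>. As the red length \<open>2k + 1\<close> is missing,
  \<open>dense_degree\<close> gives equality, which leaves no slack in either number.\<close>

lemma side_degrees:
  assumes V: "finite V" "A \<subseteq> V" "B \<subseteq> V" "A \<inter> B = {}" "\<And>x y. x \<in> A \<Longrightarrow> y \<in> B \<Longrightarrow> b x y"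
    and j: "j \<le> card B" and kj: "1 \<le> k" "k < j"
    and nw: "\<And>h. h \<in> V \<Longrightarrow> \<not> has_cycle b {x \<in> V. b h x} (2 * j)"
    and nr: "\<not> has_cycle r V (2 * k + 1)" and A: "2 * j \<le> card A" and a: "a \<in> A"
  shows "card A = 2 * j" "card {x \<in> A. b a x} = j - 1"
proof -
  have finA: "finite A" using V by (auto intro: finite_subset)
  have blue: "card {x \<in> A. b v x} < j" if "v \<in> A" for v
    using hub_degree_in_side[OF V _ j nw that] kj by simp
  have sum: "card {x \<in> A. r v x} + card {x \<in> A. b v x} + 1 = card A" if "v \<in> A" for v
    using degree_sum[OF finA that] .
  have deg: "card A \<le> 2 * card {x \<in> A. r v x}" if "v \<in> A" for v
    using blue[OF that] sum[OF that] A by linarith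
  have "\<not> has_cycle r A (2 * k + 1)" using nr V(2) has_cycle_mono by blast
  then have "2 * card {x \<in> A. r a x} = card A"
    using dense_degree[OF r_sym r_irrefl finA deg _ _ _ a, of "2 * k + 1"] kj A by linarith
  then show "card A = 2 * j" "card {x \<in> A. b a x} = j - 1" using blue[OF a] sum[OF a] A by linarith+
qed

text \<open>Without a red edge across, the red degrees give each side at least \<open>j\<close>
  vertices and \<open>side_degrees\<close> at most \<open>2j\<close>, so the order of
  \<open>V\<close> leaves only sides of exactly \<open>2j\<close> vertices with blue degree
  \<open>j - 1\<close> inside. This is one short of the \<open>j\<close> neighbours that an
  alternating rim around \<open>a\<close> would take from \<open>A\<close>; a blue path with three
  vertices inside \<open>B\<close> makes up for it.\<close>

lemma red_between:
  assumes V: "finite V" "4 * j + 1 \<le> card V" and kj: "2 \<le> k" "k < j"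
    and deg: "\<And>v. v \<in> V \<Longrightarrow> j + 2 \<le> card {x \<in> V. r v x}"
    and nr: "\<not> has_cycle r V (2 * k + 1)"
    and nw: "\<And>h. h \<in> V \<Longrightarrow> \<not> has_cycle b {x \<in> V. b h x} (2 * j)"
    and S: "S \<subseteq> V" "card S \<le> 1" and AB: "A \<union> B = V - S" "A \<inter> B = {}" "A \<noteq> {}" "B \<noteq> {}"
  shows "\<exists>x\<in>A. \<exists>y\<in>B. r x y"
proof (rule ccontr)
  assume no: "\<not> ?thesis"
  have sub: "A \<subseteq> V" "B \<subseteq> V" using AB(1) by blast+
  have fin: "finite A" "finite B" "finite S" using V(1) sub S by (auto intro: finite_subset)
  have blue: "b x y" if "x \<in> A" "y \<in> B" for x y
  proof -
    have "x \<noteq> y" using that AB(2) by blast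
    then show ?thesis using no total that by blast
  qed
  have blue': "b x y" if "x \<in> B" "y \<in> A" for x y using blue[OF that(2,1)] by (rule b_symD)
  have AB': "B \<inter> A = {}" using AB(2) by blast
  have size: "j \<le> card X" if X: "X \<subseteq> V" "finite X" "x \<in> X" "\<And>y. y \<in> V \<Longrightarrow> r x y \<Longrightarrow> y \<in> X \<union> S" for X x
  proof -
    have "{y \<in> V. r x y} \<subseteq> X \<union> S" using X(4) by blast
    then have "card {y \<in> V. r x y} \<le> card (X \<union> S)" using X fin by (intro card_mono) auto
    also have "\<dots> \<le> card X + card S" by (rule card_Un_le)
    finally have "card {y \<in> V. r x y} \<le> card X + card S" .
    moreover have "j + 2 \<le> card {y \<in> V. r x y}" using deg X by blast
    ultimately show ?thesis using S(2) by linarith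
  qed
  obtain a x where ax: "a \<in> A" "x \<in> B" using AB by blast
  have cA: "j \<le> card A" using size[OF sub(1) fin(1) ax(1)] AB(1) no ax by blast
  have "r y z \<Longrightarrow> y \<in> B \<Longrightarrow> z \<in> A \<Longrightarrow> False" for y z using no r_symD by blast
  then have cB: "j \<le> card B" using size[OF sub(2) fin(2) ax(2)] AB(1) ax by blast
  have k1: "1 \<le> k" using kj by simp
  have leA: "card A \<le> 2 * j"
    using side_degrees(1)[OF V(1) sub AB(2) blue cB k1 kj(2) nw nr _ ax(1)] by linarith
  have leB: "card B \<le> 2 * j"
    using side_degrees(1)[OF V(1) sub(2,1) AB' blue' cA k1 kj(2) nw nr _ ax(2)] by linarith
  have "V = A \<union> B \<union> S" using AB(1) S(1) by blast
  then have "card V \<le> card A + card B + card S" using card_Un_le[of "A \<union> B" S] card_Un_le[of A B] by simp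
  then have eq: "card A = 2 * j" "card B = 2 * j" using leA leB V(2) S(2) by linarith+
  have dA: "card {y \<in> A. b a y} = j - 1"
    using side_degrees(2)[OF V(1) sub AB(2) blue cB k1 kj(2) nw nr _ ax(1)] eq by simp
  have dB: "card {y \<in> B. b x y} = j - 1"
    using side_degrees(2)[OF V(1) sub(2,1) AB' blue' cA k1 kj(2) nw nr _ ax(2)] eq by simp
  obtain xs where xs: "distinct xs" "set xs \<subseteq> {y \<in> A. b a y}" "length xs = j - 1"
    using obtain_distinct_list[of "{y \<in> A. b a y}" "j - 1"] dA fin by auto
  then obtain x1 xs' where x1: "xs = x1 # xs'" using kj by (cases xs) auto
  have "2 \<le> card {y \<in> B. b x y}" using dB kj by simp
  then obtain us where us: "distinct us" "set us \<subseteq> {y \<in> B. b x y}" "length us = 2"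
    using obtain_distinct_list[of "{y \<in> B. b x y}" 2] fin by auto
  then obtain y1 y2 where y: "us = [y1, y2]" by (metis length_0_conv length_Suc_conv numeral_2_eq_2)
  have yB: "y1 \<in> B" "y2 \<in> B" "y1 \<noteq> y2" "b x y1" "b x y2" "x \<noteq> y1" "x \<noteq> y2" using us y b_irrefl by auto
  have "card (B - {x, y1, y2}) = 2 * j - 3" using yB ax eq fin by (simp add: card_Diff_subset)
  then have "j - 2 \<le> card (B - {x, y1, y2})" using kj by simp
  then obtain ys where ys: "distinct ys" "set ys \<subseteq> B - {x, y1, y2}" "length ys = j - 2"
    using obtain_distinct_list[of "B - {x, y1, y2}"] fin by blast
  have mem: "set (y2 # ys) \<subseteq> B" "set xs' \<subseteq> A" "x1 \<in> A" "x1 \<notin> set xs'" "distinct xs'" using ys xs x1 yB by auto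
  have via: "viap b (y2 # ys) xs'"
  proof (rule viap_complete)
    show "length (y2 # ys) = Suc (length xs')" using ys(3) xs(3) x1 kj by simp
    show "b u y \<and> b y u" if "u \<in> set (y2 # ys)" "y \<in> set xs'" for u y
      using that mem(1,2) blue blue' by blast
  qed
  note w = viap_weave[OF via]
  have "last (y2 # ys) \<in> B" using mem(1) last_in_set[of "y2 # ys"] by blast
  then have e: "b (last (y2 # ys)) x1" "b x1 y1" "b y1 x" using blue blue' mem yB b_symD by blast+
  \<comment> \<open>Around the rim \<open>y1\<close>, \<open>x\<close>, \<open>y2\<close> are
    consecutive vertices of \<open>B\<close>; everywhere else vertices of \<open>A\<close> and
    \<open>B\<close> alternate. So it takes \<open>j - 1\<close> vertices from \<open>A\<close> and
    \<open>j + 1\<close> from \<open>B\<close>.\<close>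
  let ?C = "weave (y2 # ys) xs' @ [x1, y1, x]"
  have "cyc b ?C" unfolding cyc_def
  proof (intro conjI)
    have "set (y2 # ys) \<inter> set xs' = {}" using mem AB(2) by blast
    then have "distinct (weave (y2 # ys) xs')" using ys(1,2) mem(5) by (intro distinct_weave) auto
    moreover have "set (weave (y2 # ys) xs') \<inter> {x1, y1, x} = {}"
      using ys(2) yB mem ax AB(2) unfolding set_weave by auto
    moreover have "distinct [x1, y1, x]" using mem yB ax AB(2) by auto
    ultimately show "distinct ?C" by simp
    show "successively b ?C" using w e by (simp add: successively_append_iff)
    show "b (last ?C) (hd ?C)" using w yB by simp
  qed simp
  moreover have "set ?C \<subseteq> {y \<in> V. b a y}"
    using xs(2) x1 mem yB ax blue sub unfolding set_append set_weave by auto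
  moreover have "length ?C = 2 * j" using ys(3) xs(3) x1 kj by (simp add: length_weave)
  ultimately have "has_cycle b {y \<in> V. b a y} (2 * j)" by (rule has_cycleI)
  then show False using nw ax sub by blast
qed

end

section \<open>Graphs and adjacency\<close>

definition adj :: "'a graph \<Rightarrow> 'a \<Rightarrow> 'a \<Rightarrow> bool" where
  "adj G x y \<longleftrightarrow> {x, y} \<in> edges G"

lemma adj_commute: "adj G x y \<longleftrightarrow> adj G y x"
  by (simp add: adj_def insert_commute)

lemma adj_symp: "symp (adj G)"
  using adj_commute by (metis sympI)

lemma fin_graph_edge:
  assumes "fin_graph G" "e \<in> edges G"
  obtains x y where "e = {x, y}" "x \<noteq> y" "x \<in> verts G" "y \<in> verts G"
proof -
  have "card e = 2" "e \<subseteq> verts G" using assms by (auto simp: fin_graph_def)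
  then show thesis using that by (auto simp: card_2_iff)
qed

lemma fin_graph_adj: "fin_graph G \<Longrightarrow> adj G x y \<Longrightarrow> x \<in> verts G \<and> y \<in> verts G \<and> x \<noteq> y"
  by (auto simp: fin_graph_def adj_def)

lemma contains_cycle_iff:
  assumes "1 \<le> n"
  shows "contains_copy G (cycle_graph n) \<longleftrightarrow> has_cycle (adj G) (verts G) n"
proof
  assume "contains_copy G (cycle_graph n)"
  then obtain f where f: "inj_on f {..<n}" "f ` {..<n} \<subseteq> verts G" "\<forall>e\<in>{{i, Suc i mod n} |i. i < n}. f ` e \<in> edges G"
    unfolding contains_copy_def cycle_graph_def fst_conv snd_conv by blast
  have e: "adj G (f i) (f (Suc i mod n))" if "i < n" for i
  proof -
    have "{i, Suc i mod n} \<in> {{i, Suc i mod n} |i. i < n}" using that by blast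
    then have "f ` {i, Suc i mod n} \<in> edges G" using f(3) by blast
    then show ?thesis by (simp add: adj_def)
  qed
  have "has_cycle (adj G) (verts G) (length [0..<n])"
  proof (rule cycle_of_map[of f])
    show "successively (\<lambda>i j. adj G (f i) (f j)) [0..<n]"
      unfolding successively_upt using e by (metis Suc_lessD mod_less)
    show "adj G (f (last [0..<n])) (f (hd [0..<n]))" using e[of "n - 1"] assms by simp
  qed (use f(1,2) assms in \<open>auto simp: atLeast0LessThan\<close>)
  then show "has_cycle (adj G) (verts G) n" by simp
next
  assume "has_cycle (adj G) (verts G) n"
  then obtain f where f: "cfun (adj G) f n" "range f \<subseteq> verts G" using has_cycle_cfun by metis
  have e: "f (Suc i mod n) = f (Suc i)" for i using f(1) unfolding cfun_def by simp
  have "f ` {i, Suc i mod n} \<in> edges G" for i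
    unfolding image_insert image_empty e using f(1) unfolding cfun_def adj_def by blast
  moreover have "inj_on f {..<n}" using f(1) by (auto simp: inj_on_def cfun_def)
  ultimately show "contains_copy G (cycle_graph n)"
    unfolding contains_copy_def cycle_graph_def using f(2) by (intro exI[of _ f]) auto
qed

lemma contains_wheelI:
  assumes h: "h \<in> verts G" "has_cycle (adj G) {x \<in> verts G. adj G h x} n" and G: "fin_graph G" and n: "1 \<le> n"
  shows "contains_copy G (wheel_graph n)"
proof -
  obtain f where f: "cfun (adj G) f n" "range f \<subseteq> {x \<in> verts G. adj G h x}" using has_cycle_cfun[OF h(2)] by blast
  let ?g = "case_sum f (\<lambda>_. h)"
  have fx: "f i \<in> verts G" "adj G h (f i)" "f i \<noteq> h" for i using f(2) fin_graph_adj[OF G, of h "f i"] by auto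
  have "inj_on f {..<n}" using f(1) by (auto simp: inj_on_def cfun_def)
  then have "inj_on ?g ({..<n} <+> {..<1::nat})" using fx(3) fx(3)[symmetric] by (auto simp: inj_on_def simp del: One_nat_def)
  moreover have "?g ` ({..<n} <+> {..<1::nat}) \<subseteq> verts G" using fx h by auto
  moreover have e: "f (Suc i mod n) = f (Suc i)" for i using f(1) unfolding cfun_def by simp
  have edge: "{f i, f (Suc i mod n)} \<in> edges G" for i
    unfolding e using f(1) unfolding cfun_def adj_def by blast
  moreover have spoke: "{f i, h} \<in> edges G" for i using fx(2) adj_commute[of G h] by (simp add: adj_def)
  \<comment> \<open>The hub graph \<open>complete_graph 1\<close> has no edges, so every edge of the
    wheel is a rim edge or a spoke.\<close>
  moreover have none: "\<not> (e \<subseteq> {..<1::nat} \<and> card e = 2)" for e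
  proof
    assume e: "e \<subseteq> {..<1::nat} \<and> card e = 2"
    then have "card e \<le> card {..<1::nat}" by (intro card_mono) auto
    then show False using e by simp
  qed
  have "?g ` e \<in> edges G" if e: "e \<in> edges (wheel_graph n)" for e
  proof -
    have "(\<exists>i. e = Inl ` {i, Suc i mod n}) \<or> (\<exists>u v. e = {Inl u, Inr v})"
      using e none unfolding wheel_graph_def graph_join_def cycle_graph_def complete_graph_def fst_conv snd_conv
      by (elim UnE imageE CollectE) blast+
    then show ?thesis
    proof (elim disjE exE)
      fix i assume "e = Inl ` {i, Suc i mod n}"
      then have "?g ` e = {f i, f (Suc i mod n)}" by simp
      then show ?thesis using edge by simp
    next
      fix u v assume "e = {Inl u, Inr v}"
      then have "?g ` e = {f u, h}" by simp
      then show ?thesis using spoke by simp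
    qed
  qed
  moreover have "verts (wheel_graph n) = {..<n} <+> {..<1}"
    by (simp add: wheel_graph_def graph_join_def cycle_graph_def complete_graph_def)
  ultimately show ?thesis unfolding contains_copy_def by (intro exI[of _ ?g]) simp
qed

lemma degree_adj:
  assumes "fin_graph G" "v \<in> verts G"
  shows "degree G v = card {x \<in> verts G. adj G v x}"
proof -
  have inj: "inj_on (\<lambda>x. {v, x}) {x \<in> verts G. adj G v x}" by (auto simp: inj_on_def doubleton_eq_iff)
  have img: "(\<lambda>x. {v, x}) ` {x \<in> verts G. adj G v x} = {e \<in> edges G. v \<in> e}"
  proof
    show "{e \<in> edges G. v \<in> e} \<subseteq> (\<lambda>x. {v, x}) ` {x \<in> verts G. adj G v x}"
    proof
      fix e assume e: "e \<in> {e \<in> edges G. v \<in> e}"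
      then have eG: "e \<in> edges G" by simp
      obtain x y where xy: "e = {x, y}" "x \<in> verts G" "y \<in> verts G" by (rule fin_graph_edge[OF assms(1) eG])
      then have "\<exists>z\<in>verts G. e = {v, z}" using e by auto
      then show "e \<in> (\<lambda>x. {v, x}) ` {x \<in> verts G. adj G v x}" using eG by (auto simp: adj_def)
    qed
  qed (auto simp: adj_def)
  show ?thesis unfolding degree_def img[symmetric] by (rule card_image[OF inj])
qed

lemma min_degree_ge:
  assumes "fin_graph G" "verts G \<noteq> {}" "\<And>v. v \<in> verts G \<Longrightarrow> d \<le> card {x \<in> verts G. adj G v x}"
  shows "d \<le> min_degree G"
proof -
  have "finite (verts G)" using assms(1) by (simp add: fin_graph_def)
  then show ?thesis unfolding min_degree_def using assms degree_adj[OF assms(1)] by simp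
qed

lemma bipartite_imp:
  assumes "fin_graph G" "bipartite G"
  obtains A B where "A \<union> B = verts G" "A \<inter> B = {}" "\<And>x y. adj G x y \<Longrightarrow> x \<in> A \<longleftrightarrow> y \<in> B"
proof -
  obtain A B where AB: "A \<union> B = verts G" "A \<inter> B = {}" "\<forall>e\<in>edges G. \<exists>a\<in>A. \<exists>b\<in>B. e = {a, b}"
    using assms(2) unfolding bipartite_def by blast
  have "x \<in> A \<longleftrightarrow> y \<in> B" if "adj G x y" for x y
  proof -
    have "\<exists>a\<in>A. \<exists>c\<in>B. {x, y} = {a, c}" using AB(3) that unfolding adj_def by (rule bspec)
    then obtain a c where "a \<in> A" "c \<in> B" "{x, y} = {a, c}" by blast
    then show ?thesis using AB(2) by (auto simp: doubleton_eq_iff)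
  qed
  then show thesis using that AB by blast
qed

text \<open>If a vertex were unreachable after deleting \<open>S\<close>, the reachable vertices and
  the remaining ones would be two parts without an edge between them.\<close>

lemma two_connectedI:
  assumes G: "fin_graph G" "2 < card (verts G)"
    and cut: "\<And>S A B. S \<subseteq> verts G \<Longrightarrow> card S \<le> 1 \<Longrightarrow> A \<union> B = verts G - S \<Longrightarrow> A \<inter> B = {} \<Longrightarrow> A \<noteq> {} \<Longrightarrow> B \<noteq> {} \<Longrightarrow>
      \<exists>x\<in>A. \<exists>y\<in>B. adj G x y"
  shows "k_connected 2 G"
  unfolding k_connected_def
proof (intro conjI allI impI)
  fix S assume S: "S \<subseteq> verts G" "card S < 2"
  let ?D = "delete_verts G S"
  let ?R = "{(x, y). {x, y} \<in> edges ?D}\<^sup>*"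
  have fin: "finite S" "finite (verts G)" using S(1) G(1) by (auto simp: fin_graph_def intro: finite_subset)
  have "verts ?D \<noteq> {}"
  proof
    assume "verts ?D = {}"
    then have "verts G \<subseteq> S" by (simp add: delete_verts_def)
    then have "card (verts G) \<le> card S" by (rule card_mono[OF fin(1)])
    then show False using G(2) S(2) by linarith
  qed
  moreover have "(u, v) \<in> ?R" if uv: "u \<in> verts ?D" "v \<in> verts ?D" for u v
  proof (rule ccontr)
    assume n: "(u, v) \<notin> ?R"
    define A where "A = {x \<in> verts ?D. (u, x) \<in> ?R}"
    define B where "B = {x \<in> verts ?D. (u, x) \<notin> ?R}"
    have "A \<union> B = verts G - S" by (auto simp: A_def B_def delete_verts_def)
    moreover have "A \<inter> B = {}" "A \<noteq> {}" "B \<noteq> {}" using uv n by (auto simp: A_def B_def)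
    ultimately obtain x y where xy: "x \<in> A" "y \<in> B" "adj G x y" using cut[of S A B] S by auto
    then have "(x, y) \<in> {(x, y). {x, y} \<in> edges ?D}" by (auto simp: A_def B_def delete_verts_def adj_def)
    then have "(u, y) \<in> ?R" using xy(1) unfolding A_def by (blast intro: rtrancl_into_rtrancl)
    then show False using xy(2) by (simp add: B_def)
  qed
  ultimately show "connected_graph ?D" unfolding connected_graph_def by blast
qed (use G(2) in simp)

lemma circumference_ge:
  assumes "fin_graph G" "3 \<le> l" "has_cycle (adj G) (verts G) l"
  shows "l \<le> circumference G"
  unfolding circumference_def
proof (rule cSup_upper)
  show "l \<in> {t. 3 \<le> t \<and> contains_copy G (cycle_graph t)}" using assms contains_cycle_iff[of l G] by simp
  have "t \<le> card (verts G)" if "3 \<le> t" "contains_copy G (cycle_graph t)" for t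
    using has_cycle_le_card contains_cycle_iff[of t G] that assms(1) by (auto simp: fin_graph_def)
  then show "bdd_above {t. 3 \<le> t \<and> contains_copy G (cycle_graph t)}" by (auto intro!: bdd_aboveI)
qed

lemma admissible_pairD:
  fixes G :: "nat graph"
  assumes "admissible_pair \<alpha> \<beta>" and G: "fin_graph G" "verts G \<noteq> {}" "2 < card (verts G)"
    and cut: "\<And>S A B. S \<subseteq> verts G \<Longrightarrow> card S \<le> 1 \<Longrightarrow> A \<union> B = verts G - S \<Longrightarrow> A \<inter> B = {} \<Longrightarrow> A \<noteq> {} \<Longrightarrow> B \<noteq> {} \<Longrightarrow>
      \<exists>x\<in>A. \<exists>y\<in>B. adj G x y"
    and bip: "\<not> bipartite G"
    and deg: "\<And>v. v \<in> verts G \<Longrightarrow> d \<le> card {x \<in> verts G. adj G v x}" "\<alpha> * real (card (verts G)) + \<beta> \<le> real d"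
    and l: "3 \<le> l" "has_cycle (adj G) (verts G) l" and t: "6 \<le> t" "t \<le> l"
  shows "has_cycle (adj G) (verts G) t"
proof -
  have "d \<le> min_degree G" using min_degree_ge[OF G(1,2)] deg(1) by blast
  then have "\<alpha> * real (card (verts G)) + \<beta> \<le> real (min_degree G)" using deg(2) by linarith
  moreover have "k_connected 2 G" using two_connectedI[OF G(1,3)] cut by blast
  moreover have "t \<le> circumference G" using circumference_ge[OF G(1) l] t by linarith
  ultimately have "contains_copy G (cycle_graph t)" using assms(1) G(1) bip t(1) unfolding admissible_pair_def by blast
  then show ?thesis using contains_cycle_iff[of t G] t by simp
qed

section \<open>A constraint on admissible pairs\<close>

text \<open>Three copies of \<open>K\<^sub>5\<close> minus an edge form a ring: two pairs of neighbouring copies share a vertex (7 and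
  11), and the edge between 2 and 3 links the third pair. A cycle of length 6 would fit into no copy and would be too
  short to pass through all of them, although the minimum degree is 4 and there is a Hamiltonian cycle.\<close>

definition ring_nbrs :: "nat \<Rightarrow> nat list" where
  "ring_nbrs v = [[1, 2, 11, 12], [0, 2, 11, 12], [0, 1, 3, 12], [2, 4, 5, 6], [3, 5, 6, 7], [3, 4, 6, 7], [3, 4, 5, 7],
     [4, 5, 6, 8, 9, 10], [7, 9, 10, 11], [7, 8, 10, 11], [7, 8, 9, 11], [0, 1, 8, 9, 10, 12], [0, 1, 2, 11]] ! v"

lemma ring_nbrs_simps:
  "ring_nbrs 0 = [1, 2, 11, 12]" "ring_nbrs 1 = [0, 2, 11, 12]" "ring_nbrs 2 = [0, 1, 3, 12]" "ring_nbrs 3 = [2, 4, 5, 6]"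
  "ring_nbrs 4 = [3, 5, 6, 7]" "ring_nbrs 5 = [3, 4, 6, 7]" "ring_nbrs 6 = [3, 4, 5, 7]" "ring_nbrs 7 = [4, 5, 6, 8, 9, 10]"
  "ring_nbrs 8 = [7, 9, 10, 11]" "ring_nbrs 9 = [7, 8, 10, 11]" "ring_nbrs 10 = [7, 8, 9, 11]"
  "ring_nbrs 11 = [0, 1, 8, 9, 10, 12]" "ring_nbrs 12 = [0, 1, 2, 11]"
  by (simp_all add: ring_nbrs_def)

lemma less_13: "v < 13 \<longleftrightarrow> v \<in> set [0, 1, 2, 3, 4, 5, 6, 7, 8, 9, 10, 11, 12 :: nat]"
  by (simp del: One_nat_def) presburger

text \<open>An exhaustive search by rewriting over walks with six vertices, in which a branch ends
  as soon as a vertex repeats. Consecutive vertices differ already because no vertex is its own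
  neighbour.\<close>

lemma ring_nbrs_no_six_cycle:
  "list_all (\<lambda>a. list_all (\<lambda>b. list_all (\<lambda>c. c = a \<or> list_all (\<lambda>d. d = a \<or> d = b \<or> list_all (\<lambda>e. e = a \<or> e = b \<or> e = c \<or>
     list_all (\<lambda>f. f = b \<or> f = c \<or> f = d \<or> a \<notin> set (ring_nbrs f) \<or> f = a) (ring_nbrs e)) (ring_nbrs d)) (ring_nbrs c)) (ring_nbrs b)) (ring_nbrs a)) 
   [0, 1, 2, 3, 4, 5, 6, 7, 8, 9, 10, 11, 12]"
  by (simp add: ring_nbrs_simps del: One_nat_def)

lemma successively_crosses:
  assumes "successively E xs" "set xs \<subseteq> A \<union> B" "A \<inter> B = {}" "x \<in> set xs \<inter> A" "y \<in> set xs \<inter> B"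
  shows "\<exists>u\<in>A. \<exists>v\<in>B. E u v \<or> E v u"
  using assms
proof (induction xs arbitrary: x y rule: induct_list012)
  case (3 z1 z2 zs)
  show ?case
  proof (rule ccontr)
    assume n: "\<not> ?case"
    have z: "E z1 z2" "z1 \<in> A \<union> B" "z2 \<in> A \<union> B" using 3(3,4) by auto
    then have side: "z1 \<in> A \<longleftrightarrow> z2 \<in> A" "z1 \<in> B \<longleftrightarrow> z2 \<in> B" using n 3(5) by blast+
    have suc: "successively E (z2 # zs)" "set (z2 # zs) \<subseteq> A \<union> B" using 3(3,4) by auto
    have "(if x = z1 then z2 else x) \<in> set (z2 # zs) \<inter> A" "(if y = z1 then z2 else y) \<in> set (z2 # zs) \<inter> B"
      using 3(6,7) side by auto
    then show False using 3(2)[OF suc 3(5)] n by blast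
  qed
qed auto

text \<open>Deleting at most one vertex from a Hamiltonian cycle leaves a path through all the
  others, and this path has to cross from \<open>A\<close> to \<open>B\<close>.\<close>

lemma hamiltonian_no_cut:
  assumes C: "cyc E C" "symp E" and S: "card S \<le> 1" "finite S" "S \<subseteq> set C"
    and AB: "A \<union> B = set C - S" "A \<inter> B = {}" "A \<noteq> {}" "B \<noteq> {}"
  shows "\<exists>x\<in>A. \<exists>y\<in>B. E x y"
proof -
  have "\<exists>xs. successively E xs \<and> set xs = A \<union> B"
  proof (cases "S = {}")
    case True
    then show ?thesis using C AB by (auto simp: cyc_def)
  next
    case False
    then obtain s where s: "S = {s}" using S by (metis card_1_singletonE card_0_eq le_antisym less_one not_less_eq_eq One_nat_def linorder_not_le)
    then have "s \<in> set C" using S by blast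
    then obtain n rest where n: "rotate n C = s # rest" using rotate_to_hd by metis
    have "cyc E (s # rest)" using C(1) n cyc_rotate by metis
    then have "successively E rest" "s \<notin> set rest" by (auto simp: cyc_def successively_Cons)
    moreover have "set C = insert s (set rest)" using n by (metis set_rotate list.simps(15))
    ultimately show ?thesis using AB(1) s by (intro exI[of _ rest]) auto
  qed
  then obtain xs where xs: "successively E xs" "set xs = A \<union> B" by blast
  obtain x y where "x \<in> set xs \<inter> A" "y \<in> set xs \<inter> B" using xs(2) AB by blast
  then show ?thesis using successively_crosses[OF xs(1) _ AB(2)] xs(2) sympD[OF C(2)] by blast
qed

definition ring_graph :: "nat graph" where
  "ring_graph = ({..<13}, {{x, y} |x y. x < 13 \<and> y \<in> set (ring_nbrs x)})"

lemma ring_nbrs_symmetric: "x < 13 \<Longrightarrow> y \<in> set (ring_nbrs x) \<Longrightarrow> y < 13 \<and> x \<noteq> y \<and> x \<in> set (ring_nbrs y)"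
proof -
  have "list_all (\<lambda>x. list_all (\<lambda>y. y < 13 \<and> x \<noteq> y \<and> x \<in> set (ring_nbrs y)) (ring_nbrs x))
    [0, 1, 2, 3, 4, 5, 6, 7, 8, 9, 10, 11, 12]"
    by (simp add: ring_nbrs_simps del: One_nat_def)
  then show "x < 13 \<Longrightarrow> y \<in> set (ring_nbrs x) \<Longrightarrow> y < 13 \<and> x \<noteq> y \<and> x \<in> set (ring_nbrs y)"
    unfolding list_all_iff less_13[of x] by blast
qed

lemma adj_ring_graph: "adj ring_graph x y \<longleftrightarrow> x < 13 \<and> y \<in> set (ring_nbrs x)"
proof
  assume "adj ring_graph x y"
  then obtain u v where "{x, y} = {u, v}" "u < 13" "v \<in> set (ring_nbrs u)" by (auto simp: adj_def ring_graph_def)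
  then show "x < 13 \<and> y \<in> set (ring_nbrs x)" using ring_nbrs_symmetric[of u v] by (auto simp: doubleton_eq_iff)
qed (auto simp: adj_def ring_graph_def)

lemma verts_ring_graph: "verts ring_graph = {..<13}"
  by (simp add: ring_graph_def)

lemma fin_ring_graph: "fin_graph ring_graph"
  unfolding fin_graph_def
proof (intro conjI ballI)
  fix e assume "e \<in> edges ring_graph"
  then obtain x y where "e = {x, y}" "x < 13" "y \<in> set (ring_nbrs x)" by (auto simp: ring_graph_def)
  then show "e \<subseteq> verts ring_graph" "card e = 2" using ring_nbrs_symmetric[of x y] by (auto simp: verts_ring_graph)
qed (simp add: verts_ring_graph)

lemma no_ring_six_cycle: "\<not> has_cycle (adj ring_graph) S 6"
proof
  assume "has_cycle (adj ring_graph) S 6"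
  then obtain xs where xs: "cyc (adj ring_graph) xs" "length xs = 6" by (auto simp: has_cycle_def)
  obtain x0 x1 x2 x3 x4 x5 where eq: "xs = [x0, x1, x2, x3, x4, x5]"
    using xs(2) by (auto simp: numeral_eq_Suc length_Suc_conv)
  have e: "x1 \<in> set (ring_nbrs x0)" "x2 \<in> set (ring_nbrs x1)" "x3 \<in> set (ring_nbrs x2)" "x4 \<in> set (ring_nbrs x3)"
    "x5 \<in> set (ring_nbrs x4)" "x0 \<in> set (ring_nbrs x5)" "x0 < 13"
    and d: "distinct [x0, x1, x2, x3, x4, x5]"
    using xs(1) unfolding eq cyc_def adj_ring_graph by simp_all
  have "x0 \<in> set [0, 1, 2, 3, 4, 5, 6, 7, 8, 9, 10, 11, 12]" using e(7) less_13 by blast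
  then show False using ring_nbrs_no_six_cycle e d unfolding list_all_iff by (metis distinct_length_2_or_more distinct.simps(2) list.set_intros)
qed

lemma ring_hamiltonian: "cyc (adj ring_graph) [0, 1, 2, 3, 4, 5, 6, 7, 8, 9, 10, 11, 12]"
  by (simp add: cyc_def adj_ring_graph ring_nbrs_simps del: One_nat_def)

lemma admissible_pair_bound:
  assumes "admissible_pair \<alpha> \<beta>"
  shows "4 < 13 * \<alpha> + \<beta>"
proof (rule ccontr)
  assume n: "\<not> ?thesis"
  let ?C = "[0, 1, 2, 3, 4, 5, 6, 7, 8, 9, 10, 11, 12 :: nat]"
  have setC: "set ?C = {..<13}" using less_13 by blast
  have "has_cycle (adj ring_graph) (verts ring_graph) 6"
  proof (rule admissible_pairD[OF assms fin_ring_graph, of 4 13 6])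
    show "\<exists>x\<in>A. \<exists>y\<in>B. adj ring_graph x y"
      if "S \<subseteq> verts ring_graph" "card S \<le> 1" "A \<union> B = verts ring_graph - S" "A \<inter> B = {}" "A \<noteq> {}" "B \<noteq> {}" for S A B
      using hamiltonian_no_cut[OF ring_hamiltonian adj_symp that(2) _ _ _ that(4-6)] that(1,3) setC
      by (auto simp: verts_ring_graph intro: finite_subset)
    show "\<not> bipartite ring_graph"
    proof
      assume "bipartite ring_graph"
      then obtain A B where AB: "A \<union> B = verts ring_graph" "A \<inter> B = {}" "\<And>x y. adj ring_graph x y \<Longrightarrow> x \<in> A \<longleftrightarrow> y \<in> B"
        using bipartite_imp[OF fin_ring_graph] by blast
      have "adj ring_graph 0 1" "adj ring_graph 1 2" "adj ring_graph 0 2"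
        by (simp_all add: adj_ring_graph ring_nbrs_simps del: One_nat_def)
      then have "0 \<in> A \<longleftrightarrow> 1 \<in> B" "1 \<in> A \<longleftrightarrow> 2 \<in> B" "0 \<in> A \<longleftrightarrow> 2 \<in> B" using AB(3) by blast+
      moreover have "0 \<in> A \<union> B" "1 \<in> A \<union> B" "2 \<in> A \<union> B" by (simp_all add: AB(1) verts_ring_graph)
      moreover have "adj ring_graph 1 0" "adj ring_graph 2 1" "adj ring_graph 2 0"
        by (simp_all add: adj_ring_graph ring_nbrs_simps del: One_nat_def)
      then have "1 \<in> A \<longleftrightarrow> 0 \<in> B" "2 \<in> A \<longleftrightarrow> 1 \<in> B" "2 \<in> A \<longleftrightarrow> 0 \<in> B" using AB(3) by blast+
      ultimately show False using AB(2) by blast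
    qed
    show "4 \<le> card {x \<in> verts ring_graph. adj ring_graph v x}" if "v \<in> verts ring_graph" for v
    proof -
      have v: "v < 13" using that by (simp add: verts_ring_graph)
      have "list_all (\<lambda>v. distinct (ring_nbrs v) \<and> 4 \<le> length (ring_nbrs v)) ?C"
        by (simp add: ring_nbrs_simps del: One_nat_def)
      then have "distinct (ring_nbrs v)" "4 \<le> length (ring_nbrs v)" using v unfolding list_all_iff less_13 by blast+
      moreover have "{x \<in> verts ring_graph. adj ring_graph v x} = set (ring_nbrs v)"
        using ring_nbrs_symmetric[OF v] v by (auto simp: verts_ring_graph adj_ring_graph)
      ultimately show ?thesis by (simp add: distinct_card)
    qed
    show "has_cycle (adj ring_graph) (verts ring_graph) 13"
      by (rule has_cycleI[OF ring_hamiltonian]) (simp_all add: setC verts_ring_graph)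
  qed (use n in \<open>auto simp: verts_ring_graph lessThan_empty_iff\<close>)
  then show False using no_ring_six_cycle by blast
qed

section \<open>Combining the two degree cases\<close>

lemma has_cycle_weaken:
  assumes "has_cycle E S n" "\<And>x y. x \<in> S \<Longrightarrow> y \<in> S \<Longrightarrow> E x y \<Longrightarrow> F x y" "S \<subseteq> T"
  shows "has_cycle F T n"
proof -
  obtain xs where xs: "cyc E xs" "set xs \<subseteq> S" "length xs = n" using assms(1) by (auto simp: has_cycle_def)
  have "F (xs ! i) (xs ! Suc i)" if "Suc i < length xs" for i
  proof (rule assms(2))
    show "xs ! i \<in> S" "xs ! Suc i \<in> S" using xs(2) that by (auto intro!: subsetD[OF xs(2)] nth_mem)
    show "E (xs ! i) (xs ! Suc i)" using xs(1) that by (auto simp: cyc_def successively_conv_nth)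
  qed
  moreover have "F (last xs) (hd xs)"
    using xs(1,2) assms(2) last_in_set[of xs] hd_in_set[of xs] unfolding cyc_def by blast
  ultimately have "cyc F xs" using xs(1) by (auto simp: cyc_def successively_conv_nth)
  then show ?thesis by (rule has_cycleI) (use xs assms(3) in auto)
qed

lemma ramsey_property_of_degree:
  fixes j k N :: nat
  assumes "admissible_pair \<alpha> \<beta>" and kj: "3 \<le> k" "k < j" and N: "4 * j + 1 \<le> N" "\<alpha> * real N + \<beta> + 3 * real j \<le> real N + 1"
  shows "ramsey_property N (cycle_graph (2 * k + 1)) (wheel_graph (2 * j))"
  unfolding ramsey_property_def
proof (intro allI impI)
  fix R assume R: "R \<subseteq> edges (complete_graph N)"
  let ?V = "verts (complete_graph N)"
  let ?G = "(?V, R)" and ?B = "(?V, edges (complete_graph N) - R)"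
  have V: "?V = {..<N}" by (simp add: complete_graph_def)
  have fin: "fin_graph ?G" "fin_graph ?B" using R by (auto simp: fin_graph_def complete_graph_def)
  define r where "r = adj ?G"
  \<comment> \<open>Pairs that leave the vertex set count as blue, which makes the colouring total
    on the type; \<open>blue\<close> below translates back to the blue graph.\<close>
  define b where "b x y \<longleftrightarrow> x \<noteq> y \<and> \<not> r x y" for x y
  have r_irr: "\<not> r x x" for x using fin_graph_adj[OF fin(1)] unfolding r_def by blast
  interpret two_coloring r b
  proof
    show "symp r" unfolding r_def by (rule adj_symp)
    show "symp b" unfolding b_def r_def by (rule sympI) (simp add: adj_commute)
  qed (use r_irr in \<open>auto simp: b_def\<close>)
  have blue: "adj ?B x y" if "b x y" "x \<in> ?V" "y \<in> ?V" for x y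
    using that unfolding b_def r_def adj_def by (auto simp: complete_graph_def)
  have finV: "finite ?V" "card ?V = N" by (simp_all add: V)
  show "contains_copy ?G (cycle_graph (2 * k + 1)) \<or> contains_copy ?B (wheel_graph (2 * j))"
  proof (rule ccontr)
    assume no: "\<not> ?thesis"
    then have nr: "\<not> has_cycle r ?V (2 * k + 1)" using contains_cycle_iff[of "2 * k + 1" ?G] by (simp add: r_def)
    have nw: "\<not> has_cycle b {x \<in> ?V. b h x} (2 * j)" if h: "h \<in> ?V" for h
    proof
      assume "has_cycle b {x \<in> ?V. b h x} (2 * j)"
      then have "has_cycle (adj ?B) {x \<in> verts ?B. adj ?B h x} (2 * j)"
        by (rule has_cycle_weaken) (use blue h in auto)
      then have "contains_copy ?B (wheel_graph (2 * j))"
        using contains_wheelI[of h ?B "2 * j"] h fin(2) kj by simp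
      then show False using no by blast
    qed
    have deg: "N + 1 \<le> card {x \<in> ?V. r v x} + 3 * j" if v: "v \<in> ?V" for v
    proof (rule ccontr)
      assume "\<not> ?thesis"
      then have "3 * j \<le> card {x \<in> ?V. b v x} + 1" using degree_sum[OF finV(1) v] finV(2) by linarith
      then show False using blue_wheel_of_blue_degree[OF finV(1) _ v _ kj nr] N(1) finV(2) nw by auto
    qed
    have deg': "j + 2 \<le> card {x \<in> ?V. r v x}" if "v \<in> ?V" for v using deg[OF that] N(1) by linarith
    have cut: "\<exists>x\<in>A. \<exists>y\<in>B. r x y"
      if "S \<subseteq> ?V" "card S \<le> 1" "A \<union> B = ?V - S" "A \<inter> B = {}" "A \<noteq> {}" "B \<noteq> {}" for S A B
      by (rule red_between[OF finV(1) _ _ kj(2) deg' nr nw that]) (use kj N finV in simp_all)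
    have "\<exists>x\<in>A. \<exists>y\<in>?V - A. r x y" if "A \<subseteq> ?V" "A \<noteq> {}" "A \<noteq> ?V" for A
      using cut[of "{}" A "?V - A"] that by auto
    then obtain l where l: "2 * k + 1 \<le> l" "has_cycle r ?V l"
      using long_red_cycle[OF finV(1) _ _ kj(2) deg' _ nw] N(1) finV(2) kj by auto
    have small: "card S \<le> 2 * j" if S: "b_clique S" "S \<subseteq> ?V" for S
    proof (rule ccontr)
      assume "\<not> ?thesis"
      then have "\<exists>h\<in>?V. has_cycle b {x \<in> ?V. b h x} (2 * j)"
        using kj by (intro b_clique_wheel[OF S(1) finV(1) S(2)]) auto
      then show False using nw by blast
    qed
    have "\<not> bipartite ?G"
    proof
      assume "bipartite ?G"
      then obtain X Y where XY: "X \<union> Y = ?V" "X \<inter> Y = {}" "\<And>x y. r x y \<Longrightarrow> x \<in> X \<longleftrightarrow> y \<in> Y"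
        using bipartite_imp[OF fin(1)] unfolding r_def by auto
      have "b_clique X" using XY(2,3) by (auto simp: b_clique_def b_def)
      moreover have "b_clique Y" using XY(2,3) r_symD by (auto simp: b_clique_def b_def)
      moreover have "X \<subseteq> ?V" "Y \<subseteq> ?V" using XY(1) by blast+
      ultimately have "card X \<le> 2 * j" "card Y \<le> 2 * j" using small by blast+
      moreover have "N \<le> card X + card Y" using card_Un_le[of X Y] XY(1) finV(2) by simp
      ultimately show False using N(1) by linarith
    qed
    have "has_cycle (adj ?G) (verts ?G) (2 * k + 1)"
    proof (rule admissible_pairD[OF assms(1) fin(1) _ _ _ \<open>\<not> bipartite ?G\<close>])
      show "\<exists>x\<in>A. \<exists>y\<in>B. adj ?G x y"
        if "S \<subseteq> verts ?G" "card S \<le> 1" "A \<union> B = verts ?G - S" "A \<inter> B = {}" "A \<noteq> {}" "B \<noteq> {}" for S A B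
        using cut[of S A B] that unfolding r_def by simp
      show "N + 1 - 3 * j \<le> card {x \<in> verts ?G. adj ?G v x}" if "v \<in> verts ?G" for v
        using deg[of v] that unfolding r_def by simp
      have "3 * j \<le> N + 1" using N(1) by linarith
      then show "\<alpha> * real (card (verts ?G)) + \<beta> \<le> real (N + 1 - 3 * j)" using N(2) finV by (simp add: of_nat_diff)
      show "has_cycle (adj ?G) (verts ?G) l" using l(2) unfolding r_def by simp
      show "verts ?G \<noteq> {}" "2 < card (verts ?G)" using N(1) kj finV by auto
    qed (use l(1) kj in auto)
    then have "has_cycle r ?V (2 * k + 1)" unfolding r_def by simp
    then show False using nr by blast
  qed
qed

theorem theorem25:
  fixes \<alpha> \<beta> :: real and k j :: nat
  assumes "admissible_pair \<alpha> \<beta>"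
    and "2 < k" and "k < j"
  shows "real (ramsey_number (cycle_graph (2 * k + 1)) (wheel_graph (2 * j)))
           \<le> (3 * real j + \<beta>) / (1 - \<alpha>)"
proof -
  have a: "1 / 4 \<le> \<alpha>" "\<alpha> < 1" "0 < \<beta>" using assms(1) by (auto simp: admissible_pair_def)
  define Q where "Q = (3 * real j + \<beta>) / (1 - \<alpha>)"
  define N where "N = nat \<lfloor>Q\<rfloor>"
  have Q: "Q * (1 - \<alpha>) = 3 * real j + \<beta>" using a by (simp add: Q_def)
  have "0 \<le> Q" using a by (simp add: Q_def)
  then have N: "real N \<le> Q" "Q < real N + 1" by (simp_all add: N_def)
  \<comment> \<open>This says \<open>4j\<alpha> \<ge> j - 3 + 12\<alpha>\<close>. With
    \<open>13\<alpha> + \<beta> > 4\<close> it follows that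
    \<open>(4j + 1)\<alpha> + \<beta> > j + 1\<close>, which rearranges to the next
    inequality.\<close>
  have "0 \<le> (real j - 3) * (4 * \<alpha> - 1)" using a assms by (intro mult_nonneg_nonneg) auto
  then have "(4 * real j + 1) * (1 - \<alpha>) \<le> Q * (1 - \<alpha>)"
    using admissible_pair_bound[OF assms(1)] unfolding Q by (simp add: algebra_simps)
  then have "4 * real j + 1 \<le> Q" using a by simp
  then have "4 * j + 1 \<le> N" unfolding N_def by linarith
  moreover have "Q * (1 - \<alpha>) \<le> (real N + 1) * (1 - \<alpha>)" using N(2) a by (intro mult_right_mono) auto
  then have "\<alpha> * real N + \<beta> + 3 * real j \<le> real N + 1" using a unfolding Q by (simp add: algebra_simps)
  ultimately have "ramsey_property N (cycle_graph (2 * k + 1)) (wheel_graph (2 * j))"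
    using ramsey_property_of_degree[OF assms(1)] assms by simp
  then have "ramsey_number (cycle_graph (2 * k + 1)) (wheel_graph (2 * j)) \<le> N"
    unfolding ramsey_number_def by (rule Least_le)
  then show ?thesis using N(1) unfolding Q_def by linarith
qed

end
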